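(* (Monodromy space of type $(1,-,1)$, Painlevé III($D_6$).) Let $AnalyticData$ be the affine variety of pairs $(m,L)$ with $m=\begin{pmatrix}m_1&m_2\\ m_3&m_4\end{pmatrix}$, $L=\begin{pmatrix}\ell_1&\ell_2\\ \ell_3&\ell_4\end{pmatrix}$ in $SL_2(\mathbb{C})$ such that $\alpha:=m_1\neq0$ and $\beta:=\ell_1\ell_4m_1+\ell_2\ell_4m_3-\ell_1\ell_3m_2-\ell_2\ell_3m_4\ne0$ (the $(1,1)$-entry of $LmL^{-1}$). Let $(\gamma,\delta)\in\mathbb{G}_m\times\mathbb{G}_m$ act by $$m\mapsto\begin{pmatrix}m_1&\gamma^2m_2\\ \gamma^{-2}m_3&m_4\end{pmatrix},\qquad L\mapsto\begin{pmatrix}\gamma^{-1}\delta\,\ell_1&\gamma\delta\,\ell_2\\ \gamma^{-1}\delta^{-1}\ell_3&\gamma\delta^{-1}\ell_4\end{pmatrix},$$ and let $\mathcal{R}=AnalyticData/\!/(\mathbb{G}_m\times\mathbb{G}_m)$ with the morphism $(\alpha,\beta):\mathcal{R}\to\mathcal{P}=\mathbb{C}^*\times\mathbb{C}^*$. Then $\mathcal{R}\to\mathcal{P}$ is isomorphic over $\mathcal{P}$ to the family of affine cubic surfaces $$x_1x_2x_3+x_1^2+x_2^2+(1+\alpha\beta)x_1+(\alpha+\beta)x_2+\alpha\beta=0 .$$ The singular locus of $\mathcal{R}$ consists of the two disjoint curves $$\alpha=\beta,\ (x_1,x_2,x_3)=(0,-\alpha,\alpha+\alpha^{-1})\quad\text{and}\quad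 \alpha=\beta^{-1},\ (x_1,x_2,x_3)=(-1,0,\alpha+\alpha^{-1}).$$ The fibre over $(\alpha,\beta)$ is non-singular if $\alpha\ne\beta,\beta^{-1}$; the singular points of the fibres are exactly their intersections with these two curves, and they are of type $A_1$. If $\alpha\neq\pm1$ and $\beta=\alpha^{\pm1}$ the fibre has exactly one singular point; if $\alpha=\beta=\pm1$ the fibre has exactly two singular points.
   Context: $X/\!/G$ denotes the categorical quotient $\mathrm{Spec}(\mathcal{O}(X)^G)$ of an affine variety by a reductive group. A surface singularity is of type $A_n$ if it is locally analytically given by $x^2+y^2+z^{n+1}=0$. Origin of the data: rank-two differential modules on $\mathbb{P}^1$ (trivial determinant), singular only at $0,\infty$, both unramified irregular of Katz invariant $1$; $m$ is the topological monodromy at $0$ (product of the formal monodromy $\mathrm{diag}(\alpha,\alpha^{-1})$ and two Stokes matrices), $L$ is the link between the formal solution spaces at $0$ and $\infty$, $\beta$ is the eigenvalue of the formal monodromy at $\infty$, and the group is the group of base changes of the formal solution spaces preserving their decompositions. *)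

theory Defs
  imports "HOL-Analysis.Analysis" "HOL-Algebra.Ideal_Product" "HOL-Algebra.QuotRing"
begin

section \<open>Affine varieties and schemes through their coordinate rings\<close>

text \<open>
  An affine scheme of finite type over the complex numbers is represented by its coordinate ring,
  a HOL-Algebra ring, together with the map embedding the scalars; a morphism is represented by
  the ring homomorphism in the opposite direction.
\<close>

inductive_set regular_functions :: "'a set \<Rightarrow> ('a \<Rightarrow> complex) set \<Rightarrow> ('a \<Rightarrow> complex) set"
  for X :: "'a set" and G :: "('a \<Rightarrow> complex) set" where
  const: "(\<lambda>x\<in>X. c) \<in> regular_functions X G"
| gen: "g \<in> G \<Longrightarrow> restrict g X \<in> regular_functions X G"
| add: "f \<in> regular_functions X G \<Longrightarrow> g \<in> regular_functions X G
        \<Longrightarrow> (\<lambda>x\<in>X. f x + g x) \<in> regular_functions X G"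
| mult: "f \<in> regular_functions X G \<Longrightarrow> g \<in> regular_functions X G
        \<Longrightarrow> (\<lambda>x\<in>X. f x * g x) \<in> regular_functions X G"

text \<open>
  The coordinate ring of the variety with set of points \<open>X\<close>, where \<open>G\<close> consists of the ambient
  coordinates and of the inverses of those functions that are required not to vanish on \<open>X\<close>.
\<close>
definition coordinate_ring :: "'a set \<Rightarrow> ('a \<Rightarrow> complex) set \<Rightarrow> ('a \<Rightarrow> complex) ring" where
  "coordinate_ring X G =
     \<lparr>carrier = regular_functions X G,
      mult = (\<lambda>f g. \<lambda>x\<in>X. f x * g x), one = (\<lambda>x\<in>X. 1),
      zero = (\<lambda>x\<in>X. 0), add = (\<lambda>f g. \<lambda>x\<in>X. f x + g x)\<rparr>"

definition complex_ring :: "complex ring" where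
  "complex_ring = \<lparr>carrier = UNIV, mult = (*), one = 1, zero = 0, add = (+)\<rparr>"

text \<open>
  \<open>\<iota>\<close> embeds the scalars. The closed points of the spectrum of a finitely generated
  algebra are its complex points, i.e. the homomorphisms of algebras to the complex numbers; the
  corresponding maximal ideal is the kernel.
\<close>
definition points :: "('b, 'm) ring_scheme \<Rightarrow> (complex \<Rightarrow> 'b) \<Rightarrow> ('b \<Rightarrow> complex) set" where
  "points B \<iota> = {p \<in> ring_hom B complex_ring. p \<in> extensional (carrier B) \<and> (\<forall>c. p (\<iota> c) = c)}"

abbreviation max_ideal :: "('b, 'm) ring_scheme \<Rightarrow> ('b \<Rightarrow> complex) \<Rightarrow> 'b set" where
  "max_ideal B p \<equiv> a_kernel B complex_ring p"


section \<open>Non-singular points\<close>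

text \<open>The Krull dimension of the localization of \<open>B\<close> at the prime ideal \<open>M\<close>.\<close>
definition height :: "('b, 'm) ring_scheme \<Rightarrow> 'b set \<Rightarrow> enat" where
  "height B M = Sup {enat n | n. \<exists>C :: nat \<Rightarrow> 'b set.
     (\<forall>i\<le>n. primeideal (C i) B) \<and> (\<forall>i<n. C i \<subset> C (Suc i)) \<and> C n = M}"

text \<open>
  The dimension of \<open>M/M\<^sup>2\<close> over the residue field \<open>B/M\<close>, as the least size of a
  generating system. For a maximal ideal \<open>M\<close>, this vector space does not change if \<open>B\<close> is replaced
  by its localization at \<open>M\<close>.
\<close>
definition cotangent_dim :: "('b, 'm) ring_scheme \<Rightarrow> 'b set \<Rightarrow> enat" where
  "cotangent_dim B M = Inf {enat (card S) | S. finite S \<and> S \<subseteq> M \<and>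
     M = genideal B S <+>\<^bsub>B\<^esub> (M \<cdot>\<^bsub>B\<^esub> M)}"

text \<open>The local ring of \<open>B\<close> (assumed noetherian) at the maximal ideal \<open>M\<close> is regular.\<close>
definition regular_at :: "('b, 'm) ring_scheme \<Rightarrow> 'b set \<Rightarrow> bool" where
  "regular_at B M \<longleftrightarrow> (\<exists>n. height B M = enat n \<and> cotangent_dim B M = enat n)"

definition singular_points :: "('b, 'm) ring_scheme \<Rightarrow> (complex \<Rightarrow> 'b) \<Rightarrow> ('b \<Rightarrow> complex) set" where
  "singular_points B \<iota> = {p \<in> points B \<iota>. \<not> regular_at B (max_ideal B p)}"


section \<open>Surface singularities of type A\<close>

definition holomorphic_on_vec :: "(complex^'n \<Rightarrow> complex) \<Rightarrow> (complex^'n) set \<Rightarrow> bool" where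
  "holomorphic_on_vec f U \<longleftrightarrow> open U \<and>
     (\<forall>z\<in>U. \<exists>D. (f has_derivative D) (at z) \<and> (\<forall>c v. D (c *s v) = c * D v))"

definition analytic_coordinates ::
  "(complex^'n \<Rightarrow> complex^'n) \<Rightarrow> (complex^'n) set \<Rightarrow> complex^'n \<Rightarrow> bool" where
  "analytic_coordinates w U q \<longleftrightarrow> open U \<and> q \<in> U \<and> w q = 0 \<and>
     (\<forall>i. holomorphic_on_vec (\<lambda>z. w z $ i) U) \<and>
     (\<exists>V w'. open V \<and> w ` U = V \<and> (\<forall>i. holomorphic_on_vec (\<lambda>z. w' z $ i) V) \<and>
        (\<forall>z\<in>U. w' (w z) = z))"

text \<open>
  \<open>I\<close> and the function \<open>g\<close> generate the same ideal in the ring of germs at \<open>q\<close> of holomorphic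
  functions.
\<close>
definition analytically_generated_by ::
  "(complex^'n \<Rightarrow> complex) set \<Rightarrow> (complex^'n \<Rightarrow> complex) \<Rightarrow> complex^'n \<Rightarrow> bool" where
  "analytically_generated_by I g q \<longleftrightarrow>
     (\<forall>f\<in>I. \<exists>W k. q \<in> W \<and> holomorphic_on_vec k W \<and> (\<forall>z\<in>W. f z = k z * g z)) \<and>
     (\<exists>F W k. finite F \<and> F \<subseteq> I \<and> q \<in> W \<and> open W \<and> (\<forall>f\<in>F. holomorphic_on_vec (k f) W) \<and>
        (\<forall>z\<in>W. g z = (\<Sum>f\<in>F. k f z * f z)))"

definition affine_3_space :: "(complex^3 \<Rightarrow> complex) ring" where
  "affine_3_space = coordinate_ring UNIV {\<lambda>z. z $ i | i. True}"

text \<open>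
  For a surface that can be embedded into affine 3-space: for some closed embedding, given by the
  surjection \<open>\<pi>\<close> with kernel the ideal of the surface, there are local analytic
  coordinates \<open>w\<close> at the image \<open>q\<close> of the point \<open>p\<close> in which the ideal is generated by
  \<open>x\<^sup>2 + y\<^sup>2 + z\<^sup>n\<^sup>+\<^sup>1\<close>.
\<close>
definition singularity_type_A ::
  "nat \<Rightarrow> ('b, 'm) ring_scheme \<Rightarrow> (complex \<Rightarrow> 'b) \<Rightarrow> ('b \<Rightarrow> complex) \<Rightarrow> bool" where
  "singularity_type_A n B \<iota> p \<longleftrightarrow>
     (\<exists>\<pi> q w U. \<pi> \<in> ring_hom affine_3_space B \<and> \<pi> ` carrier affine_3_space = carrier B \<and>
        (\<forall>c. \<pi> (\<lambda>z. c) = \<iota> c) \<and> (\<forall>i. p (\<pi> (\<lambda>z. z $ i)) = q $ i) \<and>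
        analytic_coordinates w U q \<and>
        analytically_generated_by (a_kernel affine_3_space B \<pi>)
          (\<lambda>z. (w z $ 1)\<^sup>2 + (w z $ 2)\<^sup>2 + (w z $ 3) ^ (n + 1)) q)"


section \<open>The monodromy space\<close>

type_synonym data = "(complex^2^2) \<times> (complex^2^2)"

fun alpha :: "data \<Rightarrow> complex" where
  "alpha (m, L) = m$1$1"

fun beta :: "data \<Rightarrow> complex" where
  "beta (m, L) = L$1$1 * L$2$2 * m$1$1 + L$1$2 * L$2$2 * m$2$1
               - L$1$1 * L$2$1 * m$1$2 - L$1$2 * L$2$1 * m$2$2"

definition AnalyticData :: "data set" where
  "AnalyticData = {(m, L). det m = 1 \<and> det L = 1 \<and> alpha (m, L) \<noteq> 0 \<and> beta (m, L) \<noteq> 0}"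

definition AnalyticData_ring :: "(data \<Rightarrow> complex) ring" where
  "AnalyticData_ring = coordinate_ring AnalyticData
     ({\<lambda>(m, L). m$i$j | i j. True} \<union> {\<lambda>(m, L). L$i$j | i j. True} \<union>
      {\<lambda>x. 1 / alpha x, \<lambda>x. 1 / beta x})"

fun torus_action :: "complex \<Rightarrow> complex \<Rightarrow> data \<Rightarrow> data" where
  "torus_action \<gamma> \<delta> (m, L) =
     (vector [vector [m$1$1, \<gamma>\<^sup>2 * m$1$2],
              vector [m$2$1 / \<gamma>\<^sup>2, m$2$2]],
      vector [vector [\<delta> / \<gamma> * L$1$1, \<gamma> * \<delta> * L$1$2],
              vector [L$2$1 / (\<gamma> * \<delta>), \<gamma> / \<delta> * L$2$2]])"

lemma torus_action_AnalyticData: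
  assumes "x \<in> AnalyticData" "\<gamma> \<noteq> 0" "\<delta> \<noteq> 0"
  shows "torus_action \<gamma> \<delta> x \<in> AnalyticData"
    and "alpha (torus_action \<gamma> \<delta> x) = alpha x"
    and "beta (torus_action \<gamma> \<delta> x) = beta x"
proof -
  obtain m L where x: "x = (m, L)" by force
  show b: "beta (torus_action \<gamma> \<delta> x) = beta x"
    using assms by (simp add: x field_simps power2_eq_square)
  show "alpha (torus_action \<gamma> \<delta> x) = alpha x"
    by (simp add: x)
  show "torus_action \<gamma> \<delta> x \<in> AnalyticData"
    using assms b unfolding x
    by (auto simp: AnalyticData_def det_2 field_simps power2_eq_square simp del: beta.simps)
qed

text \<open>The ring of invariants, i.e. the coordinate ring of the categorical quotient.\<close>
definition R_ring :: "(data \<Rightarrow> complex) ring" where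
  "R_ring = AnalyticData_ring \<lparr>carrier :=
     {f \<in> carrier AnalyticData_ring. \<forall>\<gamma> \<delta>. \<gamma> \<noteq> 0 \<longrightarrow> \<delta> \<noteq> 0 \<longrightarrow>
        (\<forall>x\<in>AnalyticData. f (torus_action \<gamma> \<delta> x) = f x)}\<rparr>"

definition R_const :: "complex \<Rightarrow> (data \<Rightarrow> complex)" where
  "R_const c = (\<lambda>x\<in>AnalyticData. c)"

definition R_alpha :: "data \<Rightarrow> complex" where
  "R_alpha = restrict alpha AnalyticData"

definition R_beta :: "data \<Rightarrow> complex" where
  "R_beta = restrict beta AnalyticData"

definition param_space :: "(complex \<times> complex) set" where
  "param_space = {(a, b). a \<noteq> 0 \<and> b \<noteq> 0}"

definition param_ring :: "(complex \<times> complex \<Rightarrow> complex) ring" where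
  "param_ring = coordinate_ring param_space
     {fst, snd, \<lambda>t. 1 / fst t, \<lambda>t. 1 / snd t}"

text \<open>The comorphism of \<open>(\<alpha>, \<beta>)\<close>.\<close>
definition R_structure :: "(complex \<times> complex \<Rightarrow> complex) \<Rightarrow> (data \<Rightarrow> complex)" where
  "R_structure k = (\<lambda>x\<in>AnalyticData. k (alpha x, beta x))"

text \<open>The scheme-theoretic fibre over \<open>(a, b)\<close>.\<close>
definition fibre_ideal :: "complex \<Rightarrow> complex \<Rightarrow> (data \<Rightarrow> complex) set" where
  "fibre_ideal a b = genideal R_ring {R_alpha \<ominus>\<^bsub>R_ring\<^esub> R_const a, R_beta \<ominus>\<^bsub>R_ring\<^esub> R_const b}"

definition fibre_ring :: "complex \<Rightarrow> complex \<Rightarrow> (data \<Rightarrow> complex) set ring" where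
  "fibre_ring a b = R_ring Quot fibre_ideal a b"

definition to_fibre :: "complex \<Rightarrow> complex \<Rightarrow> (data \<Rightarrow> complex) \<Rightarrow> (data \<Rightarrow> complex) set" where
  "to_fibre a b f = fibre_ideal a b +>\<^bsub>R_ring\<^esub> f"

definition fibre_const :: "complex \<Rightarrow> complex \<Rightarrow> complex \<Rightarrow> (data \<Rightarrow> complex) set" where
  "fibre_const a b c = to_fibre a b (R_const c)"


section \<open>The family of cubic surfaces\<close>

definition cubic :: "(complex \<times> complex) \<times> (complex^3) \<Rightarrow> complex" where
  "cubic = (\<lambda>((a, b), x). x$1 * x$2 * x$3 + (x$1)\<^sup>2 + (x$2)\<^sup>2
              + (1 + a * b) * x$1 + (a + b) * x$2 + a * b)"

definition family_ambient :: "((complex \<times> complex) \<times> (complex^3)) set" where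
  "family_ambient = param_space \<times> UNIV"

definition family_ambient_ring :: "((complex \<times> complex) \<times> (complex^3) \<Rightarrow> complex) ring" where
  "family_ambient_ring = coordinate_ring family_ambient
     ({\<lambda>(t, x). fst t, \<lambda>(t, x). snd t, \<lambda>(t, x). 1 / fst t, \<lambda>(t, x). 1 / snd t} \<union>
      {\<lambda>(t, x). x $ i | i. True})"

definition family_ideal :: "((complex \<times> complex) \<times> (complex^3) \<Rightarrow> complex) set" where
  "family_ideal = genideal family_ambient_ring {restrict cubic family_ambient}"

definition family_ring :: "((complex \<times> complex) \<times> (complex^3) \<Rightarrow> complex) set ring" where
  "family_ring = family_ambient_ring Quot family_ideal"

definition family_structure ::
  "(complex \<times> complex \<Rightarrow> complex) \<Rightarrow> ((complex \<times> complex) \<times> (complex^3) \<Rightarrow> complex) set" where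
  "family_structure k =
     family_ideal +>\<^bsub>family_ambient_ring\<^esub> (\<lambda>(t, x)\<in>family_ambient. k t)"

definition family_coordinate :: "3 \<Rightarrow> ((complex \<times> complex) \<times> (complex^3) \<Rightarrow> complex) set" where
  "family_coordinate i =
     family_ideal +>\<^bsub>family_ambient_ring\<^esub> (\<lambda>(t, x)\<in>family_ambient. x $ i)"

definition singular_curve_1 :: "((complex \<times> complex) \<times> (complex^3)) set" where
  "singular_curve_1 = {((a, a), vector [0, - a, a + 1 / a]) | a. a \<noteq> 0}"

definition singular_curve_2 :: "((complex \<times> complex) \<times> (complex^3)) set" where
  "singular_curve_2 = {((a, 1 / a), vector [- 1, 0, a + 1 / a]) | a. a \<noteq> 0}"

end

theory Submission
  imports Defs "HOL-Complex_Analysis.Conformal_Mappings" "HOL-Algebra.Subrings"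
begin

text \<open>
  The torus invariants are generated by the entries \<open>m\<^sub>1\<close>, \<open>m\<^sub>4\<close> and the monomials
  \<open>l\<^sub>2 l\<^sub>3\<close>, \<open>l\<^sub>1 l\<^sub>3 m\<^sub>2\<close>, \<open>l\<^sub>2 l\<^sub>4 m\<^sub>3\<close>. Eliminating the last one through \<open>\<beta>\<close> leaves
  \<open>\<alpha>\<close>, \<open>\<beta>\<close> and \<open>x\<^sub>1 = l\<^sub>2 l\<^sub>3\<close>, \<open>x\<^sub>2 = l\<^sub>1 l\<^sub>3 m\<^sub>2 - l\<^sub>1 l\<^sub>4 m\<^sub>1\<close>, \<open>x\<^sub>3 = m\<^sub>1 + m\<^sub>4\<close>, whose only
  relation is the cubic equation. Thus the quotient and its fibres are hypersurfaces in a space with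
  \<open>n = 5\<close>, respectively \<open>n = 3\<close>, coordinates, and the Jacobian criterion applies. Its
  ingredients are elementary here: the cotangent dimension at a point is \<open>n - 1\<close> or \<open>n\<close> according
  to whether the gradient vanishes; the height is at most \<open>n - 1\<close>, because \<open>n + 1\<close> regular
  functions are algebraically dependent and a relation with one of them the equation itself is
  incompatible with a chain of \<open>n + 1\<close> prime ideals; and it is at least \<open>n - 1\<close>, because the functions
  vanishing on a set whose points are pairwise joined by holomorphic curves form a prime ideal.
\<close>

section \<open>Rings of regular functions\<close>

text \<open>The difficulty lies in excluding further relations scheme-theoretically, since the
  quotient and its fibres are given only as rings. Every zero of the cubic lifts to matrices, so its
  zero set is the image of the data; that functions vanishing there are multiples of the cubic, and
  not merely nilpotent modulo it, comes from its being monic in \<open>x\<^sub>1\<close>. Invariants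
  are isolated by averaging over \<open>N\<close>-th roots of unity with \<open>N\<close> beyond all
  weights of the given function, a finite sum in place of an integral over the compact torus. A
  fibre is by definition a quotient of the ring of invariants; substituting values for \<alpha> and
  \<beta> identifies it with the hypersurface of the specialized cubic in three-space, so that the
  total space and the fibres are two instances of one criterion. For the lower bound on heights the
  cubic is solved for \<open>x\<^sub>3\<close> where \<open>x\<^sub>1 x\<^sub>2\<close> is non-zero;
  the remaining points are limits of such points, because \<open>x\<^sub>1\<close> and
  \<open>x\<^sub>2\<close> cannot vanish together when \<alpha> and \<beta> are non-zero.\<close>

declare restrict_apply [simp del] restrict_apply' [simp] restrict_cong [cong]

lemma coordinate_ring_simps [simp]:
  "carrier (coordinate_ring X G) = regular_functions X G"
  "mult (coordinate_ring X G) = (\<lambda>f g. \<lambda>x\<in>X. f x * g x)"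
  "add (coordinate_ring X G) = (\<lambda>f g. \<lambda>x\<in>X. f x + g x)"
  "one (coordinate_ring X G) = (\<lambda>x\<in>X. 1)"
  "zero (coordinate_ring X G) = (\<lambda>x\<in>X. 0)"
  by (simp_all add: coordinate_ring_def)

lemma regular_extensional: "f \<in> regular_functions X G \<Longrightarrow> f \<in> extensional X"
  by (induction rule: regular_functions.induct) (rule restrict_extensional)+

lemma regular_restrict [simp]: "f \<in> regular_functions X G \<Longrightarrow> restrict f X = f"
  by (simp add: regular_extensional extensional_restrict)

lemma regular_eqI:
  assumes "f \<in> regular_functions X G" "g \<in> regular_functions X G" "\<And>x. x \<in> X \<Longrightarrow> f x = g x"
  shows "f = g"
  using assms by (meson extensionalityI regular_extensional)

lemma regular_cong:
  assumes "(\<lambda>x\<in>X. f x) \<in> regular_functions X G" "\<And>x. x \<in> X \<Longrightarrow> f x = g x"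
  shows "(\<lambda>x\<in>X. g x) \<in> regular_functions X G"
  using assms by (metis restrict_ext)

lemma regular_add:
  assumes "restrict f X \<in> regular_functions X G" "restrict g X \<in> regular_functions X G"
  shows "(\<lambda>x\<in>X. f x + g x) \<in> regular_functions X G"
  by (rule regular_cong[OF regular_functions.add[OF assms]]) auto

lemma regular_mult:
  assumes "restrict f X \<in> regular_functions X G" "restrict g X \<in> regular_functions X G"
  shows "(\<lambda>x\<in>X. f x * g x) \<in> regular_functions X G"
  by (rule regular_cong[OF regular_functions.mult[OF assms]]) auto

lemma regular_minus:
  assumes "restrict f X \<in> regular_functions X G"
  shows "(\<lambda>x\<in>X. - f x) \<in> regular_functions X G"
  by (rule regular_cong[OF regular_mult[OF regular_functions.const[of "-1"] assms]]) auto

lemma regular_diff: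
  assumes "restrict f X \<in> regular_functions X G" "restrict g X \<in> regular_functions X G"
  shows "(\<lambda>x\<in>X. f x - g x) \<in> regular_functions X G"
  by (rule regular_cong[OF regular_add[OF assms(1) regular_minus[OF assms(2)]]]) auto

lemma regular_sum:
  assumes "\<And>i. i \<in> S \<Longrightarrow> restrict (f i) X \<in> regular_functions X G"
  shows "(\<lambda>x\<in>X. \<Sum>i\<in>S. f i x) \<in> regular_functions X G"
  using assms
  by (induction S rule: infinite_finite_induct)
    (simp_all add: regular_functions.const regular_add)

lemma regular_prod:
  assumes "\<And>i. i \<in> S \<Longrightarrow> restrict (f i) X \<in> regular_functions X G"
  shows "(\<lambda>x\<in>X. \<Prod>i\<in>S. f i x) \<in> regular_functions X G"
  using assms
  by (induction S rule: infinite_finite_induct)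
    (simp_all add: regular_functions.const regular_mult)

lemma regular_power:
  assumes "restrict f X \<in> regular_functions X G"
  shows "(\<lambda>x\<in>X. f x ^ n) \<in> regular_functions X G"
  using assms by (induction n) (simp_all add: regular_functions.const regular_mult)

lemma regular_self: "f \<in> regular_functions X G \<Longrightarrow> (\<lambda>x\<in>X. f x) \<in> regular_functions X G"
  by simp

lemmas regular_intros = regular_functions.const regular_add regular_mult regular_minus
  regular_diff regular_sum regular_prod regular_power regular_self

text \<open>A comorphism has to be checked on generators only, including the inverted ones. The
  quotient map, the inclusion of a fibre and the projections of the family to its parameters and to
  three-space are all treated this way.\<close>

lemma regular_compose:
  assumes f: "f \<in> regular_functions X G" and \<theta>: "\<And>y. y \<in> Y \<Longrightarrow> \<theta> y \<in> X"
    and gens: "\<And>g. g \<in> G \<Longrightarrow> (\<lambda>y\<in>Y. g (\<theta> y)) \<in> regular_functions Y H"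
  shows "(\<lambda>y\<in>Y. f (\<theta> y)) \<in> regular_functions Y H"
  using f
proof (induction rule: regular_functions.induct)
  case (const c)
  show ?case using \<theta> regular_functions.const[of c Y H] by simp
next
  case (gen g)
  show ?case using \<theta> gens[OF gen] by simp
next
  case (add f g)
  show ?case using \<theta> regular_add[OF add(3,4)] by simp
next
  case (mult f g)
  show ?case using \<theta> regular_mult[OF mult(3,4)] by simp
qed

lemma restrict_UNIV [simp]: "restrict f UNIV = f"
  by (simp add: restrict_def)

lemma cring_coordinate_ring: "cring (coordinate_ring X G)"
proof (rule cringI)
  show "abelian_group (coordinate_ring X G)"
  proof (rule abelian_groupI)
    fix f assume "f \<in> carrier (coordinate_ring X G)"
    then show "\<exists>g\<in>carrier (coordinate_ring X G).
        g \<oplus>\<^bsub>coordinate_ring X G\<^esub> f = \<zero>\<^bsub>coordinate_ring X G\<^esub>"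
      by (intro bexI[of _ "\<lambda>x\<in>X. - f x"]) (auto intro: regular_intros)
  next
    fix f assume "f \<in> carrier (coordinate_ring X G)"
    then show "\<zero>\<^bsub>coordinate_ring X G\<^esub> \<oplus>\<^bsub>coordinate_ring X G\<^esub> f = f"
      by simp
  qed (auto simp: algebra_simps intro: regular_intros)
  show "comm_monoid (coordinate_ring X G)"
  proof (rule comm_monoidI)
    fix f assume "f \<in> carrier (coordinate_ring X G)"
    then show "\<one>\<^bsub>coordinate_ring X G\<^esub> \<otimes>\<^bsub>coordinate_ring X G\<^esub> f = f"
      by simp
  qed (auto simp: algebra_simps intro: regular_intros)
qed (auto simp: algebra_simps)

lemma coordinate_ring_a_inv:
  assumes "g \<in> regular_functions X G"
  shows "\<ominus>\<^bsub>coordinate_ring X G\<^esub> g = (\<lambda>x\<in>X. - g x)"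
proof -
  interpret cring "coordinate_ring X G" by (rule cring_coordinate_ring)
  show ?thesis
    by (rule minus_equality[OF _ ]) (use assms in \<open>auto intro: regular_intros\<close>)
qed

lemma coordinate_ring_a_minus:
  assumes "f \<in> regular_functions X G" "g \<in> regular_functions X G"
  shows "f \<ominus>\<^bsub>coordinate_ring X G\<^esub> g = (\<lambda>x\<in>X. f x - g x)"
  using assms by (simp add: a_minus_def coordinate_ring_a_inv)

text \<open>The operations of \<open>coordinate_ring\<close> are restricted pointwise operations;
  the closure properties of ideals are put into pointwise form so that membership can be shown by
  computing with values.\<close>

lemma regular_ideal_closed:
  assumes "ideal I (coordinate_ring X G)"
  shows "(\<lambda>x\<in>X. 0) \<in> I"
    and "f \<in> I \<Longrightarrow> f \<in> regular_functions X G"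
    and "\<lbrakk>restrict f X \<in> I; restrict g X \<in> I\<rbrakk> \<Longrightarrow> (\<lambda>x\<in>X. f x + g x) \<in> I"
    and "\<lbrakk>restrict g X \<in> regular_functions X G; restrict f X \<in> I\<rbrakk> \<Longrightarrow> (\<lambda>x\<in>X. g x * f x) \<in> I"
    and "\<lbrakk>restrict f X \<in> I; restrict g X \<in> I\<rbrakk> \<Longrightarrow> (\<lambda>x\<in>X. f x - g x) \<in> I"
proof -
  interpret ideal I "coordinate_ring X G" by fact
  show zero: "(\<lambda>x\<in>X. 0) \<in> I"
    using additive_subgroup.zero_closed[of I "coordinate_ring X G"] additive_subgroup_axioms by simp
  show "f \<in> I \<Longrightarrow> f \<in> regular_functions X G" using Icarr by simp
  show add: "(\<lambda>x\<in>X. f x + g x) \<in> I" if "restrict f X \<in> I" "restrict g X \<in> I" for f g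
    using additive_subgroup.a_closed[OF additive_subgroup_axioms that] by (simp cong: restrict_cong)
  show mult: "(\<lambda>x\<in>X. g x * f x) \<in> I" if "restrict g X \<in> regular_functions X G" "restrict f X \<in> I" for f g
    using I_l_closed[OF that(2), of "restrict g X"] that(1) by (simp cong: restrict_cong)
  show "(\<lambda>x\<in>X. f x - g x) \<in> I" if "restrict f X \<in> I" "restrict g X \<in> I"
    using add[OF that(1), of "\<lambda>x. (-1) * g x"] mult[OF regular_functions.const that(2), of "-1"]
    by simp
qed

lemma regular_ideal_sum:
  assumes "ideal I (coordinate_ring X G)" "\<And>i. i \<in> S \<Longrightarrow> restrict (f i) X \<in> I"
  shows "(\<lambda>x\<in>X. \<Sum>i\<in>S. f i x) \<in> I"
  using assms(2)
  by (induction S rule: infinite_finite_induct)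
    (simp_all add: regular_ideal_closed[OF assms(1)])

lemma regular_primeideal_mult:
  assumes "primeideal I (coordinate_ring X G)"
    and "restrict f X \<in> regular_functions X G" "restrict g X \<in> regular_functions X G"
    and "(\<lambda>x\<in>X. f x * g x) \<in> I"
  shows "restrict f X \<in> I \<or> restrict g X \<in> I"
proof -
  interpret primeideal I "coordinate_ring X G" by fact
  show ?thesis using I_prime[of "restrict f X" "restrict g X"] assms(2-)
    by (simp cong: restrict_cong)
qed

lemma complex_ring_simps [simp]:
  "carrier complex_ring = UNIV" "mult complex_ring = (*)" "add complex_ring = (+)"
  "one complex_ring = 1" "zero complex_ring = 0"
  by (simp_all add: complex_ring_def)

lemma cring_complex_ring: "cring complex_ring"
proof (rule cringI)
  show "abelian_group complex_ring"
    by (rule abelian_groupI) (auto intro: exI[of _ "- x" for x] simp: algebra_simps add_eq_0_iff)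
  show "comm_monoid complex_ring"
    by (rule comm_monoidI) auto
qed (auto simp: algebra_simps)

section \<open>Homogeneous linear systems\<close>

text \<open>Gaussian elimination: a non-zero entry at \<open>r\<close> in the equation
  \<open>u\<close> removes one equation and one unknown. This yields both the coefficients of
  algebraic relations and the tangent vectors that bound cotangent dimensions from below.\<close>

lemma nontrivial_solution:
  fixes M :: "'s \<Rightarrow> 't \<Rightarrow> 'f::field"
  assumes "finite T" "finite S" "card T < card S"
  shows "\<exists>c. (\<exists>s\<in>S. c s \<noteq> 0) \<and> (\<forall>t\<in>T. (\<Sum>s\<in>S. c s * M s t) = 0)"
  using assms
proof (induction T arbitrary: S M rule: finite_induct)
  case empty
  then obtain s where "s \<in> S" by fastforce
  then show ?case by (intro exI[of _ "\<lambda>_. 1"]) auto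
next
  case (insert u T)
  show ?case
  proof (cases "\<forall>s\<in>S. M s u = 0")
    case True
    obtain c where "\<exists>s\<in>S. c s \<noteq> 0" "\<forall>t\<in>T. (\<Sum>s\<in>S. c s * M s t) = 0"
      using insert.IH[of S M] insert.prems insert.hyps by auto
    then show ?thesis using True by (intro exI[of _ c]) auto
  next
    case False
    then obtain r where r: "r \<in> S" "M r u \<noteq> 0" by blast
    define M' where "M' s t = M s t - M s u / M r u * M r t" for s t
    have "card T < card (S - {r})"
      using insert.prems insert.hyps r by simp
    then obtain c where c: "\<exists>s\<in>S - {r}. c s \<noteq> 0" "\<forall>t\<in>T. (\<Sum>s\<in>S - {r}. c s * M' s t) = 0"
      using insert.IH[of "S - {r}" M'] insert.prems by auto
    \<comment> \<open>The value at \<open>r\<close> is the one that makes the equation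
      \<open>u\<close> hold.\<close>
    define d where "d = c(r := - (\<Sum>s\<in>S - {r}. c s * M s u) / M r u)"
    have *: "(\<Sum>s\<in>S. d s * M s t) = (\<Sum>s\<in>S - {r}. c s * M' s t)" for t
    proof -
      have "(\<Sum>s\<in>S. d s * M s t) = d r * M r t + (\<Sum>s\<in>S - {r}. d s * M s t)"
        using r insert.prems by (simp add: sum.remove)
      also have "(\<Sum>s\<in>S - {r}. d s * M s t) = (\<Sum>s\<in>S - {r}. c s * M s t)"
        by (rule sum.cong) (auto simp: d_def)
      also have "d r * M r t = - (\<Sum>s\<in>S - {r}. c s * (M s u / M r u * M r t))"
        by (simp add: d_def sum_distrib_right sum_divide_distrib sum_negf[symmetric] mult.assoc)
      finally show ?thesis
        by (simp add: M'_def algebra_simps sum_subtractf)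
    qed
    have "(\<Sum>s\<in>S. d s * M s u) = 0" unfolding * using r by (simp add: M'_def)
    moreover have "\<exists>s\<in>S. d s \<noteq> 0" using c(1) by (auto simp: d_def)
    ultimately show ?thesis using c(2) * by (intro exI[of _ d]) auto
  qed
qed

section \<open>Polynomial rings with some coordinates inverted\<close>

text \<open>The product of an affine space with the torus on the coordinates in \<open>J\<close>.
  Points are kept abstract, in bijection with coordinate vectors, so that vectors as well as pairs
  of parameters and vectors can serve as points.\<close>

locale laurent_space =
  fixes coord :: "'i::finite \<Rightarrow> 'a \<Rightarrow> complex" and pt :: "('i \<Rightarrow> complex) \<Rightarrow> 'a"
    and J :: "'i set" and X :: "'a set" and G :: "('a \<Rightarrow> complex) set"
  assumes coord_pt [simp]: "coord i (pt u) = u i"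
    and pt_coord [simp]: "pt (\<lambda>i. coord i x) = x"
    and X_eq: "X = {x. \<forall>j\<in>J. coord j x \<noteq> 0}"
    and G_eq: "G = range coord \<union> (\<lambda>j x. 1 / coord j x) ` J"
begin

abbreviation "A \<equiv> coordinate_ring X G"
abbreviation "reg \<equiv> regular_functions X G"

lemma point_eqI: "(\<And>i. coord i x = coord i y) \<Longrightarrow> x = y"
  by (metis ext pt_coord)

lemma coord_regular: "(\<lambda>x\<in>X. coord i x) \<in> reg"
  by (rule regular_functions.gen) (simp add: G_eq)

lemma inverse_coord_regular: "j \<in> J \<Longrightarrow> (\<lambda>x\<in>X. 1 / coord j x) \<in> reg"
  by (rule regular_functions.gen) (auto simp add: G_eq)

lemma coord_nonzero: "x \<in> X \<Longrightarrow> j \<in> J \<Longrightarrow> coord j x \<noteq> 0"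
  by (simp add: X_eq)

lemma regular_induct [consumes 1, case_names const coord inverse add mult]:
  assumes "f \<in> reg"
    and "\<And>c. P (\<lambda>x\<in>X. c)" "\<And>i. P (\<lambda>x\<in>X. coord i x)"
    and "\<And>j. j \<in> J \<Longrightarrow> P (\<lambda>x\<in>X. 1 / coord j x)"
    and "\<And>f g. \<lbrakk>f \<in> reg; g \<in> reg; P f; P g\<rbrakk> \<Longrightarrow> P (\<lambda>x\<in>X. f x + g x)"
    and "\<And>f g. \<lbrakk>f \<in> reg; g \<in> reg; P f; P g\<rbrakk> \<Longrightarrow> P (\<lambda>x\<in>X. f x * g x)"
  shows "P f"
  using assms(1)
proof (induction rule: regular_functions.induct)
  case (gen g)
  then show ?case using assms(3,4) unfolding G_eq by auto
qed (use assms in auto)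

text \<open>The coordinates determine a homomorphism of algebras. The image of
  \<open>1 / coord j\<close> is an inverse of \<open>coord j z\<close>, which is why the candidate
  \<open>z\<close> avoids the removed hyperplanes.\<close>

lemma algebra_hom_eval:
  assumes h: "h \<in> ring_hom A complex_ring" and const: "\<And>c. h (\<lambda>x\<in>X. c) = c"
    and z: "z = pt (\<lambda>i. h (\<lambda>x\<in>X. coord i x))"
  shows "z \<in> X" and "f \<in> reg \<Longrightarrow> h f = f z"
proof -
  have hmult: "h (\<lambda>x\<in>X. f x * g x) = h f * h g" if "f \<in> reg" "g \<in> reg" for f g
    using ring_hom_mult[OF h, of f g] that by simp
  have hadd: "h (\<lambda>x\<in>X. f x + g x) = h f + h g" if "f \<in> reg" "g \<in> reg" for f g
    using ring_hom_add[OF h, of f g] that by simp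
  have inv: "coord j z * h (\<lambda>x\<in>X. 1 / coord j x) = 1" if "j \<in> J" for j
  proof -
    have "coord j z * h (\<lambda>x\<in>X. 1 / coord j x)
        = h (\<lambda>x\<in>X. (\<lambda>x\<in>X. coord j x) x * (\<lambda>x\<in>X. 1 / coord j x) x)"
      unfolding hmult[OF coord_regular inverse_coord_regular[OF that]] by (simp only: z coord_pt)
    also have "(\<lambda>x\<in>X. (\<lambda>x\<in>X. coord j x) x * (\<lambda>x\<in>X. 1 / coord j x) x) = (\<lambda>x\<in>X. 1)"
      by (rule restrict_ext) (use that coord_nonzero in auto)
    finally show ?thesis by (simp only: const)
  qed
  show zX: "z \<in> X" unfolding X_eq using inv by force
  show "h f = f z" if "f \<in> reg" using that
  proof (induction rule: regular_induct)
    case (const c) show ?case using zX by (simp only: assms(2)) simp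
  next
    case (coord i) show ?case using zX by (simp add: z)
  next
    case (inverse j)
    then show ?case using inv[OF inverse] zX coord_nonzero[OF zX inverse] by (simp add: field_simps)
  next
    case (add f g)
    then show ?case using zX by (simp only: hadd) simp
  next
    case (mult f g)
    then show ?case using zX by (simp only: hmult) simp
  qed
qed

lemma holomorphic_along_curve:
  assumes "f \<in> reg" "\<And>t. t \<in> T \<Longrightarrow> \<theta> t \<in> X" "\<And>i. (\<lambda>t. coord i (\<theta> t)) holomorphic_on T"
  shows "(\<lambda>t. f (\<theta> t)) holomorphic_on T"
  using assms(1)
proof (induction rule: regular_induct)
  case (const c)
  have "(\<lambda>t. c) holomorphic_on T" by simp
  then show ?case by (rule holomorphic_transform) (use assms in auto)
next
  case (coord i)
  show ?case by (rule holomorphic_transform[OF assms(3)[of i]]) (use assms(2) in auto)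
next
  case (inverse j)
  have "(\<lambda>t. 1 / coord j (\<theta> t)) holomorphic_on T"
    using assms coord_nonzero[OF _ inverse] by (intro holomorphic_intros) auto
  then show ?case by (rule holomorphic_transform) (use assms in auto)
next
  case (add f g)
  have "(\<lambda>t. f (\<theta> t) + g (\<theta> t)) holomorphic_on T" using add by (intro holomorphic_intros)
  then show ?case by (rule holomorphic_transform) (use assms in auto)
next
  case (mult f g)
  have "(\<lambda>t. f (\<theta> t) * g (\<theta> t)) holomorphic_on T" using mult by (intro holomorphic_intros)
  then show ?case by (rule holomorphic_transform) (use assms in auto)
qed

text \<open>The abstract points carry no topology, so convergence is expressed coordinatewise.
  Inverted coordinates cause no trouble because the limit \<open>z\<close> lies in
  \<open>X\<close>.\<close>

lemma tendsto_regular: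
  assumes "f \<in> reg" "z \<in> X" "\<And>k. s k \<in> X"
    and "\<And>i. (\<lambda>k. coord i (s k)) \<longlonglongrightarrow> coord i z"
  shows "(\<lambda>k. f (s k)) \<longlonglongrightarrow> f z"
  using assms(1)
proof (induction rule: regular_induct)
  case (inverse j)
  show ?case using assms coord_nonzero[OF assms(2) inverse]
    by (auto intro!: tendsto_intros)
qed (use assms in \<open>auto intro!: tendsto_intros\<close>)

subsection \<open>Algebraic relations\<close>

definition monomial :: "('i \<Rightarrow> nat) \<Rightarrow> 'a \<Rightarrow> complex" where
  "monomial e x = (\<Prod>i\<in>UNIV. coord i x ^ e i)"

text \<open>Exponents are bounded one by one and not in total: the admissible monomials then form a
  cube with \<open>(d + 1) ^ n\<close> elements, which is easily compared with another cube.\<close>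

inductive_set bounded_poly :: "nat \<Rightarrow> ('a \<Rightarrow> complex) set" for d where
  monomial: "(\<And>i. e i \<le> d) \<Longrightarrow> (\<lambda>x. c * monomial e x) \<in> bounded_poly d"
| add: "f \<in> bounded_poly d \<Longrightarrow> g \<in> bounded_poly d \<Longrightarrow> (\<lambda>x. f x + g x) \<in> bounded_poly d"

lemma monomial_mult: "monomial e x * monomial e' x = monomial (\<lambda>i. e i + e' i) x"
  by (simp add: monomial_def power_add prod.distrib)

lemma bounded_poly_mult:
  assumes "f \<in> bounded_poly d" "g \<in> bounded_poly d'"
  shows "(\<lambda>x. f x * g x) \<in> bounded_poly (d + d')"
  using assms(1)
proof (induction rule: bounded_poly.induct)
  case (monomial e c)
  show ?case using assms(2)
  proof (induction rule: bounded_poly.induct)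
    case (monomial e' c')
    have "(\<lambda>x. (c * c') * monomial (\<lambda>i. e i + e' i) x) \<in> bounded_poly (d + d')"
      by (rule bounded_poly.monomial) (simp add: add_mono monomial \<open>\<And>i. e i \<le> d\<close>)
    then show ?case by (simp add: monomial_mult[symmetric] ac_simps)
  next
    case (add f g)
    then show ?case using bounded_poly.add by (fastforce simp: distrib_left)
  qed
next
  case (add f1 f2)
  then show ?case using bounded_poly.add by (fastforce simp: distrib_right)
qed

lemma bounded_poly_sum_form:
  assumes "f \<in> bounded_poly d"
  shows "\<exists>k. \<forall>x. f x = (\<Sum>e\<in>PiE UNIV (\<lambda>_. {..d}). k e * monomial e x)"
  using assms
proof (induction rule: bounded_poly.induct)
  case (monomial e c)
  have "finite (PiE (UNIV :: 'i set) (\<lambda>_. {..d}))" by (simp add: finite_PiE)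
  moreover have "e \<in> PiE UNIV (\<lambda>_. {..d})" using monomial by auto
  ultimately have "c * monomial e x
      = (\<Sum>e'\<in>PiE UNIV (\<lambda>_. {..d}). (if e' = e then c else 0) * monomial e' x)" for x
    by (simp add: if_distrib[of "\<lambda>u. u * _"] cong: if_cong)
  then show ?case by (intro exI[of _ "\<lambda>e'. if e' = e then c else 0"]) blast
next
  case (add f g)
  then obtain k l where "\<forall>x. f x = (\<Sum>e\<in>PiE UNIV (\<lambda>_. {..d}). k e * monomial e x)"
    "\<forall>x. g x = (\<Sum>e\<in>PiE UNIV (\<lambda>_. {..d}). l e * monomial e x)" by blast
  then show ?case by (intro exI[of _ "\<lambda>e. k e + l e"]) (simp add: distrib_right sum.distrib)
qed

section \<open>Degrees of regular functions after clearing denominators\<close>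

definition denominator :: "'a \<Rightarrow> complex" where
  "denominator x = (\<Prod>j\<in>J. coord j x)"

text \<open>Multiplication by \<open>denominator ^ D\<close> clears the poles and may itself
  contribute \<open>D\<close> to an exponent, on top of the \<open>D\<close> coming from the
  function; hence the bound \<open>2 * D\<close>. In this form \<open>D\<close> is additive under
  products and may always be enlarged.\<close>

definition growth :: "('a \<Rightarrow> complex) \<Rightarrow> nat \<Rightarrow> bool" where
  "growth f D \<longleftrightarrow> (\<exists>g\<in>bounded_poly (2 * D). \<forall>x\<in>X. f x * denominator x ^ D = g x)"

lemma denominator_nonzero: "x \<in> X \<Longrightarrow> denominator x \<noteq> 0"
  by (simp add: denominator_def coord_nonzero)

lemma denominator_power: "denominator x ^ k = monomial (\<lambda>i. if i \<in> J then k else 0) x"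
proof -
  have "monomial (\<lambda>i. if i \<in> J then k else 0) x = (\<Prod>i\<in>UNIV. if i \<in> J then coord i x ^ k else 1)"
    unfolding monomial_def by (rule prod.cong) auto
  then show ?thesis
    by (simp add: prod.If_cases denominator_def prod_power_distrib)
qed

lemma denominator_power_bounded_poly: "k \<le> d \<Longrightarrow> (\<lambda>x. denominator x ^ k) \<in> bounded_poly d"
  using bounded_poly.monomial[of "\<lambda>i. if i \<in> J then k else 0" d 1]
  by (simp add: denominator_power)

lemma growth_mult:
  assumes "growth f D" "growth g D'"
  shows "growth (\<lambda>x. f x * g x) (D + D')"
proof -
  obtain f' g' where *: "f' \<in> bounded_poly (2 * D)" "\<And>x. x \<in> X \<Longrightarrow> f x * denominator x ^ D = f' x"
    "g' \<in> bounded_poly (2 * D')" "\<And>x. x \<in> X \<Longrightarrow> g x * denominator x ^ D' = g' x"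
    using assms unfolding growth_def by blast
  show ?thesis unfolding growth_def
  proof (rule bexI[of _ "\<lambda>x. f' x * g' x"])
    show "\<forall>x\<in>X. f x * g x * denominator x ^ (D + D') = f' x * g' x"
      by (auto simp: *(2,4)[symmetric] power_add)
    show "(\<lambda>x. f' x * g' x) \<in> bounded_poly (2 * (D + D'))"
      using bounded_poly_mult[OF *(1,3)] by (simp add: distrib_left)
  qed
qed

lemma growth_one: "growth (\<lambda>x. 1) D"
  unfolding growth_def by (rule bexI[OF _ denominator_power_bounded_poly[of D]]) auto

lemma growth_mono: "growth f D \<Longrightarrow> D \<le> D' \<Longrightarrow> growth f D'"
  using growth_mult[OF _ growth_one[of "D' - D"], of f D] by simp

lemma growth_cong: "growth f D \<Longrightarrow> (\<And>x. x \<in> X \<Longrightarrow> f x = g x) \<Longrightarrow> growth g D"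
  by (auto simp: growth_def)

lemma growth_prod:
  assumes "finite I" "\<And>i. i \<in> I \<Longrightarrow> growth (f i) (D i)"
  shows "growth (\<lambda>x. \<Prod>i\<in>I. f i x) (\<Sum>i\<in>I. D i)"
  using assms by (induction I rule: finite_induct) (auto simp: growth_one intro: growth_mult)

lemma growth_power: "growth f D \<Longrightarrow> growth (\<lambda>x. f x ^ k) (k * D)"
  by (induction k) (auto simp: growth_one intro: growth_mult)

lemma growth_regular: "f \<in> reg \<Longrightarrow> \<exists>D. growth f D"
proof (induction rule: regular_induct)
  case (const c)
  have "(\<lambda>x. c * monomial (\<lambda>_. 0) x) \<in> bounded_poly (2 * 0)" by (rule bounded_poly.monomial) simp
  then have "growth (\<lambda>x\<in>X. c) 0" unfolding growth_def
    by (rule rev_bexI) (simp add: monomial_def)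
  then show ?case by blast
next
  case (coord i)
  have *: "coord i x = monomial (\<lambda>k. if k = i then 1 else 0) x" for x
  proof -
    have "monomial (\<lambda>k. if k = i then 1 else 0) x = (\<Prod>k\<in>UNIV. if k = i then coord k x else 1)"
      unfolding monomial_def by (rule prod.cong) auto
    then show ?thesis by simp
  qed
  have "(\<lambda>x. 1 * (monomial (\<lambda>k. (if k = i then 1 else 0) + (if k \<in> J then 1 else 0)) x))
      \<in> bounded_poly (2 * 1)"
    by (rule bounded_poly.monomial) auto
  then have "growth (\<lambda>x\<in>X. coord i x) 1" unfolding growth_def
    by (rule rev_bexI) (simp add: monomial_mult[symmetric] * denominator_power[of _ 1, simplified])
  then show ?case by blast
next
  case (inverse j)
  have *: "1 / coord j x * denominator x = monomial (\<lambda>k. if k \<in> J - {j} then 1 else 0) x"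
    if "x \<in> X" for x
  proof -
    have "monomial (\<lambda>k. if k \<in> J - {j} then 1 else 0) x
        = (\<Prod>k\<in>UNIV. if k \<in> J - {j} then coord k x else 1)"
      unfolding monomial_def by (rule prod.cong) auto
    also have "\<dots> = (\<Prod>k\<in>J - {j}. coord k x)"
      by (simp add: prod.If_cases) (rule prod.cong, auto)
    finally show ?thesis
      using inverse coord_nonzero[OF that inverse]
      by (simp add: denominator_def prod.remove[of J j])
  qed
  have "(\<lambda>x. 1 * (monomial (\<lambda>k. if k \<in> J - {j} then 1 else 0) x)) \<in> bounded_poly (2 * 1)"
    by (rule bounded_poly.monomial) auto
  then have "growth (\<lambda>x\<in>X. 1 / coord j x) 1" unfolding growth_def
    by (rule rev_bexI) (use * in simp)
  then show ?case by blast
next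
  case (add f g)
  then obtain D D' where "growth f D" "growth g D'" by blast
  then have "growth f (D + D')" "growth g (D + D')" by (auto intro: growth_mono)
  then obtain f' g' where
    "f' \<in> bounded_poly (2 * (D + D'))" "\<forall>x\<in>X. f x * denominator x ^ (D + D') = f' x"
    "g' \<in> bounded_poly (2 * (D + D'))" "\<forall>x\<in>X. g x * denominator x ^ (D + D') = g' x"
    unfolding growth_def by blast
  then have "growth (\<lambda>x\<in>X. f x + g x) (D + D')"
    unfolding growth_def
    by (intro bexI[of _ "\<lambda>x. f' x + g' x"] bounded_poly.add) (auto simp: distrib_right)
  then show ?case by blast
next
  case (mult f g)
  then obtain D D' where "growth f D" "growth g D'" by blast
  then have "growth (\<lambda>x\<in>X. f x * g x) (D + D')"
    by (intro growth_cong[OF growth_mult]) auto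
  then show ?case by blast
qed

text \<open>
  The monomials of degree at most \<open>N\<close> in each of the \<open>n + 1\<close> given functions outnumber, for large
  \<open>N\<close>, the dimension of the space in which they lie, which is polynomial in \<open>N\<close> of degree \<open>n\<close>.
\<close>
lemma algebraic_relation:
  assumes "finite I" "card I = Suc CARD('i)" "\<And>i. i \<in> I \<Longrightarrow> f i \<in> reg"
  obtains E c where "finite E" "E \<noteq> {}" "E \<subseteq> extensional I" "\<And>e. e \<in> E \<Longrightarrow> c e \<noteq> (0::complex)"
    "\<And>x. x \<in> X \<Longrightarrow> (\<Sum>e\<in>E. c e * (\<Prod>i\<in>I. f i x ^ e i)) = 0"
proof -
  define n where "n = CARD('i)"
  have "\<forall>i\<in>I. \<exists>D. growth (f i) D" using growth_regular assms(3) by blast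
  then obtain D' where D': "growth (f i) (D' i)" if "i \<in> I" for i
    using bchoice[of I "\<lambda>i D. growth (f i) D"] by blast
  define D where "D = (\<Sum>i\<in>I. D' i)"
  have D: "growth (f i) D" if "i \<in> I" for i
    using D'[OF that] by (rule growth_mono) (use that assms(1) in \<open>auto simp: D_def intro: member_le_sum\<close>)
  \<comment> \<open>\<open>N\<close> is chosen for the comparison
    \<open>2 * K + 1 \<le> Suc N * (2 * (Suc n * D) + 1)\<close>: the \<open>n\<close>-th power of
    the last factor is \<open>N\<close> itself, less than the additional factor \<open>Suc N\<close>
    in the number of exponent vectors.\<close>
  define N where "N = (2 * (Suc n * D) + 1) ^ n"
  define K where "K = Suc n * (N * D)"
  define S where "S = PiE I (\<lambda>_. {..N})"
  define T where "T = PiE (UNIV :: 'i set) (\<lambda>_. {..2 * K})"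
  have fin: "finite S" "finite T" unfolding S_def T_def using assms(1) by (auto intro: finite_PiE)
  have cardS: "card S = Suc N ^ Suc n"
    unfolding S_def using assms(1,2) by (simp add: card_PiE n_def)
  have cardT: "card T = (2 * K + 1) ^ n"
    unfolding T_def by (simp add: card_PiE n_def)
  have "2 * K + 1 \<le> Suc N * (2 * (Suc n * D) + 1)"
    by (simp add: K_def algebra_simps)
  then have "(2 * K + 1) ^ n \<le> Suc N ^ n * N"
    unfolding N_def power_mult_distrib[symmetric] by (rule power_mono) simp
  also have "\<dots> < Suc N ^ Suc n" by simp
  finally have less: "card T < card S" unfolding cardS cardT .
  have "growth (\<lambda>x. \<Prod>i\<in>I. f i x ^ e i) K" if "e \<in> S" for e
  proof (rule growth_mono)
    show "growth (\<lambda>x. \<Prod>i\<in>I. f i x ^ e i) (\<Sum>i\<in>I. e i * D)"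
      using assms(1) D by (intro growth_prod growth_power) auto
    have "(\<Sum>i\<in>I. e i * D) \<le> (\<Sum>i\<in>I. N * D)"
      using that by (intro sum_mono) (auto simp: S_def PiE_iff)
    then show "(\<Sum>i\<in>I. e i * D) \<le> K" by (simp add: K_def assms(2) n_def)
  qed
  note gr = this
  have "\<exists>k. \<forall>x\<in>X. (\<Prod>i\<in>I. f i x ^ e i) * denominator x ^ K = (\<Sum>t\<in>T. k t * monomial t x)"
    if e: "e \<in> S" for e
  proof -
    obtain g where g: "g \<in> bounded_poly (2 * K)"
      "\<forall>x\<in>X. (\<Prod>i\<in>I. f i x ^ e i) * denominator x ^ K = g x"
      using gr[OF e] unfolding growth_def by blast
    obtain k where "\<forall>x. g x = (\<Sum>t\<in>T. k t * monomial t x)"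
      using bounded_poly_sum_form[OF g(1)] unfolding T_def by blast
    with g(2) have "\<forall>x\<in>X. (\<Prod>i\<in>I. f i x ^ e i) * denominator x ^ K
        = (\<Sum>t\<in>T. k t * monomial t x)" by simp
    then show ?thesis by blast
  qed
  then have "\<exists>k. \<forall>e\<in>S. \<forall>x\<in>X. (\<Prod>i\<in>I. f i x ^ e i) * denominator x ^ K
      = (\<Sum>t\<in>T. k e t * monomial t x)" by (intro bchoice) blast
  then obtain k where k: "(\<Prod>i\<in>I. f i x ^ e i) * denominator x ^ K = (\<Sum>t\<in>T. k e t * monomial t x)"
    if "e \<in> S" "x \<in> X" for e x by blast
  obtain c where c: "\<exists>e\<in>S. c e \<noteq> 0" "\<forall>t\<in>T. (\<Sum>e\<in>S. c e * k e t) = 0"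
    using nontrivial_solution[OF fin(2,1) less, of k] by blast
  \<comment> \<open>Dropping the zero coefficients makes non-emptiness of \<open>E\<close> express
    that the relation is non-trivial.\<close>
  define E where "E = {e \<in> S. c e \<noteq> 0}"
  show ?thesis
  proof
    show "finite E" "E \<noteq> {}" "\<And>e. e \<in> E \<Longrightarrow> c e \<noteq> 0" using fin c(1) by (auto simp: E_def)
    show "E \<subseteq> extensional I" by (auto simp: E_def S_def PiE_def)
    fix x assume x: "x \<in> X"
    have "(\<Sum>e\<in>E. c e * (\<Prod>i\<in>I. f i x ^ e i)) = (\<Sum>e\<in>S. c e * (\<Prod>i\<in>I. f i x ^ e i))"
      unfolding E_def by (rule sum.mono_neutral_left) (use fin(1) in auto)
    then have "(\<Sum>e\<in>E. c e * (\<Prod>i\<in>I. f i x ^ e i)) * denominator x ^ K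
        = (\<Sum>e\<in>S. c e * (\<Prod>i\<in>I. f i x ^ e i)) * denominator x ^ K" by (rule arg_cong)
    also have "\<dots> = (\<Sum>e\<in>S. c e * (\<Sum>t\<in>T. k e t * monomial t x))"
      unfolding sum_distrib_right by (rule sum.cong) (simp_all add: k[OF _ x, symmetric] mult.assoc)
    also have "\<dots> = (\<Sum>e\<in>S. \<Sum>t\<in>T. c e * k e t * monomial t x)"
      by (simp only: sum_distrib_left mult.assoc)
    also have "\<dots> = (\<Sum>t\<in>T. (\<Sum>e\<in>S. c e * k e t) * monomial t x)"
      by (subst sum.swap) (simp only: sum_distrib_right)
    also have "\<dots> = 0" using c(2) by (intro sum.neutral) simp
    finally show "(\<Sum>e\<in>E. c e * (\<Prod>i\<in>I. f i x ^ e i)) = 0"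
      using denominator_nonzero[OF x] by (metis mult_eq_0_iff power_not_zero)
  qed
qed

subsection \<open>Chains of prime ideals\<close>

text \<open>A non-zero polynomial in \<open>f k\<close>, ..., \<open>f n\<close> whose value lies in
  \<open>V\<close>. Exponent vectors are extensional on \<open>{k..n}\<close>, so distinct elements
  of \<open>E\<close> are distinct monomials; for \<open>k = n + 1\<close> only one vector is left
  and the polynomial is a non-zero constant.\<close>

definition relation_mod :: "(nat \<Rightarrow> 'a \<Rightarrow> complex) \<Rightarrow> nat \<Rightarrow> nat \<Rightarrow> ('a \<Rightarrow> complex) set \<Rightarrow> bool" where
  "relation_mod f k n V = (\<exists>E c. finite E \<and> E \<noteq> {} \<and> E \<subseteq> extensional {k..n} \<and> (\<forall>e\<in>E. c e \<noteq> 0) \<and>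
     (\<lambda>x\<in>X. \<Sum>e\<in>E. c e * (\<Prod>i\<in>{k..n}. f i x ^ e i)) \<in> V)"

lemma relation_modE:
  assumes "relation_mod f k n V"
  obtains E c where "finite E" "E \<noteq> {}" "E \<subseteq> extensional {k..n}" "\<And>e. e \<in> E \<Longrightarrow> c e \<noteq> 0"
    "(\<lambda>x\<in>X. \<Sum>e\<in>E. c e * (\<Prod>i\<in>{k..n}. f i x ^ e i)) \<in> V"
proof -
  from assms obtain E c where *: "finite E \<and> E \<noteq> {} \<and> E \<subseteq> extensional {k..n} \<and> (\<forall>e\<in>E. c e \<noteq> 0) \<and>
     (\<lambda>x\<in>X. \<Sum>e\<in>E. c e * (\<Prod>i\<in>{k..n}. f i x ^ e i)) \<in> V"
    unfolding relation_mod_def by blast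
  show thesis by (rule that[of E c]) (use * in blast)+
qed

text \<open>
  Divide the relation by the largest power of \<open>f k\<close> dividing it; then only the terms free of
  \<open>f k\<close> matter modulo \<open>V'\<close>.
\<close>
lemma relation_mod_step:
  assumes rel: "relation_mod f k n V" and kn: "k \<le> n"
    and V': "ideal V' A" "V \<subseteq> V'" "f k \<in> V'"
    and reg: "\<And>i. i \<in> {k..n} \<Longrightarrow> f i \<in> reg"
    and cancel: "\<And>g. \<lbrakk>restrict g X \<in> reg; (\<lambda>x\<in>X. f k x * g x) \<in> V\<rbrakk> \<Longrightarrow> restrict g X \<in> V"
  shows "relation_mod f (Suc k) n V'"
proof -
  obtain E c where E: "finite E" "E \<noteq> {}" "E \<subseteq> extensional {k..n}" "\<And>e. e \<in> E \<Longrightarrow> c e \<noteq> 0"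
    and inV: "(\<lambda>x\<in>X. \<Sum>e\<in>E. c e * (\<Prod>i\<in>{k..n}. f i x ^ e i)) \<in> V"
    by (rule relation_modE[OF rel]) (rule that)
  define m where "m = Min ((\<lambda>e. e k) ` E)"
  have m_le: "m \<le> e k" if "e \<in> E" for e using E(1) that by (simp add: m_def)
  have "m \<in> (\<lambda>e. e k) ` E" using E(1,2) unfolding m_def by (intro Min_in) auto
  then obtain e0 where e0: "e0 \<in> E" "e0 k = m" by auto
  define R where "R e x = (\<Prod>i\<in>{Suc k..n}. f i x ^ e i)" for e x
  have split: "(\<Prod>i\<in>{k..n}. f i x ^ e i) = f k x ^ e k * R e x" for e x
    using kn by (simp add: R_def prod.atLeast_Suc_atMost)
  have R_reg: "(\<lambda>x\<in>X. R e x) \<in> reg" for e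
    unfolding R_def by (intro regular_intros reg) auto
  define g where "g j x = (\<Sum>e\<in>E. c e * (f k x ^ (e k - j) * R e x))" for j x
  have fk_reg: "f k \<in> reg" using reg kn by simp
  have g_reg: "(\<lambda>x\<in>X. g j x) \<in> reg" for j
    unfolding g_def by (intro regular_intros R_reg fk_reg)
  have "(\<lambda>x\<in>X. g j x) \<in> V" if "j \<le> m" for j using that
  proof (induction j)
    case 0 then show ?case using inV by (simp add: g_def split)
  next
    case (Suc j)
    have "f k x * g (Suc j) x = g j x" for x
      unfolding g_def sum_distrib_left
    proof (rule sum.cong)
      fix e assume "e \<in> E"
      then have "e k - j = Suc (e k - Suc j)" using m_le[of e] Suc.prems by simp
      then show "f k x * (c e * (f k x ^ (e k - Suc j) * R e x)) = c e * (f k x ^ (e k - j) * R e x)"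
        by simp
    qed simp
    then show ?case using Suc cancel[OF g_reg[of "Suc j"]] by simp
  qed
  then have gV: "(\<lambda>x\<in>X. g m x) \<in> V'" using V'(2) by blast
  \<comment> \<open>After division by \<open>f k ^ m\<close> exactly the terms with exponent
    \<open>m\<close> at \<open>k\<close> are free of \<open>f k\<close>; all others lie in
    \<open>V'\<close>.\<close>
  define E1 where "E1 = {e \<in> E. e k = m}"
  have "(\<lambda>x\<in>X. \<Sum>e\<in>E - E1. c e * (f k x ^ (e k - m) * R e x)) \<in> V'"
  proof (rule regular_ideal_sum[OF V'(1)])
    fix e assume "e \<in> E - E1"
    then have pos: "e k - m = Suc (e k - m - 1)" using m_le[of e] by (auto simp: E1_def)
    have "(\<lambda>x\<in>X. (c e * (f k x ^ (e k - m - 1) * R e x)) * f k x) \<in> V'"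
      by (rule regular_ideal_closed(4)[OF V'(1)])
        (intro regular_intros R_reg fk_reg, use V'(3) fk_reg in simp)
    moreover have "(c e * (f k x ^ (e k - m - 1) * R e x)) * f k x
        = c e * (f k x ^ (e k - m) * R e x)" for x
      by (subst (2) pos) simp
    ultimately show "(\<lambda>x\<in>X. c e * (f k x ^ (e k - m) * R e x)) \<in> V'" by (simp only:)
  qed
  from regular_ideal_closed(5)[OF V'(1) gV this]
  have *: "(\<lambda>x\<in>X. \<Sum>e\<in>E1. c e * R e x) \<in> V'"
  proof (rule back_subst[of "\<lambda>u. u \<in> V'"], intro restrict_ext)
    fix x
    have "g m x = (\<Sum>e\<in>E1. c e * (f k x ^ (e k - m) * R e x))
        + (\<Sum>e\<in>E - E1. c e * (f k x ^ (e k - m) * R e x))"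
      unfolding g_def using E(1) by (subst sum.subset_diff[of E1 E]) (auto simp: E1_def)
    then show "g m x - (\<Sum>e\<in>E - E1. c e * (f k x ^ (e k - m) * R e x)) = (\<Sum>e\<in>E1. c e * R e x)"
      by (simp add: E1_def)
  qed
  \<comment> \<open>The exponent at \<open>k\<close> is reset to \<open>undefined\<close> to stay
    extensional. On \<open>E1\<close> that exponent is always \<open>m\<close>, so no two terms
    merge.\<close>
  define drop where "drop e = e(k := undefined)" for e :: "nat \<Rightarrow> nat"
  have inj: "inj_on drop E1"
  proof (rule inj_onI)
    fix e e' assume "e \<in> E1" "e' \<in> E1" "drop e = drop e'"
    then show "e = e'" unfolding drop_def E1_def by (metis (mono_tags, lifting) fun_upd_triv fun_upd_upd mem_Collect_eq)
  qed
  have R_drop: "R (drop e) x = R e x" for e x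
    unfolding R_def drop_def by (rule prod.cong) auto
  define c' where "c' e = c (inv_into E1 drop e)" for e
  have c': "c' (drop e) = c e" if "e \<in> E1" for e
    using inv_into_f_f[OF inj that] by (simp add: c'_def)
  show ?thesis unfolding relation_mod_def
  proof (intro exI conjI)
    show "finite (drop ` E1)" "drop ` E1 \<noteq> {}" using E(1) e0 by (auto simp: E1_def)
    show "drop ` E1 \<subseteq> extensional {Suc k..n}"
      using E(3) by (fastforce simp: E1_def drop_def extensional_def)
    show "\<forall>e\<in>drop ` E1. c' e \<noteq> 0" using c' E(4) by (auto simp: E1_def)
    show "(\<lambda>x\<in>X. \<Sum>e\<in>drop ` E1. c' e * (\<Prod>i\<in>{Suc k..n}. f i x ^ e i)) \<in> V'"
      using * unfolding R_def[symmetric] by (simp add: sum.reindex[OF inj] c' R_drop)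
  qed
qed

text \<open>Starting from the relation obtained by counting monomials, each function is divided out
  in turn: \<open>F\<close> because it is a non-zero-divisor, every later one because it lies
  outside the previous prime ideal. A chain that is too long would leave a non-zero constant in the
  proper ideal \<open>C n\<close>.\<close>

lemma prime_chain_length:
  assumes C: "\<And>i. i \<le> m \<Longrightarrow> primeideal (C i) A" "\<And>i. i < m \<Longrightarrow> C i \<subset> C (Suc i)"
    and F: "F \<in> C 0" "\<And>g. \<lbrakk>g \<in> reg; \<And>x. x \<in> X \<Longrightarrow> F x * g x = 0\<rbrakk> \<Longrightarrow> g = (\<lambda>x\<in>X. 0)"
  shows "m < CARD('i)"
proof (rule ccontr)
  define n where "n = CARD('i)"
  assume "\<not> m < CARD('i)"
  then have nm: "n \<le> m" by (simp add: n_def)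
  have ideal: "ideal (C i) A" if "i \<le> n" for i
    using C(1)[of i] that nm by (simp add: primeideal_def)
  have "\<exists>g. g \<in> C (Suc i) - C i" if "i < n" for i using C(2)[of i] that nm by auto
  then obtain g where g: "g i \<in> C (Suc i)" "g i \<notin> C i" if "i < n" for i by (metis DiffE)
  \<comment> \<open>Shifted by one: for positive \<open>i\<close> the function \<open>f i\<close>
    lies in \<open>C i\<close> but not in \<open>C (i - 1)\<close>.\<close>
  define f where "f i = (if i = 0 then F else g (i - 1))" for i
  have f_mem: "f i \<in> C i" if "i \<le> n" for i using F(1) g(1)[of "i - 1"] that by (auto simp: f_def)
  have f_reg: "f i \<in> reg" if "i \<le> n" for i
    using regular_ideal_closed(2)[OF ideal f_mem] that by blast
  have card: "card {..n} = Suc CARD('i)" by (simp add: n_def)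
  have regs: "\<And>i. i \<in> {..n} \<Longrightarrow> f i \<in> reg" using f_reg by simp
  obtain E c where E: "finite E" "E \<noteq> {}" "E \<subseteq> extensional {..n}" "\<And>e. e \<in> E \<Longrightarrow> c e \<noteq> (0::complex)"
    "\<And>x. x \<in> X \<Longrightarrow> (\<Sum>e\<in>E. c e * (\<Prod>i\<in>{..n}. f i x ^ e i)) = 0"
    by (rule algebraic_relation[where f = f, OF finite_atMost card regs]) (assumption, rule that)
  have zero: "(\<lambda>x\<in>X. \<Sum>e\<in>E. c e * (\<Prod>i\<in>{..n}. f i x ^ e i)) = (\<lambda>x\<in>X. 0)"
    using E(5) by (rule restrict_ext)
  have rel0: "relation_mod f 0 n {\<lambda>x\<in>X. 0}"
    unfolding relation_mod_def atLeast0AtMost using E(1-4) zero by blast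
  have "relation_mod f (Suc k) n (C k)" if "k \<le> n" for k using that
  proof (induction k)
    case 0
    show ?case
    proof (rule relation_mod_step[OF rel0])
      fix h assume h: "restrict h X \<in> reg" and 0: "(\<lambda>x\<in>X. f 0 x * h x) \<in> {\<lambda>x\<in>X. 0}"
      have "restrict h X = (\<lambda>x\<in>X. 0)"
      proof (rule F(2)[OF h])
        fix x assume "x \<in> X"
        have "(\<lambda>x\<in>X. f 0 x * h x) x = (\<lambda>x\<in>X. 0) x" using 0 by (simp only: singleton_iff)
        then show "F x * restrict h X x = 0" using \<open>x \<in> X\<close> by (simp add: f_def)
      qed
      then show "restrict h X \<in> {\<lambda>x\<in>X. 0}" by simp
    next
      show "{\<lambda>x\<in>X. 0} \<subseteq> C 0" using regular_ideal_closed(1)[OF ideal] by simp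
    qed (simp_all add: ideal f_mem f_reg)
  next
    case (Suc k)
    show ?case
    proof (rule relation_mod_step[OF Suc.IH])
      fix h assume h: "restrict h X \<in> reg" and mem: "(\<lambda>x\<in>X. f (Suc k) x * h x) \<in> C k"
      have "f (Suc k) \<notin> C k" using g(2)[of k] Suc.prems by (simp add: f_def)
      then show "restrict h X \<in> C k"
        using regular_primeideal_mult[OF C(1)[of k] _ h mem] f_reg[of "Suc k"] Suc.prems nm by auto
    next
      show "C k \<subseteq> C (Suc k)" using C(2)[of k] Suc.prems nm by auto
    qed (use Suc.prems in \<open>simp_all add: ideal f_mem f_reg\<close>)
  qed
  then have "relation_mod f (Suc n) n (C n)" by simp
  then obtain E c where "E \<noteq> {}" "E \<subseteq> extensional {Suc n..n}" "\<And>e. e \<in> E \<Longrightarrow> c e \<noteq> 0"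
    and *: "(\<lambda>x\<in>X. \<Sum>e\<in>E. c e * (\<Prod>i\<in>{Suc n..n}. f i x ^ e i)) \<in> C n"
    by (rule relation_modE) (rule that)
  \<comment> \<open>\<open>{Suc n..n}\<close> is empty, so \<open>E\<close> is a singleton, and the
    product over the empty index set is 1.\<close>
  then obtain e where "E = {e}" "c e \<noteq> 0" by (auto simp: extensional_empty)
  then have "(\<lambda>x\<in>X. 1 / c e * c e) \<in> C n"
    using * by (intro regular_ideal_closed(4)[OF ideal]) (auto intro: regular_intros)
  then have "\<one>\<^bsub>A\<^esub> \<in> C n" using \<open>c e \<noteq> 0\<close> by simp
  then show False
    using ideal.one_imp_carrier[OF ideal[OF le_refl]] primeideal.I_notcarr[OF C(1)[OF nm]] by simp
qed

end

context laurent_space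
begin

subsection \<open>Vanishing ideals\<close>

definition vanishing :: "'a set \<Rightarrow> ('a \<Rightarrow> complex) set" where
  "vanishing Z = {f \<in> reg. \<forall>x\<in>Z. f x = 0}"

text \<open>A sufficient substitute for irreducibility that avoids factorizing polynomials: every
  two points lie on one curve, parametrized holomorphically by a connected open subset of the
  complex plane.\<close>

definition curve_connected :: "'a set \<Rightarrow> bool" where
  "curve_connected Z \<longleftrightarrow> (\<forall>p\<in>Z. \<forall>q\<in>Z. \<exists>T \<theta>. open T \<and> connected T \<and> \<theta> ` T \<subseteq> Z \<and>
     p \<in> \<theta> ` T \<and> q \<in> \<theta> ` T \<and> (\<forall>i. (\<lambda>t. coord i (\<theta> t)) holomorphic_on T))"

lemma curve_connected_singleton: "curve_connected {z}"
  unfolding curve_connected_def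
  by (intro ballI exI[of _ UNIV] exI[of _ "\<lambda>_. z"]) auto

lemma ideal_vanishing: "Z \<subseteq> X \<Longrightarrow> ideal (vanishing Z) A"
proof -
  assume Z: "Z \<subseteq> X"
  interpret cring A by (rule cring_coordinate_ring)
  show ?thesis
  proof (rule idealI)
    show "ring A" by unfold_locales
    have "inv\<^bsub>add_monoid A\<^esub> f \<in> vanishing Z" if f: "f \<in> vanishing Z" for f
      unfolding a_inv_def[symmetric]
      using coordinate_ring_a_inv[of f X G] Z f by (auto simp: vanishing_def intro: regular_intros)
    then show "subgroup (vanishing Z) (add_monoid A)"
      by (intro subgroup.intro) (use Z in \<open>auto simp: vanishing_def intro: regular_intros\<close>)
  qed (use Z in \<open>auto simp: vanishing_def intro: regular_intros\<close>)
qed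

text \<open>Identity theorem: if \<open>f p \<noteq> 0\<close> and \<open>g q \<noteq> 0\<close>,
  take a curve through \<open>p\<close> and \<open>q\<close>. Along it \<open>f\<close> is non-zero
  on a non-empty open set of parameters, where \<open>g\<close> must vanish; then \<open>g\<close>
  vanishes on the whole curve, including \<open>q\<close>.\<close>

lemma primeideal_vanishing:
  assumes Z: "Z \<subseteq> X" "Z \<noteq> {}" "curve_connected Z"
  shows "primeideal (vanishing Z) A"
proof (rule primeidealI)
  show "ideal (vanishing Z) A" using Z by (simp add: ideal_vanishing)
  show "cring A" by (rule cring_coordinate_ring)
  obtain z where z: "z \<in> Z" using Z by blast
  have "(\<lambda>x\<in>X. 1) z = (1::complex)" using z Z(1) by auto
  then have "(\<lambda>x\<in>X. 1) \<in> reg - vanishing Z"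
    using z by (force simp: vanishing_def intro: regular_intros)
  then show "carrier A \<noteq> vanishing Z" by auto
  fix f g assume fg: "f \<in> carrier A" "g \<in> carrier A" "f \<otimes>\<^bsub>A\<^esub> g \<in> vanishing Z"
  show "f \<in> vanishing Z \<or> g \<in> vanishing Z"
  proof (rule ccontr)
    assume "\<not> (f \<in> vanishing Z \<or> g \<in> vanishing Z)"
    then obtain p q where pq: "p \<in> Z" "f p \<noteq> 0" "q \<in> Z" "g q \<noteq> 0"
      using fg by (auto simp: vanishing_def)
    obtain T \<theta> where T: "open T" "connected T" "\<theta> ` T \<subseteq> Z" "p \<in> \<theta> ` T" "q \<in> \<theta> ` T"
      and hol: "\<And>i. (\<lambda>t. coord i (\<theta> t)) holomorphic_on T"
      using Z(3) pq(1,3) unfolding curve_connected_def by metis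
    obtain s t where st: "s \<in> T" "\<theta> s = p" "t \<in> T" "\<theta> t = q" using T by blast
    have TX: "\<theta> r \<in> X" if "r \<in> T" for r using T(3) Z(1) that by blast
    have holf: "(\<lambda>t. f (\<theta> t)) holomorphic_on T" and holg: "(\<lambda>t. g (\<theta> t)) holomorphic_on T"
      using fg(1,2) by (auto intro: holomorphic_along_curve[OF _ TX hol])
    have prod0: "f (\<theta> r) * g (\<theta> r) = 0" if "r \<in> T" for r
    proof -
      have "(\<lambda>x\<in>X. f x * g x) (\<theta> r) = 0" using fg(3) T(3) that by (auto simp: vanishing_def)
      then show ?thesis using TX[OF that] by simp
    qed
    have "continuous_on T (\<lambda>t. f (\<theta> t))" using holf by (rule holomorphic_on_imp_continuous_on)
    then have "open {r \<in> T. f (\<theta> r) \<noteq> 0}"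
      using T(1) continuous_open_preimage[of T "\<lambda>t. f (\<theta> t)" "- {0}"]
      by (simp add: vimage_def Int_def open_Compl)
    then have "g (\<theta> t) = 0"
      using analytic_continuation_open[of "{r \<in> T. f (\<theta> r) \<noteq> 0}" T "\<lambda>t. g (\<theta> t)" "\<lambda>_. 0" t]
        T(1,2) st pq prod0 holg by auto
    then show False using st pq by simp
  qed
qed

subsection \<open>Directional derivatives\<close>

definition line :: "'a \<Rightarrow> ('i \<Rightarrow> complex) \<Rightarrow> complex \<Rightarrow> 'a" where
  "line z v t = pt (\<lambda>i. coord i z + t * v i)"

text \<open>The derivation at \<open>z\<close> belonging to the tangent vector \<open>v\<close>.
  Differentiating in the parameter of a line makes it a complex derivative in one variable, with no
  differential structure on the type of points.\<close>

definition dderiv :: "'a \<Rightarrow> ('i \<Rightarrow> complex) \<Rightarrow> ('a \<Rightarrow> complex) \<Rightarrow> complex" where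
  "dderiv z v f = deriv (\<lambda>t. f (line z v t)) 0"

lemma coord_line [simp]: "coord i (line z v t) = coord i z + t * v i"
  by (simp add: line_def)

lemma line_0 [simp]: "line z v 0 = z"
  by (simp add: line_def)

lemma open_line: "open {t. line z v t \<in> X}"
proof -
  have "{t. line z v t \<in> X} = (\<Inter>j\<in>J. {t. coord j z + t * v j \<noteq> 0})"
    by (auto simp: X_eq)
  then show ?thesis
    by (auto intro!: open_INT open_Collect_neq continuous_intros)
qed

lemma eventually_line: "z \<in> X \<Longrightarrow> \<forall>\<^sub>F t in nhds 0. line z v t \<in> X"
  using eventually_nhds_in_open[OF open_line, of 0] by simp

lemma field_differentiable_line:
  assumes "f \<in> reg" "z \<in> X"
  shows "(\<lambda>t. f (line z v t)) field_differentiable at 0"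
proof (rule holomorphic_on_imp_differentiable_at)
  show "(\<lambda>t. f (line z v t)) holomorphic_on {t. line z v t \<in> X}"
    using assms(1) by (rule holomorphic_along_curve) (auto intro!: holomorphic_intros)
qed (use assms open_line in auto)

lemma dderiv_cong:
  assumes "z \<in> X" "\<And>x. x \<in> X \<Longrightarrow> f x = g x"
  shows "dderiv z v f = dderiv z v g"
  unfolding dderiv_def
  by (rule deriv_cong_ev[OF eventually_mono[OF eventually_line[OF assms(1)] assms(2)]]) auto

lemma dderiv_const [simp]: "z \<in> X \<Longrightarrow> dderiv z v (\<lambda>x\<in>X. c) = 0"
  by (subst dderiv_cong[of _ _ "\<lambda>x. c"]) (auto simp: dderiv_def)

lemma dderiv_coord: "z \<in> X \<Longrightarrow> dderiv z v (\<lambda>x\<in>X. coord i x - c) = v i"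
  by (subst dderiv_cong[of _ _ "\<lambda>x. coord i x - c"])
    (auto simp: dderiv_def intro!: DERIV_imp_deriv derivative_eq_intros)

lemma dderiv_add:
  assumes "f \<in> reg" "g \<in> reg" "z \<in> X"
  shows "dderiv z v (\<lambda>x\<in>X. f x + g x) = dderiv z v f + dderiv z v g"
  using assms by (subst dderiv_cong[of _ _ "\<lambda>x. f x + g x"])
    (auto simp: dderiv_def intro!: deriv_add field_differentiable_line)

lemma dderiv_mult:
  assumes "f \<in> reg" "g \<in> reg" "z \<in> X"
  shows "dderiv z v (\<lambda>x\<in>X. f x * g x) = f z * dderiv z v g + dderiv z v f * g z"
  using assms deriv_mult[OF field_differentiable_line[OF assms(1,3)] field_differentiable_line[OF assms(2,3)], of v v]
  by (subst dderiv_cong[of _ _ "\<lambda>x. f x * g x"]) (auto simp: dderiv_def)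

lemma dderiv_minus:
  assumes "f \<in> reg" "z \<in> X"
  shows "dderiv z v (\<lambda>x\<in>X. - f x) = - dderiv z v f"
proof -
  have "dderiv z v (\<lambda>x\<in>X. - f x) = dderiv z v (\<lambda>x\<in>X. (\<lambda>x\<in>X. -1) x * f x)"
    by (rule dderiv_cong) (use assms in auto)
  then show ?thesis using dderiv_mult[OF _ assms, of "\<lambda>x\<in>X. -1" v] assms(2)
    by (simp add: regular_functions.const)
qed

definition square_ideal :: "'a \<Rightarrow> ('a \<Rightarrow> complex) set" where
  "square_ideal z = vanishing {z} \<cdot>\<^bsub>A\<^esub> vanishing {z}"

lemma ideal_square_ideal: "z \<in> X \<Longrightarrow> ideal (square_ideal z) A"
  unfolding square_ideal_def
  by (intro ring.ideal_prod_is_ideal cring.axioms(1) cring_coordinate_ring ideal_vanishing) auto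

lemma dderiv_square_ideal:
  assumes "f \<in> square_ideal z" "z \<in> X"
  shows "f \<in> vanishing {z} \<and> dderiv z v f = 0"
  using assms(1) unfolding square_ideal_def
proof (induction rule: ideal_prod.induct)
  case (prod f g)
  then show ?case using assms(2) dderiv_mult[of f g z v] 
    by (auto simp: vanishing_def intro: regular_intros)
next
  case (sum f g)
  then show ?case using assms(2) dderiv_add[of f g z v]
    by (auto simp: vanishing_def intro: regular_intros)
qed

definition shifted_coord :: "'a \<Rightarrow> 'i \<Rightarrow> 'a \<Rightarrow> complex" where
  "shifted_coord z i = (\<lambda>x\<in>X. coord i x - coord i z)"

lemma shifted_coord_vanishing: "z \<in> X \<Longrightarrow> shifted_coord z i \<in> vanishing {z}"
  using regular_diff[OF coord_regular regular_functions.const]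
  by (auto simp: shifted_coord_def vanishing_def)

lemma square_idealI: "f \<in> vanishing {z} \<Longrightarrow> g \<in> vanishing {z} \<Longrightarrow> (\<lambda>x\<in>X. f x * g x) \<in> square_ideal z"
  using ideal_prod.prod[of f "vanishing {z}" g "vanishing {z}" A] by (simp add: square_ideal_def)

text \<open>The shifted coordinates span the cotangent space of the ambient space at
  \<open>z\<close>; the linear part is found by following the construction of \<open>f\<close> from
  the generators.\<close>

lemma taylor:
  assumes "f \<in> reg" "z \<in> X"
  shows "\<exists>c. (\<lambda>x\<in>X. f x - f z - (\<Sum>i\<in>UNIV. c i * (coord i x - coord i z))) \<in> square_ideal z"
  using assms(1)
proof (induction rule: regular_induct)
  note closed = regular_ideal_closed[OF ideal_square_ideal[OF assms(2)]]
  have [simp]: "(\<Sum>i\<in>UNIV. (if i = k then a else 0) * b i) = a * b k"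
    for k :: 'i and a :: complex and b
    by (simp add: if_distrib[of "\<lambda>u. u * _"] cong: if_cong)
  {
    case (const c)
    show ?case using closed(1) assms(2) by (intro exI[of _ "\<lambda>_. 0"]) simp
  next
    case (coord i)
    show ?case using closed(1) assms(2)
      by (intro exI[of _ "\<lambda>k. if k = i then 1 else 0"]) simp
  next
    case (inverse j)
    let ?z = "coord j z"
    have nz: "?z \<noteq> 0" using coord_nonzero[OF assms(2) inverse] .
    \<comment> \<open>The remainder of \<open>1 / x\<close> after its linear part at
      \<open>z\<close> is \<open>(x - z)\<^sup>2 / (x z\<^sup>2)\<close>.\<close>
    have "(\<lambda>x\<in>X. ((1 / coord j x) * (1 / ?z\<^sup>2)) * (shifted_coord z j x * shifted_coord z j x)) \<in> square_ideal z"
    proof (rule closed(4))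
      show "(\<lambda>x\<in>X. 1 / coord j x * (1 / ?z\<^sup>2)) \<in> reg"
        by (intro regular_mult inverse_coord_regular inverse regular_functions.const)
      show "(\<lambda>x\<in>X. shifted_coord z j x * shifted_coord z j x) \<in> square_ideal z"
        by (intro square_idealI shifted_coord_vanishing assms(2))
    qed
    then have "(\<lambda>x\<in>X. 1 / coord j x - 1 / ?z - (- 1 / ?z\<^sup>2) * (coord j x - ?z)) \<in> square_ideal z"
    proof (rule back_subst[of "\<lambda>u. u \<in> square_ideal z"], intro restrict_ext)
      fix x assume "x \<in> X"
      then show "((1 / coord j x) * (1 / ?z\<^sup>2)) * (shifted_coord z j x * shifted_coord z j x)
          = 1 / coord j x - 1 / ?z - (- 1 / ?z\<^sup>2) * (coord j x - ?z)"
        using nz coord_nonzero[OF _ inverse, of x]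
        by (simp add: shifted_coord_def field_simps power2_eq_square)
    qed
    then show ?case using assms(2)
      by (intro exI[of _ "\<lambda>k. if k = j then - 1 / ?z\<^sup>2 else 0"]) simp
  next
    case (add f g)
    then obtain c d where
      c: "(\<lambda>x\<in>X. f x - f z - (\<Sum>i\<in>UNIV. c i * (coord i x - coord i z))) \<in> square_ideal z" and
      d: "(\<lambda>x\<in>X. g x - g z - (\<Sum>i\<in>UNIV. d i * (coord i x - coord i z))) \<in> square_ideal z"
      by blast
    have "(\<lambda>x\<in>X. f x + g x - (f z + g z) - (\<Sum>i\<in>UNIV. (c i + d i) * (coord i x - coord i z)))
      \<in> square_ideal z"
      using closed(3)[OF c d]
      by (rule back_subst[of "\<lambda>u. u \<in> square_ideal z"], intro restrict_ext)
        (simp only: distrib_right sum.distrib, simp)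
    then show ?case using assms(2) by (intro exI[of _ "\<lambda>i. c i + d i"]) simp
  next
    case (mult f g)
    then obtain c d where
      c: "(\<lambda>x\<in>X. f x - f z - (\<Sum>i\<in>UNIV. c i * (coord i x - coord i z))) \<in> square_ideal z" and
      d: "(\<lambda>x\<in>X. g x - g z - (\<Sum>i\<in>UNIV. d i * (coord i x - coord i z))) \<in> square_ideal z"
      by blast
    \<comment> \<open>The remainder of \<open>f g\<close> is \<open>g z\<close> times the remainder
      of \<open>f\<close>, plus \<open>f z\<close> times that of \<open>g\<close>, plus
      \<open>(f - f z) (g - g z)\<close>.\<close>
    have 1: "(\<lambda>x\<in>X. g z * (f x - f z - (\<Sum>i\<in>UNIV. c i * (coord i x - coord i z)))) \<in> square_ideal z"
      by (rule closed(4)[OF regular_functions.const c])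
    have 2: "(\<lambda>x\<in>X. f z * (g x - g z - (\<Sum>i\<in>UNIV. d i * (coord i x - coord i z)))) \<in> square_ideal z"
      by (rule closed(4)[OF regular_functions.const d])
    have "(\<lambda>x\<in>X. h x - h z) \<in> vanishing {z}" if "h \<in> reg" for h
      using regular_diff[OF _ regular_functions.const, of h X G "h z"] that assms(2)
      by (auto simp: vanishing_def)
    from square_idealI[OF this[OF mult(1)] this[OF mult(2)]]
    have 3: "(\<lambda>x\<in>X. (f x - f z) * (g x - g z)) \<in> square_ideal z" by simp
    have "(\<lambda>x\<in>X. f x * g x - f z * g z - (\<Sum>i\<in>UNIV. (g z * c i + f z * d i) * (coord i x - coord i z)))
      \<in> square_ideal z"
      using closed(3)[OF closed(3)[OF 1 2] 3]
      by (rule back_subst[of "\<lambda>u. u \<in> square_ideal z"], intro restrict_ext)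
        (simp only: distrib_right sum.distrib mult.assoc sum_distrib_left[symmetric],
          simp add: algebra_simps)
    then show ?case using assms(2) by (intro exI[of _ "\<lambda>i. g z * c i + f z * d i"]) simp
  }
qed

text \<open>Derivations annihilate \<open>square_ideal z\<close>, so any linear part modulo this
  ideal computes all directional derivatives at once; in particular they are linear in
  \<open>v\<close>.\<close>

lemma dderiv_taylor:
  assumes "f \<in> reg" "z \<in> X"
    and "(\<lambda>x\<in>X. f x - f z - (\<Sum>i\<in>UNIV. c i * (coord i x - coord i z))) \<in> square_ideal z"
  shows "dderiv z v f = (\<Sum>i\<in>UNIV. c i * v i)"
proof -
  let ?l = "\<lambda>x\<in>X. f z + (\<Sum>i\<in>UNIV. c i * (coord i x - coord i z))"
  let ?q = "\<lambda>x\<in>X. f x - f z - (\<Sum>i\<in>UNIV. c i * (coord i x - coord i z))"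
  have l: "?l \<in> reg" by (intro regular_intros coord_regular)
  have q: "?q \<in> reg" "dderiv z v ?q = 0"
    using dderiv_square_ideal[OF assms(3,2)] by (auto simp: vanishing_def)
  have "dderiv z v f = dderiv z v (\<lambda>x\<in>X. ?l x + ?q x)"
    by (rule dderiv_cong) (use assms in auto)
  also have "\<dots> = dderiv z v ?l" using dderiv_add[OF l q(1) assms(2)] q(2) by simp
  also have "\<dots> = dderiv z v (\<lambda>x. f z + (\<Sum>i\<in>UNIV. c i * (coord i x - coord i z)))"
    by (rule dderiv_cong) (use assms in auto)
  also have "\<dots> = (\<Sum>i\<in>UNIV. c i * v i)"
    unfolding dderiv_def
    by (auto simp: mult.commute intro!: DERIV_imp_deriv derivative_eq_intros)
  finally show ?thesis .
qed

end

section \<open>Hypersurfaces\<close>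

lemma (in laurent_space) regular_ideal_add:
  "ideal I A \<Longrightarrow> f \<in> I \<Longrightarrow> g \<in> I \<Longrightarrow> (\<lambda>x\<in>X. f x + g x) \<in> I"
proof -
  assume I: "ideal I A" "f \<in> I" "g \<in> I"
  have "restrict f X \<in> I" "restrict g X \<in> I"
    using I(2,3) regular_ideal_closed(2)[OF I(1,2)] regular_ideal_closed(2)[OF I(1,3)] by simp_all
  then show ?thesis by (rule regular_ideal_closed(3)[OF I(1)])
qed

text \<open>\<open>B\<close> is presented by a surjection whose kernel consists of the multiples of
  \<open>F\<close>, not as a literal quotient ring: this covers the ring of invariants and the fibre
  rings alike. Describing the kernel by multiples of \<open>F\<close> keeps the scheme structure,
  which vanishing on the zero set would not.\<close>

locale hypersurface = laurent_space coord pt J X G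
  for coord :: "'i::finite \<Rightarrow> 'a \<Rightarrow> complex" and pt J X G +
  fixes B :: "('b, 'm) ring_scheme" and \<pi> :: "('a \<Rightarrow> complex) \<Rightarrow> 'b"
    and F :: "'a \<Rightarrow> complex" and dF :: "'i \<Rightarrow> 'a \<Rightarrow> complex"
  assumes cring_B: "cring B"
    and hom: "\<pi> \<in> ring_hom (coordinate_ring X G) B"
    and surj: "\<pi> ` regular_functions X G = carrier B"
    and F_regular: "F \<in> regular_functions X G"
    and kernel: "f \<in> regular_functions X G \<Longrightarrow>
      \<pi> f = \<zero>\<^bsub>B\<^esub> \<longleftrightarrow> (\<exists>g\<in>regular_functions X G. \<forall>x\<in>X. f x = g x * F x)"
    and nonzerodivisor: "\<lbrakk>g \<in> regular_functions X G; \<And>x. x \<in> X \<Longrightarrow> F x * g x = 0\<rbrakk> \<Longrightarrow> g = (\<lambda>x\<in>X. 0)"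
    and derivative: "z \<in> X \<Longrightarrow>
      ((\<lambda>t. F (pt (\<lambda>i. coord i z + t * v i))) has_field_derivative (\<Sum>i\<in>UNIV. dF i z * v i)) (at 0)"
begin

sublocale hom: ring_hom_ring A B \<pi>
  by (intro ring_hom_ring.intro ring_hom_ring_axioms.intro cring.axioms(1) cring_coordinate_ring
      cring_B hom)

lemma \<pi>_closed: "f \<in> reg \<Longrightarrow> \<pi> f \<in> carrier B"
  using surj by blast

lemma \<pi>_minus:
  assumes "f \<in> reg" "g \<in> reg"
  shows "\<pi> f \<ominus>\<^bsub>B\<^esub> \<pi> g = \<pi> (\<lambda>x\<in>X. f x - g x)"
proof -
  have "\<pi> f \<ominus>\<^bsub>B\<^esub> \<pi> g = \<pi> (f \<ominus>\<^bsub>A\<^esub> g)"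
    using assms hom.hom_add[of f "\<ominus>\<^bsub>A\<^esub> g"] hom.hom_a_inv[of g] hom.R.a_inv_closed[of g]
    by (simp add: a_minus_def del: coordinate_ring_simps(3))
  then show ?thesis by (simp add: coordinate_ring_a_minus[OF assms])
qed

lemma \<pi>_eq_iff:
  assumes "f \<in> reg" "g \<in> reg"
  shows "\<pi> f = \<pi> g \<longleftrightarrow> (\<exists>q\<in>reg. \<forall>x\<in>X. f x - g x = q x * F x)"
proof -
  have "\<pi> f = \<pi> g \<longleftrightarrow> \<pi> f \<ominus>\<^bsub>B\<^esub> \<pi> g = \<zero>\<^bsub>B\<^esub>"
    using \<pi>_closed[OF assms(1)] \<pi>_closed[OF assms(2)]
    by (metis a_minus_def hom.S.minus_equality hom.S.minus_minus hom.S.a_inv_closed hom.S.r_neg)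
  also have "\<pi> f \<ominus>\<^bsub>B\<^esub> \<pi> g = \<pi> (\<lambda>x\<in>X. f x - g x)"
    by (rule \<pi>_minus[OF assms])
  also have "\<dots> = \<zero>\<^bsub>B\<^esub> \<longleftrightarrow> (\<exists>q\<in>reg. \<forall>x\<in>X. f x - g x = q x * F x)"
    by (subst kernel) (use assms in \<open>auto intro: regular_intros\<close>)
  finally show ?thesis .
qed

lemma \<pi>_add: "f \<in> reg \<Longrightarrow> g \<in> reg \<Longrightarrow> \<pi> f \<oplus>\<^bsub>B\<^esub> \<pi> g = \<pi> (\<lambda>x\<in>X. f x + g x)"
  using ring_hom_add[OF hom, of f g] by simp

lemma \<pi>_mult: "f \<in> reg \<Longrightarrow> g \<in> reg \<Longrightarrow> \<pi> f \<otimes>\<^bsub>B\<^esub> \<pi> g = \<pi> (\<lambda>x\<in>X. f x * g x)"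
  using ring_hom_mult[OF hom, of f g] by simp

lemma \<pi>_F: "\<pi> F = \<zero>\<^bsub>B\<^esub>"
  unfolding kernel[OF F_regular]
  by (rule bexI[of _ "\<lambda>x\<in>X. 1"]) (auto intro: regular_intros)

lemma ideal_image: "ideal I A \<Longrightarrow> ideal (\<pi> ` I) B"
proof -
  assume I: "ideal I A"
  interpret I: ideal I A by fact
  note closed = regular_ideal_closed[OF I]
  show ?thesis
  proof (rule idealI)
    show "ring B" by (rule cring.axioms(1)[OF cring_B])
    have "subgroup (\<pi> ` I) (add_monoid B)"
    proof (rule subgroup.intro)
      show "\<pi> ` I \<subseteq> carrier (add_monoid B)" using closed(2) \<pi>_closed by auto
      show "\<one>\<^bsub>add_monoid B\<^esub> \<in> \<pi> ` I" using closed(1) hom.hom_zero by force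
      show "x \<otimes>\<^bsub>add_monoid B\<^esub> y \<in> \<pi> ` I" if "x \<in> \<pi> ` I" "y \<in> \<pi> ` I" for x y
        using that closed(2) regular_ideal_add[OF I] by (auto simp: \<pi>_add)
      show "inv\<^bsub>add_monoid B\<^esub> x \<in> \<pi> ` I" if x: "x \<in> \<pi> ` I" for x
      proof -
        obtain f where f: "f \<in> I" "x = \<pi> f" using x by blast
        have "\<ominus>\<^bsub>A\<^esub> f \<in> I" using I.a_inv_closed[OF f(1)] .
        moreover have "\<ominus>\<^bsub>B\<^esub> x = \<pi> (\<ominus>\<^bsub>A\<^esub> f)"
          unfolding f(2) by (rule hom.hom_a_inv[symmetric]) (use f(1) closed(2) in simp)
        ultimately show ?thesis unfolding a_inv_def[symmetric] by simp
      qed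
    qed
    then show "subgroup (\<pi> ` I) (add_monoid B)" .
  next
    fix a x assume a: "a \<in> \<pi> ` I" and x: "x \<in> carrier B"
    obtain f g where fg: "f \<in> I" "a = \<pi> f" "g \<in> reg" "x = \<pi> g" using a x surj by blast
    have "x \<otimes>\<^bsub>B\<^esub> a = \<pi> (\<lambda>x\<in>X. g x * f x)"
      using fg closed(2) by (simp add: \<pi>_mult)
    moreover have "(\<lambda>x\<in>X. g x * f x) \<in> I"
      by (rule closed(4)) (use fg closed(2)[OF fg(1)] in simp_all)
    ultimately show *: "x \<otimes>\<^bsub>B\<^esub> a \<in> \<pi> ` I" by simp
    show "a \<otimes>\<^bsub>B\<^esub> x \<in> \<pi> ` I"
      using * comm_monoid.m_comm[OF cring.axioms(2)[OF cring_B], of a x] x fg closed(2) \<pi>_closed by auto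
  qed
qed

text \<open>Ideals of \<open>A\<close> containing \<open>F\<close> are recovered from their images,
  because two functions with the same image differ by a multiple of \<open>F\<close>.\<close>

lemma preimage_image:
  assumes "ideal I A" "F \<in> I" "f \<in> reg" "\<pi> f \<in> \<pi> ` I"
  shows "f \<in> I"
proof -
  note closed = regular_ideal_closed[OF assms(1)]
  obtain g where g: "g \<in> I" "\<pi> f = \<pi> g" using assms(4) by blast
  then obtain q where q: "q \<in> reg" "\<And>x. x \<in> X \<Longrightarrow> f x - g x = q x * F x"
    using \<pi>_eq_iff[OF assms(3) closed(2)] by auto
  have "(\<lambda>x\<in>X. (\<lambda>x\<in>X. q x * F x) x + g x) \<in> I"
    by (rule closed(3)) (use q g assms closed(2)[OF g(1)] F_regular in \<open>auto intro: closed(4)\<close>)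
  moreover have "(\<lambda>x\<in>X. (\<lambda>x\<in>X. q x * F x) x + g x) = f"
  proof (rule regular_eqI[OF _ assms(3)])
    show "(\<lambda>x\<in>X. (\<lambda>x\<in>X. q x * F x) x + g x) \<in> reg" using calculation closed(2) by blast
    show "(\<lambda>x\<in>X. (\<lambda>x\<in>X. q x * F x) x + g x) x = f x" if "x \<in> X" for x
      using q(2)[OF that] that by (simp add: algebra_simps)
  qed
  ultimately show ?thesis by simp
qed

lemma primeideal_image:
  assumes "primeideal P A" "F \<in> P"
  shows "primeideal (\<pi> ` P) B"
proof (rule primeidealI)
  interpret P: primeideal P A by fact
  have P: "ideal P A" by (rule P.is_ideal)
  show "ideal (\<pi> ` P) B" by (rule ideal_image[OF P])
  show "cring B" by (rule cring_B)
  show "carrier B \<noteq> \<pi> ` P"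
  proof
    assume "carrier B = \<pi> ` P"
    then have "reg \<subseteq> P" using preimage_image[OF P assms(2)] \<pi>_closed by blast
    then show False using P.I_notcarr regular_ideal_closed(2)[OF P] by auto
  qed
  fix a b assume ab: "a \<in> carrier B" "b \<in> carrier B" "a \<otimes>\<^bsub>B\<^esub> b \<in> \<pi> ` P"
  then obtain f g where fg: "f \<in> reg" "a = \<pi> f" "g \<in> reg" "b = \<pi> g" using surj by blast
  then have "(\<lambda>x\<in>X. f x * g x) \<in> P"
    using ab(3) preimage_image[OF P assms(2), of "\<lambda>x\<in>X. f x * g x"]
    by (simp add: \<pi>_mult regular_mult)
  then show "a \<in> \<pi> ` P \<or> b \<in> \<pi> ` P"
    using P.I_prime[of f g] fg by auto
qed

subsection \<open>Points\<close>

definition scalar :: "complex \<Rightarrow> 'b" where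
  "scalar c = \<pi> (\<lambda>x\<in>X. c)"

text \<open>An arbitrary representative is evaluated. The result is meaningful at zeros of
  \<open>F\<close>, where two representatives of the same element agree.\<close>

definition eval_at :: "'a \<Rightarrow> 'b \<Rightarrow> complex" where
  "eval_at z = (\<lambda>b\<in>carrier B. inv_into reg \<pi> b z)"

lemma eval_at_\<pi>:
  assumes "z \<in> X" "F z = 0" "f \<in> reg"
  shows "eval_at z (\<pi> f) = f z"
proof -
  define g where "g = inv_into reg \<pi> (\<pi> f)"
  have g: "g \<in> reg" "\<pi> g = \<pi> f"
    unfolding g_def using assms(3) by (auto intro!: inv_into_into f_inv_into_f[of "\<pi> f" \<pi> reg])
  then obtain q where "\<forall>x\<in>X. g x - f x = q x * F x" using \<pi>_eq_iff assms(3) by blast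
  then show ?thesis using assms \<pi>_closed[of f] by (auto simp: eval_at_def g_def[symmetric])
qed

lemma eval_at_points:
  assumes "z \<in> X" "F z = 0"
  shows "eval_at z \<in> points B scalar"
proof -
  have "eval_at z \<in> ring_hom B complex_ring"
  proof (rule ring_hom_memI)
    fix a b assume "a \<in> carrier B" "b \<in> carrier B"
    then obtain f g where "f \<in> reg" "a = \<pi> f" "g \<in> reg" "b = \<pi> g" using surj by blast
    then show "eval_at z (a \<otimes>\<^bsub>B\<^esub> b) = eval_at z a \<otimes>\<^bsub>complex_ring\<^esub> eval_at z b"
      "eval_at z (a \<oplus>\<^bsub>B\<^esub> b) = eval_at z a \<oplus>\<^bsub>complex_ring\<^esub> eval_at z b"
      using assms by (simp_all add: \<pi>_mult \<pi>_add eval_at_\<pi> regular_mult regular_add)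
  next
    have "\<one>\<^bsub>B\<^esub> = \<pi> (\<lambda>x\<in>X. 1)" using ring_hom_one[OF hom] by simp
    then show "eval_at z \<one>\<^bsub>B\<^esub> = \<one>\<^bsub>complex_ring\<^esub>"
      using assms by (simp add: eval_at_\<pi> regular_functions.const)
  qed auto
  then show ?thesis unfolding points_def
    using assms by (auto simp: scalar_def eval_at_\<pi> regular_functions.const)
      (auto simp: eval_at_def)
qed

text \<open>Composed with \<open>\<pi>\<close>, a point of \<open>B\<close> becomes an algebra
  homomorphism on \<open>A\<close>, hence the evaluation at some \<open>z\<close>; it sends
  \<open>F\<close> to zero because \<open>\<pi>\<close> does.\<close>

lemma points_eval_at:
  assumes "p \<in> points B scalar"
  obtains z where "z \<in> X" "F z = 0" "p = eval_at z"
proof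
  have p: "p \<in> ring_hom B complex_ring" "p \<in> extensional (carrier B)" "\<And>c. p (scalar c) = c"
    using assms by (auto simp: points_def)
  define z where "z = pt (\<lambda>i. p (\<pi> (\<lambda>x\<in>X. coord i x)))"
  have comp: "p \<circ> \<pi> \<in> ring_hom A complex_ring" by (rule ring_hom_trans[OF hom p(1)])
  have const: "(p \<circ> \<pi>) (\<lambda>x\<in>X. c) = c" for c using p(3) by (simp add: scalar_def)
  show zX: "z \<in> X" by (rule algebra_hom_eval(1)[OF comp const]) (simp add: z_def)
  have eval: "p (\<pi> f) = f z" if "f \<in> reg" for f
    using algebra_hom_eval(2)[OF comp const _ that] by (simp add: z_def)
  show Fz: "F z = 0"
    using eval[OF F_regular] const[of 0] eval[of "\<lambda>x\<in>X. 0"] ring_hom_zero[OF p(1)] cring_B cring_complex_ring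
    by (simp add: \<pi>_F cring_def)
  show "p = eval_at z"
  proof (rule extensionalityI[OF p(2)])
    show "eval_at z \<in> extensional (carrier B)" by (simp add: eval_at_def)
    fix b assume "b \<in> carrier B"
    then obtain f where "f \<in> reg" "b = \<pi> f" using surj by blast
    then show "p b = eval_at z b" using eval zX Fz by (simp add: eval_at_\<pi>)
  qed
qed

lemma max_ideal_eval_at:
  assumes "z \<in> X" "F z = 0"
  shows "max_ideal B (eval_at z) = \<pi> ` vanishing {z}"
proof -
  have "max_ideal B (eval_at z) = {b \<in> carrier B. eval_at z b = 0}"
    by (simp add: a_kernel_def')
  also have "\<dots> = \<pi> ` vanishing {z}"
    using assms by (auto simp: vanishing_def surj[symmetric] eval_at_\<pi>)
  finally show ?thesis .
qed

subsection \<open>Cotangent spaces\<close>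

lemma dderiv_F: "z \<in> X \<Longrightarrow> dderiv z v F = (\<Sum>i\<in>UNIV. dF i z * v i)"
  unfolding dderiv_def line_def by (rule DERIV_imp_deriv) (rule derivative)

text \<open>The expected dimension of the cotangent space: one for each ambient coordinate, less one
  if the linear part of \<open>F\<close> is a non-trivial relation between them.\<close>

definition cotangent_rank :: "'a \<Rightarrow> nat" where
  "cotangent_rank z = (if \<forall>i. dF i z = 0 then CARD('i) else CARD('i) - 1)"

lemma image_square_ideal:
  "\<pi> ` square_ideal z = (\<pi> ` vanishing {z}) \<cdot>\<^bsub>B\<^esub> (\<pi> ` vanishing {z})" if z: "z \<in> X"
proof (intro equalityI subsetI)
  have van: "f \<in> reg" if "f \<in> vanishing {z}" for f using that by (simp add: vanishing_def)
  have sq: "f \<in> reg" if "f \<in> square_ideal z" for f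
    using regular_ideal_closed(2)[OF ideal_square_ideal[OF z] that] .
  {
    fix b assume "b \<in> \<pi> ` square_ideal z"
    then obtain f where f: "f \<in> square_ideal z" "b = \<pi> f" by blast
    have "\<pi> f \<in> (\<pi> ` vanishing {z}) \<cdot>\<^bsub>B\<^esub> (\<pi> ` vanishing {z})"
      using f(1) unfolding square_ideal_def
    proof (induction rule: ideal_prod.induct)
      case (prod f g)
      then show ?case
        using ideal_prod.prod[of "\<pi> f" "\<pi> ` vanishing {z}" "\<pi> g" _ B] van
        by (simp add: \<pi>_mult)
    next
      case (sum f g)
      then show ?case
        using ideal_prod.sum[OF sum.IH] sq unfolding square_ideal_def by (simp add: \<pi>_add)
    qed
    then show "b \<in> (\<pi> ` vanishing {z}) \<cdot>\<^bsub>B\<^esub> (\<pi> ` vanishing {z})" using f by simp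
  next
    fix b assume "b \<in> (\<pi> ` vanishing {z}) \<cdot>\<^bsub>B\<^esub> (\<pi> ` vanishing {z})"
    then show "b \<in> \<pi> ` square_ideal z"
    proof (induction rule: ideal_prod.induct)
      case (prod a b)
      then obtain f g where "f \<in> vanishing {z}" "a = \<pi> f" "g \<in> vanishing {z}" "b = \<pi> g" by blast
      then show ?case using square_idealI[of f z g] van by (auto simp: \<pi>_mult)
    next
      case (sum a b)
      then obtain f g where fg: "f \<in> square_ideal z" "a = \<pi> f" "g \<in> square_ideal z" "b = \<pi> g" by blast
      then have "(\<lambda>x\<in>X. f x + g x) \<in> square_ideal z"
        by (intro regular_ideal_add[OF ideal_square_ideal[OF z]])
      then show ?case using fg sq by (simp add: \<pi>_add)
    qed
  }
qed

text \<open>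
  If there are too few generators, some tangent vector \<open>v\<close> of the hypersurface annihilates all
  of them, hence all of the maximal ideal, although it moves some coordinate.
\<close>
lemma cotangent_lower:
  assumes z: "z \<in> X" "F z = 0" and S: "finite S" "S \<subseteq> \<pi> ` vanishing {z}"
    and gen: "\<pi> ` vanishing {z} = genideal B S <+>\<^bsub>B\<^esub> (\<pi> ` vanishing {z} \<cdot>\<^bsub>B\<^esub> \<pi> ` vanishing {z})"
  shows "cotangent_rank z \<le> card S"
proof (rule ccontr)
  assume less: "\<not> cotangent_rank z \<le> card S"
  \<comment> \<open>Each element of \<open>T\<close> is one linear condition on \<open>v\<close>:
    \<open>Some s\<close> for a generator, \<open>None\<close> for tangency to the hypersurface,
    which is left out where the gradient is zero.\<close>
  define T where "T = Some ` S \<union> (if \<forall>i. dF i z = 0 then {} else {None})"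
  have "card T \<le> card S + (if \<forall>i. dF i z = 0 then 0 else 1)"
    unfolding T_def using card_Un_le[of "Some ` S" "{None}"] by (auto simp: card_image)
  with less have cardT: "card T < CARD('i)" "finite T"
    using S(1) by (auto simp: cotangent_rank_def T_def split: if_splits)
  have "\<forall>s\<in>S. \<exists>r c. r \<in> vanishing {z} \<and> s = \<pi> r \<and> (\<forall>v. dderiv z v r = (\<Sum>i\<in>UNIV. c i * v i))"
  proof
    fix s assume "s \<in> S"
    then obtain r where r: "r \<in> vanishing {z}" "s = \<pi> r" using S(2) by blast
    then have "r \<in> reg" by (simp add: vanishing_def)
    with taylor[OF this z(1)] dderiv_taylor[OF this z(1)] r
    show "\<exists>r c. r \<in> vanishing {z} \<and> s = \<pi> r \<and> (\<forall>v. dderiv z v r = (\<Sum>i\<in>UNIV. c i * v i))" by blast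
  qed
  then obtain r c where rc: "\<And>s. s \<in> S \<Longrightarrow> r s \<in> vanishing {z} \<and> s = \<pi> (r s)"
    "\<And>s v. s \<in> S \<Longrightarrow> dderiv z v (r s) = (\<Sum>i\<in>UNIV. c s i * v i)"
    unfolding bchoice_iff by auto
  define M where "M i t = (case t of Some s \<Rightarrow> c s i | None \<Rightarrow> dF i z)" for i t
  obtain v where v: "\<exists>i\<in>UNIV. v i \<noteq> 0" "\<forall>t\<in>T. (\<Sum>i\<in>UNIV. v i * M i t) = 0"
    using nontrivial_solution[OF cardT(2) finite_class.finite_UNIV cardT(1), of M] by blast
  have vS: "dderiv z v (r s) = 0" if "s \<in> S" for s
    using rc(2)[OF that, of v] v(2)[rule_format, of "Some s"] that
    by (simp add: T_def M_def mult.commute)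
  have vF: "dderiv z v F = 0"
  proof (cases "\<forall>i. dF i z = 0")
    case False
    then show ?thesis using v(2)[rule_format, of None] z(1)
      by (simp add: T_def M_def mult.commute dderiv_F)
  qed (simp add: dderiv_F z)
  \<comment> \<open>These functions vanish at \<open>z\<close> together with their derivative along
    \<open>v\<close>. They form an ideal by the product rule, and it contains \<open>F\<close>, so
    membership can be transported back from \<open>B\<close>.\<close>
  define N where "N = {f \<in> vanishing {z}. dderiv z v f = 0}"
  have N: "ideal N A"
  proof (rule idealI)
    show "ring A" by (rule cring.axioms(1)[OF cring_coordinate_ring])
    show "subgroup N (add_monoid A)"
    proof (rule subgroup.intro)
      show "inv\<^bsub>add_monoid A\<^esub> f \<in> N" if "f \<in> N" for f
        unfolding a_inv_def[symmetric]
        using that z coordinate_ring_a_inv[of f X G] dderiv_minus[of f z v]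
        by (auto simp: N_def vanishing_def intro: regular_intros)
    qed (use z in \<open>auto simp: N_def vanishing_def dderiv_add intro: regular_intros\<close>)
  qed (use z in \<open>auto simp: N_def vanishing_def dderiv_mult intro: regular_intros\<close>)
  have "S \<subseteq> \<pi> ` N" using rc(1) vS by (fastforce simp: N_def)
  then have "genideal B S \<subseteq> \<pi> ` N" by (rule hom.S.genideal_minimal[OF ideal_image[OF N]])
  moreover have "square_ideal z \<subseteq> N"
    using dderiv_square_ideal[OF _ z(1)] by (auto simp: N_def)
  then have "\<pi> ` vanishing {z} \<cdot>\<^bsub>B\<^esub> \<pi> ` vanishing {z} \<subseteq> \<pi> ` N"
    using image_square_ideal[OF z(1)] by blast
  ultimately have "genideal B S <+>\<^bsub>B\<^esub> (\<pi> ` vanishing {z} \<cdot>\<^bsub>B\<^esub> \<pi> ` vanishing {z}) \<subseteq> \<pi> ` N"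
    unfolding set_add_def'
    using additive_subgroup.a_closed[OF ideal.axioms(1)[OF ideal_image[OF N]]] by blast
  then have "\<pi> ` vanishing {z} \<subseteq> \<pi> ` N" by (rule ord_eq_le_trans[OF gen])
  then have sub: "vanishing {z} \<subseteq> N"
    using preimage_image[OF N] vF F_regular z by (auto simp: N_def vanishing_def)
  obtain k where k: "v k \<noteq> 0" using v(1) by blast
  have "shifted_coord z k \<in> N" using sub shifted_coord_vanishing[OF z(1)] by blast
  then show False using k dderiv_coord[OF z(1), of v k] by (simp add: N_def shifted_coord_def)
qed

text \<open>The shifted coordinates generate modulo squares. If some \<open>dF k z\<close> is
  non-zero, the linear part of \<open>F\<close>, which is zero in \<open>B\<close> up to squares,
  expresses the \<open>k\<close>-th of them through the others.\<close>

lemma cotangent_upper: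
  assumes z: "z \<in> X" "F z = 0"
  shows "\<exists>S. finite S \<and> S \<subseteq> \<pi> ` vanishing {z} \<and> card S \<le> cotangent_rank z \<and>
    \<pi> ` vanishing {z} = genideal B S <+>\<^bsub>B\<^esub> (\<pi> ` vanishing {z} \<cdot>\<^bsub>B\<^esub> \<pi> ` vanishing {z})"
proof -
  note sq = ideal_square_ideal[OF z(1)]
  have van: "f \<in> reg" if "f \<in> vanishing {z}" for f using that by (simp add: vanishing_def)
  \<comment> \<open>\<open>I\<close> indexes the coordinates that are kept: every linear form is a
    multiple of the differential of \<open>F\<close> plus a form in them.\<close>
  have "\<exists>I. card I \<le> cotangent_rank z \<and> (\<forall>c::'i \<Rightarrow> complex. \<exists>d a. \<forall>v.
      (\<Sum>i\<in>UNIV. c i * v i) = a * (\<Sum>i\<in>UNIV. dF i z * v i) + (\<Sum>i\<in>I. d i * v i))"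
  proof (cases "\<forall>i. dF i z = 0")
    case True
    then show ?thesis
      by (intro exI[of _ UNIV]) (auto simp: cotangent_rank_def)
  next
    case False
    then obtain k where k: "dF k z \<noteq> 0" by blast
    show ?thesis
    proof (intro exI conjI allI)
      show "card (UNIV - {k}) \<le> cotangent_rank z"
        using False by (simp add: cotangent_rank_def card_Diff_singleton)
      fix c v :: "'i \<Rightarrow> complex"
      have split: "(\<Sum>i\<in>UNIV. u i * v i) = u k * v k + (\<Sum>i\<in>UNIV - {k}. u i * v i)"
        for u :: "'i \<Rightarrow> complex" by (simp add: sum.remove)
      show "(\<Sum>i\<in>UNIV. c i * v i) = c k / dF k z * (\<Sum>i\<in>UNIV. dF i z * v i)
          + (\<Sum>i\<in>UNIV - {k}. (c i - c k / dF k z * dF i z) * v i)"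
        unfolding split using k
        by (simp add: algebra_simps sum_subtractf sum_distrib_left)
    qed
  qed
  then obtain I where I: "card I \<le> cotangent_rank z"
    "\<And>c::'i \<Rightarrow> complex. \<exists>d a. \<forall>v.
      (\<Sum>i\<in>UNIV. c i * v i) = a * (\<Sum>i\<in>UNIV. dF i z * v i) + (\<Sum>i\<in>I. d i * v i)"
    by blast
  define S where "S = (\<lambda>i. \<pi> (shifted_coord z i)) ` I"
  have SM: "S \<subseteq> \<pi> ` vanishing {z}" using shifted_coord_vanishing[OF z(1)] by (auto simp: S_def)
  have Scarr: "S \<subseteq> carrier B" using SM van \<pi>_closed by blast
  have genS: "ideal (genideal B S) B" by (rule hom.S.genideal_ideal[OF Scarr])
  have M: "ideal (\<pi> ` vanishing {z}) B" by (rule ideal_image[OF ideal_vanishing]) (use z in auto)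
  obtain cF where cF:
    "(\<lambda>x\<in>X. F x - F z - (\<Sum>i\<in>UNIV. cF i * (coord i x - coord i z))) \<in> square_ideal z"
    using taylor[OF F_regular z(1)] by blast
  have cF_eq: "(\<Sum>i\<in>UNIV. cF i * v i) = (\<Sum>i\<in>UNIV. dF i z * v i)" for v
    using dderiv_taylor[OF F_regular z(1) cF, of v] dderiv_F[OF z(1), of v] by simp
  show ?thesis
  proof (intro exI[of _ S] conjI)
    show "finite S" "S \<subseteq> \<pi> ` vanishing {z}" using SM by (auto simp: S_def)
    show "card S \<le> cotangent_rank z"
      using I(1) card_image_le[of I "\<lambda>i. \<pi> (shifted_coord z i)"] by (simp add: S_def)
    show "\<pi> ` vanishing {z} = genideal B S <+>\<^bsub>B\<^esub> (\<pi> ` vanishing {z} \<cdot>\<^bsub>B\<^esub> \<pi> ` vanishing {z})"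
    proof (rule equalityI)
      have "genideal B S \<subseteq> \<pi> ` vanishing {z}" by (rule hom.S.genideal_minimal[OF M SM])
      moreover have "\<pi> ` vanishing {z} \<cdot>\<^bsub>B\<^esub> \<pi> ` vanishing {z} \<subseteq> \<pi> ` vanishing {z}"
        using hom.S.ideal_prod_inter[OF M M] by blast
      ultimately show "genideal B S <+>\<^bsub>B\<^esub> (\<pi> ` vanishing {z} \<cdot>\<^bsub>B\<^esub> \<pi> ` vanishing {z}) \<subseteq> \<pi> ` vanishing {z}"
        unfolding set_add_def'
        using additive_subgroup.a_closed[OF ideal.axioms(1)[OF M]] by blast
    next
      show "\<pi> ` vanishing {z} \<subseteq> genideal B S <+>\<^bsub>B\<^esub> (\<pi> ` vanishing {z} \<cdot>\<^bsub>B\<^esub> \<pi> ` vanishing {z})"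
      proof
        fix b assume "b \<in> \<pi> ` vanishing {z}"
        then obtain f where f: "f \<in> vanishing {z}" "b = \<pi> f" by blast
        obtain c where c:
          "(\<lambda>x\<in>X. f x - f z - (\<Sum>i\<in>UNIV. c i * (coord i x - coord i z))) \<in> square_ideal z"
          using taylor[OF van[OF f(1)] z(1)] by blast
        obtain d a where da: "\<And>v. (\<Sum>i\<in>UNIV. c i * v i) =
            a * (\<Sum>i\<in>UNIV. cF i * v i) + (\<Sum>i\<in>I. d i * v i)"
          using I(2)[of c] cF_eq by auto
        define l where "l = (\<lambda>x\<in>X. \<Sum>i\<in>I. d i * shifted_coord z i x)"
        \<comment> \<open>Subtracting \<open>a\<close> times the remainder of \<open>F\<close> from
          the remainder of \<open>f\<close> leaves \<open>f = l + q + a F\<close>, and the last term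
          disappears in \<open>B\<close>.\<close>
        define q where "q = (\<lambda>x\<in>X. (f x - f z - (\<Sum>i\<in>UNIV. c i * (coord i x - coord i z)))
          - a * (F x - F z - (\<Sum>i\<in>UNIV. cF i * (coord i x - coord i z))))"
        have q: "q \<in> square_ideal z" unfolding q_def
          by (intro regular_ideal_closed(5)[OF sq c] regular_ideal_closed(4)[OF sq _ cF] regular_intros)
        have qreg: "q \<in> reg" using regular_ideal_closed(2)[OF sq q] .
        have pre: "ideal {h \<in> carrier A. \<pi> h \<in> genideal B S} A"
          by (rule hom.ideal_vimage[OF genS])
        have l: "l \<in> {h \<in> carrier A. \<pi> h \<in> genideal B S}" unfolding l_def
        proof (rule regular_ideal_sum[OF pre])
          fix i assume i: "i \<in> I"
          have sc: "shifted_coord z i \<in> reg" using van[OF shifted_coord_vanishing[OF z(1)]] .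
          have "\<pi> (shifted_coord z i) \<in> genideal B S"
            using hom.S.genideal_self[OF Scarr] i by (auto simp: S_def)
          then have "restrict (shifted_coord z i) X \<in> {h \<in> carrier A. \<pi> h \<in> genideal B S}"
            using sc by simp
          then show "(\<lambda>x\<in>X. d i * shifted_coord z i x) \<in> {h \<in> carrier A. \<pi> h \<in> genideal B S}"
            by (rule regular_ideal_closed(4)[OF pre regular_functions.const])
        qed
        have "\<pi> f = \<pi> (\<lambda>x\<in>X. l x + q x)"
        proof (subst \<pi>_eq_iff)
          show "f \<in> reg" using van f by blast
          show "(\<lambda>x\<in>X. l x + q x) \<in> reg" using l qreg by (auto intro: regular_intros)
          show "\<exists>h\<in>reg. \<forall>x\<in>X. f x - (\<lambda>x\<in>X. l x + q x) x = h x * F x"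
          proof (intro bexI[of _ "\<lambda>x\<in>X. a"] ballI)
            fix x assume x: "x \<in> X"
            have "f z = 0" using f by (simp add: vanishing_def)
            then show "f x - (\<lambda>x\<in>X. l x + q x) x = (\<lambda>x\<in>X. a) x * F x"
              using da[of "\<lambda>i. coord i x - coord i z"] x z
              by (simp add: l_def q_def shifted_coord_def algebra_simps)
          qed (rule regular_functions.const)
        qed
        then have "b = \<pi> l \<oplus>\<^bsub>B\<^esub> \<pi> q" using f(2) l qreg by (simp add: \<pi>_add)
        moreover have "\<pi> q \<in> \<pi> ` vanishing {z} \<cdot>\<^bsub>B\<^esub> \<pi> ` vanishing {z}"
          using q image_square_ideal[OF z(1)] by blast
        ultimately show "b \<in> genideal B S <+>\<^bsub>B\<^esub> (\<pi> ` vanishing {z} \<cdot>\<^bsub>B\<^esub> \<pi> ` vanishing {z})"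
          using l by (auto simp: set_add_def')
      qed
    qed
  qed
qed

lemma cotangent_dim_eval_at:
  assumes "z \<in> X" "F z = 0"
  shows "cotangent_dim B (max_ideal B (eval_at z)) = enat (cotangent_rank z)"
  unfolding max_ideal_eval_at[OF assms]
proof (rule antisym)
  obtain S where S: "finite S" "S \<subseteq> \<pi> ` vanishing {z}" "card S \<le> cotangent_rank z"
    "\<pi> ` vanishing {z} = genideal B S <+>\<^bsub>B\<^esub> (\<pi> ` vanishing {z} \<cdot>\<^bsub>B\<^esub> \<pi> ` vanishing {z})"
    using cotangent_upper[OF assms] by blast
  have "cotangent_dim B (\<pi> ` vanishing {z}) \<le> enat (card S)"
    unfolding cotangent_dim_def by (rule Inf_lower) (use S in blast)
  also have "\<dots> \<le> enat (cotangent_rank z)" using S(3) by simp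
  finally show "cotangent_dim B (\<pi> ` vanishing {z}) \<le> enat (cotangent_rank z)" .
  show "enat (cotangent_rank z) \<le> cotangent_dim B (\<pi> ` vanishing {z})"
    unfolding cotangent_dim_def
    by (rule Inf_greatest) (auto intro: cotangent_lower[OF assms])
qed

subsection \<open>Heights\<close>

text \<open>The preimages in \<open>A\<close> of a chain in \<open>B\<close> form a chain of prime
  ideals that all contain \<open>F\<close>, so the bound for such chains applies.\<close>

lemma height_upper: "height B P \<le> enat (CARD('i) - 1)"
  unfolding height_def
proof (rule Sup_least, clarify)
  fix n and C :: "nat \<Rightarrow> 'b set"
  assume C: "\<forall>i\<le>n. primeideal (C i) B" "\<forall>i<n. C i \<subset> C (Suc i)"
  have "n < CARD('i)"
  proof (rule prime_chain_length[of n "\<lambda>i. {f \<in> carrier A. \<pi> f \<in> C i}" F])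
    show "primeideal {f \<in> carrier A. \<pi> f \<in> C i} A" if "i \<le> n" for i
      using hom.primeideal_vimage[OF cring_coordinate_ring] C(1) that by blast
    show "{f \<in> carrier A. \<pi> f \<in> C i} \<subset> {f \<in> carrier A. \<pi> f \<in> C (Suc i)}" if "i < n" for i
    proof -
      have "C i \<subset> C (Suc i)" using C(2) that by blast
      moreover have "C (Suc i) \<subseteq> carrier B"
        using C(1) that by (meson Suc_leI ideal.Icarr primeideal.axioms(1) subsetI)
      ultimately obtain b where "b \<in> C (Suc i)" "b \<notin> C i" "b \<in> \<pi> ` reg" using surj by blast
      then show ?thesis using \<open>C i \<subset> C (Suc i)\<close> by auto
    qed
    have "ideal (C 0) B" using C(1) by (simp add: primeideal_def)
    then have "\<zero>\<^bsub>B\<^esub> \<in> C 0" by (simp add: additive_subgroup.zero_closed ideal.axioms(1))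
    then show "F \<in> {f \<in> carrier A. \<pi> f \<in> C 0}" using F_regular \<pi>_F by simp
  qed (rule nonzerodivisor)
  then show "enat n \<le> enat (CARD('i) - 1)" by simp
qed

text \<open>Only the vanishing ideals have to be strictly nested, not the sets \<open>Z i\<close>;
  thus no closures are taken, and an open part may be followed by a curve in its boundary.\<close>

lemma height_lower:
  assumes z: "z \<in> X" "F z = 0"
    and Z: "\<And>i. i \<le> k \<Longrightarrow> Z i \<subseteq> {x \<in> X. F x = 0}" "\<And>i. i \<le> k \<Longrightarrow> Z i \<noteq> {}"
      "\<And>i. i \<le> k \<Longrightarrow> curve_connected (Z i)"
    and strict: "\<And>i. i < k \<Longrightarrow> vanishing (Z i) \<subset> vanishing (Z (Suc i))" and "Z k = {z}"
  shows "enat k \<le> height B (max_ideal B (eval_at z))"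
  unfolding height_def
proof (rule Sup_upper, intro CollectI exI conjI allI impI)
  have FZ: "F \<in> vanishing (Z i)" if "i \<le> k" for i
    using F_regular Z(1)[OF that] by (auto simp: vanishing_def)
  have prime: "primeideal (vanishing (Z i)) A" if "i \<le> k" for i
    using Z[OF that] by (intro primeideal_vanishing) auto
  show "primeideal (\<pi> ` vanishing (Z i)) B" if "i \<le> k" for i
    by (rule primeideal_image[OF prime FZ]) (rule that)+
  show "\<pi> ` vanishing (Z i) \<subset> \<pi> ` vanishing (Z (Suc i))" if i: "i < k" for i
  proof -
    obtain f where f: "f \<in> vanishing (Z (Suc i))" "f \<notin> vanishing (Z i)" using strict[OF i] by blast
    have "\<pi> f \<notin> \<pi> ` vanishing (Z i)"
      using preimage_image[of "vanishing (Z i)" f] f prime[of i] FZ[of i] i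
      by (auto simp: primeideal_def vanishing_def)
    then show ?thesis using strict[OF i] f by blast
  qed
  show "\<pi> ` vanishing (Z k) = max_ideal B (eval_at z)"
    using assms(7) max_ideal_eval_at[OF z] by simp
qed simp

text \<open>At a critical zero of \<open>F\<close> the cotangent dimension \<open>n\<close> exceeds
  every possible height, which is at most \<open>n - 1\<close>; at the other zeros both equal
  \<open>n - 1\<close>, given the lower bound on heights assumed here.\<close>

lemma singular_points_eq:
  assumes "\<And>z i. \<lbrakk>z \<in> X; F z = 0; dF i z \<noteq> 0\<rbrakk>
    \<Longrightarrow> enat (CARD('i) - 1) \<le> height B (max_ideal B (eval_at z))"
  shows "singular_points B scalar = eval_at ` {z \<in> X. F z = 0 \<and> (\<forall>i. dF i z = 0)}"
proof -
  have "regular_at B (max_ideal B (eval_at z)) \<longleftrightarrow> \<not> (\<forall>i. dF i z = 0)" if z: "z \<in> X" "F z = 0" for z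
  proof (cases "\<forall>i. dF i z = 0")
    case True
    have "CARD('i) - 1 < CARD('i)" by (simp add: card_gt_0_iff)
    then have "height B (max_ideal B (eval_at z)) \<noteq> enat CARD('i)"
      using height_upper[of "max_ideal B (eval_at z)"] by (metis enat_ord_simps(1) not_less)
    then show ?thesis
      unfolding regular_at_def cotangent_dim_eval_at[OF z] using True by (auto simp: cotangent_rank_def)
  next
    case False
    then have "height B (max_ideal B (eval_at z)) = enat (CARD('i) - 1)"
      using assms[OF z] height_upper[of "max_ideal B (eval_at z)"] by (blast intro: antisym)
    then show ?thesis
      unfolding regular_at_def cotangent_dim_eval_at[OF z] using False by (auto simp: cotangent_rank_def)
  qed
  then show ?thesis
    unfolding singular_points_def by (auto simp: eval_at_points elim!: points_eval_at)
qed

end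

section \<open>Division by a monic quadratic\<close>

lemma finite_quadratic_roots:
  fixes a b c :: complex
  assumes "a \<noteq> 0 \<or> b \<noteq> 0 \<or> c \<noteq> 0"
  shows "finite {t. a * t\<^sup>2 + b * t + c = 0}"
proof -
  have "finite {t. poly [:c, b, a:] t = 0}" by (rule poly_roots_finite) (use assms in auto)
  then show ?thesis by (simp add: algebra_simps power2_eq_square)
qed

lemma quadratic_two_roots:
  fixes b c :: complex
  assumes "b\<^sup>2 - 4 * c \<noteq> 0"
  obtains r s where "r \<noteq> s" "r\<^sup>2 + b * r + c = 0" "s\<^sup>2 + b * s + c = 0"
proof
  define d where "d = csqrt (b\<^sup>2 - 4 * c)"
  have d: "d\<^sup>2 = b\<^sup>2 - 4 * c" "d \<noteq> 0" using assms by (auto simp: d_def)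
  show "(- b + d) / 2 \<noteq> (- b - d) / 2" using d(2) by (simp add: field_simps)
  have "((- b + d) / 2)\<^sup>2 + b * ((- b + d) / 2) + c = (d\<^sup>2 - b\<^sup>2 + 4 * c) / 4"
    by (simp add: field_simps power2_eq_square)
  then show "((- b + d) / 2)\<^sup>2 + b * ((- b + d) / 2) + c = 0" using d by simp
  have "((- b - d) / 2)\<^sup>2 + b * ((- b - d) / 2) + c = (d\<^sup>2 - b\<^sup>2 + 4 * c) / 4"
    by (simp add: field_simps power2_eq_square)
  then show "((- b - d) / 2)\<^sup>2 + b * ((- b - d) / 2) + c = 0" using d by simp
qed

context laurent_space
begin

definition set_coord :: "'i \<Rightarrow> complex \<Rightarrow> 'a \<Rightarrow> 'a" where
  "set_coord k t x = pt ((\<lambda>i. coord i x)(k := t))"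

lemma coord_set_coord [simp]: "coord i (set_coord k t x) = (if i = k then t else coord i x)"
  by (simp add: set_coord_def)

lemma set_coord_mem [simp]: "k \<notin> J \<Longrightarrow> set_coord k t x \<in> X \<longleftrightarrow> x \<in> X"
  by (auto simp: X_eq)

text \<open>The points with \<open>k\<close>-th coordinate \<open>coord k z + 1 / (n + 1)\<close>
  converge to \<open>z\<close> and eventually avoid the finite exceptional set, so continuity gives
  the value at \<open>z\<close>.\<close>

lemma regular_zero_from_nearby:
  assumes "g \<in> reg" "z \<in> X" "k \<notin> J" "finite S" "\<And>t. t \<notin> S \<Longrightarrow> g (set_coord k t z) = 0"
  shows "g z = 0"
proof -
  define u where "u n = coord k z + 1 / of_nat (Suc n)" for n
  have "inj u" by (auto simp: inj_def u_def)
  then have "finite (u -` S)" by (rule finite_vimageI[OF assms(4)])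
  then obtain m where m: "\<forall>n\<in>u -` S. n < m" by (auto simp: finite_nat_set_iff_bounded)
  have "\<forall>\<^sub>F n in sequentially. n \<notin> u -` S"
    unfolding eventually_sequentially using m by (meson not_less)
  then have "\<forall>\<^sub>F n in sequentially. g (set_coord k (u n) z) = 0"
    by (rule eventually_mono) (use assms(5) in auto)
  then have "(\<lambda>n. g (set_coord k (u n) z)) \<longlonglongrightarrow> 0" by (rule tendsto_eventually)
  moreover have "(\<lambda>n. g (set_coord k (u n) z)) \<longlonglongrightarrow> g z"
  proof (rule tendsto_regular[OF assms(1,2)])
    have "(\<lambda>n. 1 / of_nat (Suc n) :: complex) \<longlonglongrightarrow> 0"
      using LIMSEQ_Suc[OF lim_inverse_n] by (simp add: inverse_eq_divide)
    then have "u \<longlonglongrightarrow> coord k z + 0" unfolding u_def by (intro tendsto_intros)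
    then show "(\<lambda>n. coord i (set_coord k (u n) z)) \<longlonglongrightarrow> coord i z" for i
      by (cases "i = k") auto
  qed (use assms(2,3) in simp)
  ultimately show ?thesis using LIMSEQ_unique by blast
qed

definition independent_of :: "'i \<Rightarrow> ('a \<Rightarrow> complex) \<Rightarrow> bool" where
  "independent_of k g \<longleftrightarrow> (\<forall>x\<in>X. \<forall>t. g (set_coord k t x) = g x)"

lemma independent_of_combine:
  assumes "k \<notin> J" "independent_of k f" "independent_of k g"
  shows "independent_of k (\<lambda>x\<in>X. f x + g x)" "independent_of k (\<lambda>x\<in>X. f x * g x)"
    "independent_of k (\<lambda>x\<in>X. f x - g x)"
  using assms by (auto simp: independent_of_def)

text \<open>Division with remainder by a polynomial monic of degree 2 in the coordinate
  \<open>k\<close>. As \<open>k \<notin> J\<close>, every generator other than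
  \<open>coord k\<close> is independent of it, and only products can raise the degree.\<close>

lemma quadratic_division:
  assumes k: "k \<notin> J" and b: "b \<in> reg" "independent_of k b" and c: "c \<in> reg" "independent_of k c"
    and F: "\<And>x. x \<in> X \<Longrightarrow> F x = (coord k x)\<^sup>2 + b x * coord k x + c x"
    and f: "f \<in> reg"
  shows "\<exists>g0 g1 q. g0 \<in> reg \<and> g1 \<in> reg \<and> q \<in> reg \<and> independent_of k g0 \<and> independent_of k g1 \<and>
    (\<forall>x\<in>X. f x = g0 x + g1 x * coord k x + q x * F x)"
  using f
proof (induction rule: regular_induct)
  have const_indep: "(\<lambda>x\<in>X. a) \<in> reg" "independent_of k (\<lambda>x\<in>X. a)" for a
    using k by (auto simp: independent_of_def regular_functions.const)
  {
    case (const a)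
    show ?case
      by (rule exI[of _ "\<lambda>x\<in>X. a"], rule exI[of _ "\<lambda>x\<in>X. 0"], rule exI[of _ "\<lambda>x\<in>X. 0"])
        (simp add: const_indep)
  next
    case (coord i)
    show ?case
    proof (cases "i = k")
      case True
      then show ?thesis
        by (intro exI[of _ "\<lambda>x\<in>X. 0"] exI[of _ "\<lambda>x\<in>X. 1"]) (simp add: const_indep)
    next
      case False
      then have "independent_of k (\<lambda>x\<in>X. coord i x)" using k by (auto simp: independent_of_def)
      then show ?thesis
        by (intro exI[of _ "\<lambda>x\<in>X. coord i x"] exI[of _ "\<lambda>x\<in>X. 0"])
          (simp add: const_indep coord_regular)
    qed
  next
    case (inverse j)
    then have "independent_of k (\<lambda>x\<in>X. 1 / coord j x)" using k by (auto simp: independent_of_def)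
    then show ?case
      by (intro exI[of _ "\<lambda>x\<in>X. 1 / coord j x"] exI[of _ "\<lambda>x\<in>X. 0"])
        (simp add: const_indep inverse_coord_regular inverse)
  next
    case (add f h)
    then obtain f0 f1 p h0 h1 q where
      f: "f0 \<in> reg" "f1 \<in> reg" "p \<in> reg" "independent_of k f0" "independent_of k f1"
        "\<And>x. x \<in> X \<Longrightarrow> f x = f0 x + f1 x * coord k x + p x * F x" and
      h: "h0 \<in> reg" "h1 \<in> reg" "q \<in> reg" "independent_of k h0" "independent_of k h1"
        "\<And>x. x \<in> X \<Longrightarrow> h x = h0 x + h1 x * coord k x + q x * F x" by blast
    show ?case
    proof (intro exI conjI ballI)
      show "(\<lambda>x\<in>X. f0 x + h0 x) \<in> reg" "(\<lambda>x\<in>X. f1 x + h1 x) \<in> reg" "(\<lambda>x\<in>X. p x + q x) \<in> reg"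
        by (intro regular_intros f h)+
      show "independent_of k (\<lambda>x\<in>X. f0 x + h0 x)" "independent_of k (\<lambda>x\<in>X. f1 x + h1 x)"
        by (intro independent_of_combine k f h)+
      fix x assume "x \<in> X"
      then show "(\<lambda>x\<in>X. f x + h x) x = (\<lambda>x\<in>X. f0 x + h0 x) x
          + (\<lambda>x\<in>X. f1 x + h1 x) x * coord k x + (\<lambda>x\<in>X. p x + q x) x * F x"
        using f(6) h(6) by (simp add: algebra_simps)
    qed
  next
    case (mult f h)
    then obtain f0 f1 p h0 h1 q where
      f: "f0 \<in> reg" "f1 \<in> reg" "p \<in> reg" "independent_of k f0" "independent_of k f1"
        "\<And>x. x \<in> X \<Longrightarrow> f x = f0 x + f1 x * coord k x + p x * F x" and
      h: "h0 \<in> reg" "h1 \<in> reg" "q \<in> reg" "independent_of k h0" "independent_of k h1"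
        "\<And>x. x \<in> X \<Longrightarrow> h x = h0 x + h1 x * coord k x + q x * F x" by blast
    \<comment> \<open>\<open>u\<close> is the coefficient of the square in the product of the two
      remainders; replacing the square through \<open>F\<close> lowers the degree at the cost of the
      corrections \<open>bu\<close> and \<open>cu\<close>.\<close>
    define u where "u = (\<lambda>x\<in>X. f1 x * h1 x)"
    have u: "u \<in> reg" "independent_of k u"
      unfolding u_def by (intro regular_intros f h independent_of_combine k)+
    define cu where "cu = (\<lambda>x\<in>X. c x * u x)"
    define bu where "bu = (\<lambda>x\<in>X. b x * u x)"
    have cu: "cu \<in> reg" "independent_of k cu" "bu \<in> reg" "independent_of k bu"
      unfolding cu_def bu_def by (intro regular_intros u b c independent_of_combine k)+
    define fh where "fh = (\<lambda>x\<in>X. f0 x * h0 x)"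
    define l where "l = (\<lambda>x\<in>X. f0 x * h1 x)"
    define l' where "l' = (\<lambda>x\<in>X. f1 x * h0 x)"
    define ll where "ll = (\<lambda>x\<in>X. l x + l' x)"
    have fh: "fh \<in> reg" "independent_of k fh" "l \<in> reg" "independent_of k l"
      "l' \<in> reg" "independent_of k l'"
      unfolding fh_def l_def l'_def by (intro regular_intros f h independent_of_combine k)+
    have ll: "ll \<in> reg" "independent_of k ll"
      unfolding ll_def by (intro regular_intros fh independent_of_combine k)+
    show ?case
    proof (intro exI conjI ballI)
      show "(\<lambda>x\<in>X. fh x - cu x) \<in> reg" by (intro regular_diff regular_self fh cu)
      show "(\<lambda>x\<in>X. ll x - bu x) \<in> reg" by (intro regular_diff regular_self ll cu)
      show "(\<lambda>x\<in>X. u x + (f0 x + f1 x * coord k x) * q x + p x * h x) \<in> reg"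
        by (intro regular_add regular_mult coord_regular regular_self u f(1,2,3) h(3) mult(2))
      show "independent_of k (\<lambda>x\<in>X. fh x - cu x)" "independent_of k (\<lambda>x\<in>X. ll x - bu x)"
        by (intro independent_of_combine k ll fh cu)+
      fix x assume x: "x \<in> X"
      have sqF: "(coord k x)\<^sup>2 = F x - b x * coord k x - c x" using F[OF x] by simp
      have sq: "u x * (coord k x)\<^sup>2 = u x * F x - bu x * coord k x - cu x"
        unfolding sqF using x by (simp add: bu_def cu_def algebra_simps)
      have "f x * h x = (f0 x + f1 x * coord k x) * h x + p x * h x * F x"
        using f(6)[OF x] by (simp add: algebra_simps)
      also have "(f0 x + f1 x * coord k x) * h x
          = (f0 x + f1 x * coord k x) * (h0 x + h1 x * coord k x)
            + (f0 x + f1 x * coord k x) * q x * F x"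
        using h(6)[OF x] by (simp add: algebra_simps)
      also have "(f0 x + f1 x * coord k x) * (h0 x + h1 x * coord k x)
          = fh x + ll x * coord k x + u x * (coord k x)\<^sup>2"
        using x by (simp add: fh_def ll_def l_def l'_def u_def algebra_simps power2_eq_square)
      finally show "(\<lambda>x\<in>X. f x * h x) x = (\<lambda>x\<in>X. fh x - cu x) x
          + (\<lambda>x\<in>X. ll x - bu x) x * coord k x
          + (\<lambda>x\<in>X. u x + (f0 x + f1 x * coord k x) * q x + p x * h x) x * F x"
        using x unfolding sq by (simp add: algebra_simps)
    qed
  }
qed

end

section \<open>The family of cubic surfaces\<close>

text \<open>Of the five indices the two Boolean ones stand for the inverted parameters \<alpha>
  (\<open>False\<close>) and \<beta> (\<open>True\<close>), the others for the coordinates of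
  three-space.\<close>

fun family_coord :: "bool + 3 \<Rightarrow> (complex \<times> complex) \<times> (complex^3) \<Rightarrow> complex" where
  "family_coord (Inl False) (t, x) = fst t"
| "family_coord (Inl True) (t, x) = snd t"
| "family_coord (Inr i) (t, x) = x $ i"

definition family_point :: "(bool + 3 \<Rightarrow> complex) \<Rightarrow> (complex \<times> complex) \<times> (complex^3)" where
  "family_point u = ((u (Inl False), u (Inl True)), \<chi> i. u (Inr i))"

definition family_generators :: "((complex \<times> complex) \<times> (complex^3) \<Rightarrow> complex) set" where
  "family_generators =
     {\<lambda>(t, x). fst t, \<lambda>(t, x). snd t, \<lambda>(t, x). 1 / fst t, \<lambda>(t, x). 1 / snd t} \<union>
      {\<lambda>(t, x). x $ i | i. True}"

interpretation family: laurent_space family_coord family_point "range Inl" family_ambient family_generators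
proof
  show "family_coord i (family_point u) = u i" for i u
    by (cases "(i, family_point u)" rule: family_coord.cases) (auto simp: family_point_def)
  show "family_point (\<lambda>i. family_coord i x) = x" for x
    by (cases x) (simp add: family_point_def vec_eq_iff)
  show "family_ambient = {x. \<forall>j\<in>range Inl. family_coord j x \<noteq> 0}"
    by (auto simp: family_ambient_def param_space_def UNIV_bool)
  have "range family_coord = {family_coord (Inl False), family_coord (Inl True)} \<union> range (\<lambda>i. family_coord (Inr i))"
    by (auto simp: UNIV_sum UNIV_bool)
  moreover have "family_coord (Inl False) = (\<lambda>(t, x). fst t)" "family_coord (Inl True) = (\<lambda>(t, x). snd t)"
    "\<And>i. family_coord (Inr i) = (\<lambda>(t, x). x $ i)"
    by auto
  moreover have "(\<lambda>j x. 1 / family_coord j x) ` range Inl = {\<lambda>(t, x). 1 / fst t, \<lambda>(t, x). 1 / snd t}"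
    by (auto simp: UNIV_bool fun_eq_iff)
  ultimately show "family_generators = range family_coord \<union> (\<lambda>j x. 1 / family_coord j x) ` range Inl"
    unfolding family_generators_def by auto
qed

lemma family_ambient_ring_eq: "family_ambient_ring = family.A"
  by (simp add: family_ambient_ring_def family_generators_def)

definition affine_generators :: "(complex^3 \<Rightarrow> complex) set" where
  "affine_generators = {\<lambda>z. z $ i | i. True}"

interpretation affine: laurent_space "\<lambda>i (z::complex^3). z $ i" "\<lambda>u. \<chi> i. u i" "{}" UNIV affine_generators
  by unfold_locales (auto simp: affine_generators_def)

lemma affine_3_space_eq: "affine_3_space = affine.A"
  by (simp add: affine_3_space_def affine_generators_def)

definition fibre_cubic :: "complex \<Rightarrow> complex \<Rightarrow> complex^3 \<Rightarrow> complex" where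
  "fibre_cubic a b x = x$1 * x$2 * x$3 + (x$1)\<^sup>2 + (x$2)\<^sup>2 + (1 + a * b) * x$1 + (a + b) * x$2 + a * b"

lemma cubic_eq: "cubic ((a, b), x) = fibre_cubic a b x"
  by (simp add: cubic_def fibre_cubic_def)

definition fibre_gradient :: "complex \<Rightarrow> complex \<Rightarrow> 3 \<Rightarrow> complex^3 \<Rightarrow> complex" where
  "fibre_gradient a b i x = (if i = 1 then x$2 * x$3 + 2 * x$1 + 1 + a * b
     else if i = 2 then x$1 * x$3 + 2 * x$2 + a + b else x$1 * x$2)"

fun family_gradient :: "bool + 3 \<Rightarrow> (complex \<times> complex) \<times> (complex^3) \<Rightarrow> complex" where
  "family_gradient (Inl False) ((a, b), x) = b * x$1 + x$2 + b"
| "family_gradient (Inl True) ((a, b), x) = a * x$1 + x$2 + a"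
| "family_gradient (Inr i) ((a, b), x) = fibre_gradient a b i x"

lemma fibre_cubic_derivative:
  "((\<lambda>t. fibre_cubic a b (\<chi> i. x $ i + t * v i)) has_field_derivative (\<Sum>i\<in>UNIV. fibre_gradient a b i x * v i)) (at 0)"
  unfolding fibre_cubic_def fibre_gradient_def
  by (auto intro!: derivative_eq_intros simp: sum_3 algebra_simps)

lemma sum_family: "(\<Sum>i\<in>UNIV. f i) = f (Inl False) + f (Inl True) + f (Inr 1) + f (Inr 2) + f (Inr 3)"
  for f :: "bool + 3 \<Rightarrow> complex"
proof -
  have "UNIV = {Inl False, Inl True, Inr 1, Inr 2, Inr (3::3)}"
    by (auto simp: UNIV_sum UNIV_bool UNIV_3)
  then have "sum f UNIV = sum f {Inl False, Inl True, Inr 1, Inr 2, Inr (3::3)}" by (rule arg_cong)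
  also have "\<dots> = f (Inl False) + f (Inl True) + f (Inr 1) + f (Inr 2) + f (Inr 3)"
    by (simp add: add.assoc)
  finally show ?thesis .
qed

lemma cubic_derivative:
  assumes "z \<in> family_ambient"
  shows "((\<lambda>t. restrict cubic family_ambient (family_point (\<lambda>i. family_coord i z + t * v i)))
    has_field_derivative (\<Sum>i\<in>UNIV. family_gradient i z * v i)) (at 0)"
proof -
  obtain a b x where z: "z = ((a, b), x)" by (metis prod.exhaust)
  have "\<forall>\<^sub>F t in nhds 0. family_point (\<lambda>i. family_coord i z + t * v i) \<in> family_ambient"
    using family.eventually_line[OF assms] by (simp add: family.line_def)
  then have *: "\<forall>\<^sub>F t in nhds 0. restrict cubic family_ambient (family_point (\<lambda>i. family_coord i z + t * v i))
      = fibre_cubic (a + t * v (Inl False)) (b + t * v (Inl True)) (\<chi> i. x $ i + t * v (Inr i))"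
    by (rule eventually_mono) (simp add: z family_point_def cubic_eq)
  have "((\<lambda>t. fibre_cubic (a + t * v (Inl False)) (b + t * v (Inl True)) (\<chi> i. x $ i + t * v (Inr i)))
    has_field_derivative (\<Sum>i\<in>UNIV. family_gradient i z * v i)) (at 0)"
    unfolding fibre_cubic_def sum_family z
    by (auto intro!: derivative_eq_intros simp: fibre_gradient_def algebra_simps)
  then show ?thesis
    by (simp only: DERIV_cong_ev[OF refl * refl])
qed

lemma family_coord_eq:
  "family_coord (Inl False) x = fst (fst x)" "family_coord (Inl True) x = snd (fst x)"
  "family_coord (Inr i) x = snd x $ i"
  by (cases x; simp)+

lemma regular_coords:
  "(\<lambda>x\<in>family_ambient. fst (fst x)) \<in> family.reg"
  "(\<lambda>x\<in>family_ambient. snd (fst x)) \<in> family.reg"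
  "(\<lambda>x\<in>family_ambient. 1 / fst (fst x)) \<in> family.reg"
  "(\<lambda>x\<in>family_ambient. 1 / snd (fst x)) \<in> family.reg"
  "(\<lambda>x\<in>family_ambient. snd x $ i) \<in> family.reg"
  using family.coord_regular[of "Inl False"] family.coord_regular[of "Inl True"]
    family.inverse_coord_regular[OF rangeI, of False] family.inverse_coord_regular[OF rangeI, of True]
    family.coord_regular[of "Inr i"]
  by (simp_all add: family_coord_eq cong: restrict_cong)

lemma cubic_regular: "restrict cubic family_ambient \<in> family.reg"
  unfolding cubic_def case_prod_beta' by (rule regular_coords regular_intros)+

lemma fibre_cubic_regular: "fibre_cubic a b \<in> affine.reg"
proof -
  have "(\<lambda>x\<in>UNIV. fibre_cubic a b x) \<in> affine.reg"
    unfolding fibre_cubic_def by (rule affine.coord_regular regular_intros)+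
  then show ?thesis by (simp add: restrict_def)
qed

text \<open>On each line in the direction of \<open>x\<^sub>1\<close> the cubic is a monic quadratic
  with at most two zeros. Off them \<open>g\<close> vanishes, hence everywhere by
  continuity.\<close>

lemma cubic_nonzerodivisor:
  assumes "g \<in> family.reg" "\<And>x. x \<in> family_ambient \<Longrightarrow> restrict cubic family_ambient x * g x = 0"
  shows "g = (\<lambda>x\<in>family_ambient. 0)"
proof (rule regular_eqI[OF assms(1) regular_functions.const])
  fix z assume z: "z \<in> family_ambient"
  obtain a b x where zeq: "z = ((a, b), x)" by (metis prod.exhaust)
  have "g z = 0"
  proof (rule family.regular_zero_from_nearby[OF assms(1) z, of "Inr 1"])
    show "finite {t. 1 * t\<^sup>2 + (x$2 * x$3 + 1 + a * b) * t + ((x$2)\<^sup>2 + (a + b) * x$2 + a * b) = 0}"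
      by (rule finite_quadratic_roots) simp
    fix t assume t: "t \<notin> {t. 1 * t\<^sup>2 + (x$2 * x$3 + 1 + a * b) * t + ((x$2)\<^sup>2 + (a + b) * x$2 + a * b) = 0}"
    define w where "w = family.set_coord (Inr 1) t z"
    have w: "w \<in> family_ambient" using z family.set_coord_mem[of "Inr 1" t z] by (simp add: w_def image_iff)
    have "w = ((a, b), \<chi> i. if i = 1 then t else x $ i)"
      by (simp add: w_def family.set_coord_def family_point_def zeq family_coord_eq vec_eq_iff)
    then have "cubic w = 1 * t\<^sup>2 + (x$2 * x$3 + 1 + a * b) * t + ((x$2)\<^sup>2 + (a + b) * x$2 + a * b)"
      by (simp add: cubic_eq fibre_cubic_def algebra_simps)
    then show "g (family.set_coord (Inr 1) t z) = 0"
      using assms(2)[OF w] w t by (auto simp: w_def)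
  qed auto
  then show "g z = (\<lambda>x\<in>family_ambient. 0) z" using z by simp
qed

lemma fibre_cubic_nonzerodivisor:
  assumes "g \<in> affine.reg" "\<And>x. fibre_cubic a b x * g x = 0"
  shows "g = (\<lambda>x\<in>UNIV. 0)"
proof (rule regular_eqI[OF assms(1) regular_functions.const])
  fix x :: "complex^3"
  have "g x = 0"
  proof (rule affine.regular_zero_from_nearby[OF assms(1) UNIV_I, of 1])
    show "finite {t. 1 * t\<^sup>2 + (x$2 * x$3 + 1 + a * b) * t + ((x$2)\<^sup>2 + (a + b) * x$2 + a * b) = 0}"
      by (rule finite_quadratic_roots) simp
    fix t assume t: "t \<notin> {t. 1 * t\<^sup>2 + (x$2 * x$3 + 1 + a * b) * t + ((x$2)\<^sup>2 + (a + b) * x$2 + a * b) = 0}"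
    have "fibre_cubic a b (affine.set_coord 1 t x)
        = 1 * t\<^sup>2 + (x$2 * x$3 + 1 + a * b) * t + ((x$2)\<^sup>2 + (a + b) * x$2 + a * b)"
      by (simp add: affine.set_coord_def fibre_cubic_def algebra_simps)
    then show "g (affine.set_coord 1 t x) = 0" using assms(2)[of "affine.set_coord 1 t x"] t by auto
  qed auto
  then show "g x = (\<lambda>x\<in>UNIV. 0) x" by simp
qed

text \<open>
  The remainder of the division by the cubic, which is monic in \<open>x\<^sub>1\<close>, is linear in \<open>x\<^sub>1\<close>; it
  vanishes where the discriminant does not, because there it has two roots.
\<close>
lemma cubic_divides:
  assumes f: "f \<in> family.reg" "\<And>x. \<lbrakk>x \<in> family_ambient; cubic x = 0\<rbrakk> \<Longrightarrow> f x = 0"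
  shows "\<exists>q\<in>family.reg. \<forall>x\<in>family_ambient. f x = q x * cubic x"
proof -
  define B where "B = (\<lambda>x\<in>family_ambient. snd x $ 2 * snd x $ 3 + (1 + fst (fst x) * snd (fst x)))"
  define C where "C = (\<lambda>x\<in>family_ambient. (snd x $ 2)\<^sup>2 + (fst (fst x) + snd (fst x)) * snd x $ 2
    + fst (fst x) * snd (fst x))"
  have BC: "B \<in> family.reg" "C \<in> family.reg"
    unfolding B_def C_def by (rule regular_coords regular_intros)+
  have set1: "family.set_coord (Inr 1) t ((a, b), x) = ((a, b), \<chi> i. if i = 1 then t else x $ i)" for t a b x
    by (simp add: family.set_coord_def family_point_def family_coord_eq vec_eq_iff)
  have indep: "family.independent_of (Inr 1) B" "family.independent_of (Inr 1) C"
    unfolding family.independent_of_def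
    by (safe, simp add: B_def set1 family_ambient_def, simp add: C_def set1 family_ambient_def)
  have F: "cubic x = (family_coord (Inr 1) x)\<^sup>2 + B x * family_coord (Inr 1) x + C x"
    if "x \<in> family_ambient" for x
    using that by (cases x) (simp add: B_def C_def cubic_def case_prod_beta' algebra_simps)
  have "Inr 1 \<notin> range Inl" by auto
  then obtain g0 g1 q where g: "g0 \<in> family.reg" "g1 \<in> family.reg" "q \<in> family.reg"
    "family.independent_of (Inr 1) g0" "family.independent_of (Inr 1) g1"
    "\<forall>x\<in>family_ambient. f x = g0 x + g1 x * family_coord (Inr 1) x + q x * cubic x"
    using family.quadratic_division[OF _ BC(1) indep(1) BC(2) indep(2) F f(1)] by blast
  have generic: "g0 z = 0 \<and> g1 z = 0" if z: "z \<in> family_ambient" and disc: "(B z)\<^sup>2 - 4 * C z \<noteq> 0" for z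
  proof -
    obtain r s where rs: "r \<noteq> s" "r\<^sup>2 + B z * r + C z = 0" "s\<^sup>2 + B z * s + C z = 0"
      using quadratic_two_roots[OF disc] .
    have "g0 z + g1 z * t = 0" if t: "t\<^sup>2 + B z * t + C z = 0" for t
    proof -
      define w where "w = family.set_coord (Inr 1) t z"
      have w: "w \<in> family_ambient" unfolding w_def using z by (subst family.set_coord_mem) auto
      have "B w = B z" "C w = C z" "g0 w = g0 z" "g1 w = g1 z" "family_coord (Inr 1) w = t"
        using indep g(4,5) z by (auto simp: w_def family.independent_of_def)
      then show ?thesis using f(2)[OF w] F[OF w] g(6) w t by auto
    qed
    with rs have "g0 z + g1 z * r = 0" "g0 z + g1 z * s = 0" by auto
    then have "g1 z * (r - s) = 0" by (simp add: algebra_simps add_eq_0_iff)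
    then show ?thesis using rs(1) \<open>g0 z + g1 z * r = 0\<close> by simp
  qed
  \<comment> \<open>Where \<open>x\<^sub>2\<close> is non-zero, the discriminant is a quadratic in
    \<open>x\<^sub>3\<close> with leading coefficient \<open>x\<^sub>2\<^sup>2\<close>, so it
    vanishes for finitely many \<open>x\<^sub>3\<close> only. Points with
    \<open>x\<^sub>2 = 0\<close> are then reached by moving \<open>x\<^sub>2\<close>.\<close>
  have zero: "g z = 0" if gen: "g \<in> family.reg" "\<And>z. \<lbrakk>z \<in> family_ambient; (B z)\<^sup>2 - 4 * C z \<noteq> 0\<rbrakk> \<Longrightarrow> g z = 0"
    and z: "z \<in> family_ambient" for g z
  proof -
    have step: "g z = 0" if z: "z \<in> family_ambient" and nz: "snd z $ 2 \<noteq> 0" for z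
    proof -
      obtain a b x where zeq: "z = ((a, b), x)" by (metis prod.exhaust)
      let ?S = "{t. (x$2)\<^sup>2 * t\<^sup>2 + (2 * x$2 * (1 + a * b)) * t
        + ((1 + a * b)\<^sup>2 - 4 * ((x$2)\<^sup>2 + (a + b) * x$2 + a * b)) = 0}"
      have "g (family.set_coord (Inr 3) t z) = 0" if t: "t \<notin> ?S" for t
      proof -
      define w where "w = family.set_coord (Inr 3) t z"
      have w: "w \<in> family_ambient" unfolding w_def using z by (subst family.set_coord_mem) auto
      have weq: "w = ((a, b), \<chi> i. if i = 3 then t else x $ i)"
        by (simp add: w_def family.set_coord_def family_point_def zeq family_coord_eq vec_eq_iff)
      have "(B w)\<^sup>2 - 4 * C w = (x$2)\<^sup>2 * t\<^sup>2 + (2 * x$2 * (1 + a * b)) * t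
        + ((1 + a * b)\<^sup>2 - 4 * ((x$2)\<^sup>2 + (a + b) * x$2 + a * b))"
        using w unfolding weq B_def C_def by (simp add: algebra_simps power2_eq_square)
      then show "g (family.set_coord (Inr 3) t z) = 0" using gen(2)[OF w] t by (simp add: w_def)
      qed
      moreover have "finite ?S" by (rule finite_quadratic_roots) (use nz zeq in simp)
      ultimately show ?thesis
        by (intro family.regular_zero_from_nearby[OF gen(1) z, of "Inr 3" ?S]) auto
    qed
    show ?thesis
    proof (rule family.regular_zero_from_nearby[OF gen(1) z, of "Inr 2" "{0}"])
      fix t :: complex assume "t \<notin> {0}"
      then have "snd (family.set_coord (Inr 2) t z) $ 2 \<noteq> 0"
        by (simp add: family.set_coord_def family_point_def)
      moreover have "family.set_coord (Inr 2) t z \<in> family_ambient"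
        using z by (subst family.set_coord_mem) auto
      ultimately show "g (family.set_coord (Inr 2) t z) = 0" by (intro step)
    qed auto
  qed
  have "g0 z = 0 \<and> g1 z = 0" if "z \<in> family_ambient" for z
    using zero[OF g(1) _ that] zero[OF g(2) _ that] generic by blast
  then have "\<forall>x\<in>family_ambient. f x = q x * cubic x" using g(6) by auto
  then show ?thesis using g(3) by blast
qed

section \<open>The quotient map\<close>

fun quotient_map :: "data \<Rightarrow> (complex \<times> complex) \<times> (complex^3)" where
  "quotient_map (m, L) = ((alpha (m, L), beta (m, L)),
     vector [L$1$2 * L$2$1, L$1$1 * L$2$1 * m$1$2 - L$1$1 * L$2$2 * m$1$1, m$1$1 + m$2$2])"

lemma AnalyticData_iff:
  "(m, L) \<in> AnalyticData \<longleftrightarrow> m$1$2 * m$2$1 = m$1$1 * m$2$2 - 1 \<and> L$1$1 * L$2$2 = 1 + L$1$2 * L$2$1 \<and>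
     alpha (m, L) \<noteq> 0 \<and> beta (m, L) \<noteq> 0"
proof -
  have det: "x - y = 1 \<longleftrightarrow> y = x - 1" "x - y = 1 \<longleftrightarrow> x = 1 + y" for x y :: complex
    by (auto simp: algebra_simps)
  show ?thesis
    using det(1)[of "m$1$1 * m$2$2" "m$1$2 * m$2$1"] det(2)[of "L$1$1 * L$2$2" "L$1$2 * L$2$1"]
    by (simp add: AnalyticData_def det_2 del: alpha.simps beta.simps)
qed

text \<open>
  With \<open>u = l\<^sub>2 l\<^sub>3\<close>, \<open>P = l\<^sub>1 l\<^sub>3 m\<^sub>2\<close> and \<open>Q = l\<^sub>2 l\<^sub>4 m\<^sub>3\<close>, the cubic equation is
  \<open>P Q = u (1 + u) (m\<^sub>1 m\<^sub>4 - 1)\<close>, where \<open>\<beta>\<close> replaces \<open>Q\<close>.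
\<close>
lemma cubic_identity:
  fixes u P Q m1 m4 :: complex
  assumes "\<beta> = (1 + u) * m1 + Q - P - u * m4"
  shows "fibre_cubic m1 \<beta> (vector [u, P - (1 + u) * m1, m1 + m4]) = P * Q - u * (1 + u) * (m1 * m4 - 1)"
  unfolding assms by (simp add: fibre_cubic_def algebra_simps power2_eq_square)

lemma quotient_map_mem:
  assumes "x \<in> AnalyticData"
  shows "quotient_map x \<in> family_ambient" "cubic (quotient_map x) = 0"
proof -
  obtain m L where x: "x = (m, L)" by force
  have d: "m$1$2 * m$2$1 = m$1$1 * m$2$2 - 1" "L$1$1 * L$2$2 = 1 + L$1$2 * L$2$1"
    using assms by (auto simp: x AnalyticData_iff simp del: alpha.simps beta.simps)
  show "quotient_map x \<in> family_ambient"
    using assms by (simp add: x AnalyticData_iff family_ambient_def param_space_def del: alpha.simps beta.simps)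
  have beta: "beta (m, L) = (1 + L$1$2 * L$2$1) * m$1$1 + L$1$2 * L$2$2 * m$2$1
      - L$1$1 * L$2$1 * m$1$2 - L$1$2 * L$2$1 * m$2$2"
    by (simp add: d(2)[symmetric])
  have "cubic (quotient_map x) = fibre_cubic (m$1$1) (beta (m, L))
      (vector [L$1$2 * L$2$1, L$1$1 * L$2$1 * m$1$2 - (1 + L$1$2 * L$2$1) * m$1$1, m$1$1 + m$2$2])"
    by (simp add: x cubic_eq d(2)[symmetric] del: beta.simps)
  also have "\<dots> = (L$1$1 * L$2$1 * m$1$2) * (L$1$2 * L$2$2 * m$2$1)
      - L$1$2 * L$2$1 * (1 + L$1$2 * L$2$1) * (m$1$1 * m$2$2 - 1)"
    by (rule cubic_identity[OF beta])
  also have "\<dots> = 0" unfolding d[symmetric] by (simp add: algebra_simps)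
  finally show "cubic (quotient_map x) = 0" .
qed

text \<open>
  A point of the hypersurface lifts as soon as \<open>u\<close>, \<open>1 + u\<close>, \<open>m\<^sub>1 m\<^sub>4 - 1\<close>, \<open>P\<close> and \<open>Q\<close> are
  realized by monomials in the entries of the matrices.
\<close>
lemma lift_exists:
  fixes u v P Q :: complex
  assumes "P * Q = u * (1 + u) * v"
  shows "\<exists>l1 l2 l3 l4 m2 m3. l1 * l4 = 1 + u \<and> l2 * l3 = u \<and> m2 * m3 = v \<and>
    l1 * l3 * m2 = P \<and> l2 * l4 * m3 = Q"
proof -
  \<comment> \<open>If \<open>u (1 + u)\<close> is zero, then \<open>P Q = 0\<close> while
    \<open>v\<close> is arbitrary; which entries of \<open>L\<close> must vanish is decided by
    \<open>u\<close> and by the zero pattern of \<open>P\<close> and \<open>Q\<close>.\<close>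
  consider "u \<noteq> 0" "1 + u \<noteq> 0" | "u = 0" "P \<noteq> 0" | "u = 0" "P = 0" "Q \<noteq> 0" | "u = 0" "P = 0" "Q = 0"
    | "1 + u = 0" "P \<noteq> 0" | "1 + u = 0" "P = 0" "Q \<noteq> 0" | "1 + u = 0" "P = 0" "Q = 0"
    by blast
  note cases = this
  have I: ?thesis if "l1 * l4 = 1 + u" "l2 * l3 = u" "m2 * m3 = v" "l1 * l3 * m2 = P" "l2 * l4 * m3 = Q"
    for l1 l2 l3 l4 m2 m3 using that by blast
  from cases show ?thesis
  proof cases
    case 1
    have "P / u * (Q / (1 + u)) = P * Q / (u * (1 + u))" by simp
    then have "P / u * (Q / (1 + u)) = v" using 1 unfolding assms by simp
    then show ?thesis using 1 by (intro I[of 1 "1 + u" 1 u "P / u" "Q / (1 + u)"]) simp_all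
  next
    case 2
    then have "Q = 0" using assms by simp
    then show ?thesis using 2 by (intro I[of 1 1 0 1 P "v / P"]) simp_all
  next
    case 3
    then show ?thesis by (intro I[of 1 1 1 0 "v / Q" Q]) simp_all
  next
    case 4
    then show ?thesis by (intro I[of 1 1 0 0 v 1]) simp_all
  next
    case 5
    then have "Q = 0" "u = -1" using assms by (auto simp: add_eq_0_iff)
    then show ?thesis using 5(2) by (intro I[of 1 0 1 "-1" "- P" "- v / P"]) simp_all
  next
    case 6
    then have "u = -1" by (simp add: add_eq_0_iff)
    then show ?thesis using 6(2,3) by (intro I[of 0 1 1 "-1" "v / Q" Q]) simp_all
  next
    case 7
    then have "u = -1" by (simp add: add_eq_0_iff)
    then show ?thesis using 7(2,3) by (intro I[of 0 0 1 "-1" v 1]) simp_all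
  qed
qed

lemma quotient_map_surj:
  assumes "z \<in> family_ambient" "cubic z = 0"
  shows "\<exists>x\<in>AnalyticData. quotient_map x = z"
proof -
  obtain a b y where z: "z = ((a, b), y)" by (metis prod.exhaust)
  have ab: "a \<noteq> 0" "b \<noteq> 0" using assms(1) by (auto simp: z family_ambient_def param_space_def)
  \<comment> \<open>\<open>m4\<close> is read off from the trace, \<open>P\<close> from the second
    coordinate, and \<open>Q\<close> from the formula for \<beta>.\<close>
  define m4 where "m4 = y$3 - a"
  define P where "P = y$2 + (1 + y$1) * a"
  define Q where "Q = b + P + y$1 * m4 - (1 + y$1) * a"
  have y: "vector [y$1, P - (1 + y$1) * a, a + m4] = y"
    by (simp add: vec_eq_iff forall_3 P_def m4_def)
  have b: "b = (1 + y$1) * a + Q - P - y$1 * m4" by (simp add: Q_def)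
  have "P * Q = y$1 * (1 + y$1) * (a * m4 - 1)"
    using cubic_identity[OF b] assms(2) unfolding y z cubic_eq by simp
  then obtain l1 l2 l3 l4 m2 m3 where *: "l1 * l4 = 1 + y$1" "l2 * l3 = y$1" "m2 * m3 = a * m4 - 1"
    "l1 * l3 * m2 = P" "l2 * l4 * m3 = Q"
    using lift_exists by blast
  define m :: "complex^2^2" where "m = vector [vector [a, m2], vector [m3, m4]]"
  define L :: "complex^2^2" where "L = vector [vector [l1, l2], vector [l3, l4]]"
  have beta: "beta (m, L) = b"
    using b * by (simp add: m_def L_def)
  have "(m, L) \<in> AnalyticData"
    unfolding AnalyticData_iff beta using * ab by (simp add: m_def L_def)
  moreover have "quotient_map (m, L) = z"
  proof -
    have "l1 * l3 * m2 - l1 * l4 * a = P - (1 + y$1) * a" using * by simp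
    then have "quotient_map (m, L) = ((a, b), vector [y$1, P - (1 + y$1) * a, a + m4])"
      using * unfolding quotient_map.simps beta by (simp add: m_def L_def)
    then show ?thesis by (simp only: y z)
  qed
  ultimately show ?thesis by blast
qed

lemma quotient_map_torus_action:
  assumes "\<gamma> \<noteq> 0" "\<delta> \<noteq> 0"
  shows "quotient_map (torus_action \<gamma> \<delta> x) = quotient_map x"
proof -
  obtain m L where x: "x = (m, L)" by force
  have "beta (torus_action \<gamma> \<delta> x) = beta x"
    using assms by (simp add: x field_simps power2_eq_square)
  then show ?thesis
    using assms unfolding x by (simp del: beta.simps add: field_simps power2_eq_square)
qed

section \<open>The comorphism of the quotient map and the ring of invariants\<close>

definition pullback :: "((complex \<times> complex) \<times> (complex^3) \<Rightarrow> complex) \<Rightarrow> data \<Rightarrow> complex" where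
  "pullback f = (\<lambda>x\<in>AnalyticData. f (quotient_map x))"

definition data_generators :: "(data \<Rightarrow> complex) set" where
  "data_generators = {\<lambda>(m, L). m$i$j | i j. True} \<union> {\<lambda>(m, L). L$i$j | i j. True} \<union>
      {\<lambda>x. 1 / alpha x, \<lambda>x. 1 / beta x}"

abbreviation "data_regular \<equiv> regular_functions AnalyticData data_generators"

lemma AnalyticData_ring_eq: "AnalyticData_ring = coordinate_ring AnalyticData data_generators"
  by (simp add: AnalyticData_ring_def data_generators_def)

lemma data_regular_gens:
  "(\<lambda>x\<in>AnalyticData. fst x $ i $ j) \<in> data_regular" "(\<lambda>x\<in>AnalyticData. snd x $ i $ j) \<in> data_regular"
  "(\<lambda>x\<in>AnalyticData. 1 / alpha x) \<in> data_regular" "(\<lambda>x\<in>AnalyticData. 1 / beta x) \<in> data_regular"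
proof -
  have "(\<lambda>x. fst x $ i $ j) \<in> data_generators" "(\<lambda>x. snd x $ i $ j) \<in> data_generators"
    unfolding data_generators_def case_prod_beta' by blast+
  then show "(\<lambda>x\<in>AnalyticData. fst x $ i $ j) \<in> data_regular"
    "(\<lambda>x\<in>AnalyticData. snd x $ i $ j) \<in> data_regular"
    by (auto intro: regular_functions.gen)
qed (auto intro!: regular_functions.gen simp: data_generators_def)

lemma alpha_beta_eq:
  "alpha x = fst x $ 1 $ 1"
  "beta x = snd x $ 1 $ 1 * snd x $ 2 $ 2 * fst x $ 1 $ 1 + snd x $ 1 $ 2 * snd x $ 2 $ 2 * fst x $ 2 $ 1
     - snd x $ 1 $ 1 * snd x $ 2 $ 1 * fst x $ 1 $ 2 - snd x $ 1 $ 2 * snd x $ 2 $ 1 * fst x $ 2 $ 2"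
  by (cases x; simp)+

lemma quotient_map_components:
  "fst (fst (quotient_map x)) = alpha x" "snd (fst (quotient_map x)) = beta x"
  "snd (quotient_map x) $ 1 = snd x $ 1 $ 2 * snd x $ 2 $ 1"
  "snd (quotient_map x) $ 2 = snd x $ 1 $ 1 * snd x $ 2 $ 1 * fst x $ 1 $ 2 - snd x $ 1 $ 1 * snd x $ 2 $ 2 * fst x $ 1 $ 1"
  "snd (quotient_map x) $ 3 = fst x $ 1 $ 1 + fst x $ 2 $ 2"
  by (cases x; simp)+

lemma pullback_regular:
  assumes "f \<in> family.reg"
  shows "pullback f \<in> data_regular"
  unfolding pullback_def
proof (rule regular_compose[OF assms quotient_map_mem(1)])
  have ab: "(\<lambda>x\<in>AnalyticData. alpha x) \<in> data_regular" "(\<lambda>x\<in>AnalyticData. beta x) \<in> data_regular"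
    unfolding alpha_beta_eq by (intro regular_add regular_diff regular_mult data_regular_gens)+
  have x: "(\<lambda>x\<in>AnalyticData. snd (quotient_map x) $ i) \<in> data_regular" for i
    using exhaust_3[of i]
    by (elim disjE; simp only: quotient_map_components;
        intro regular_add regular_diff regular_mult data_regular_gens)
  show "(\<lambda>x\<in>AnalyticData. g (quotient_map x)) \<in> data_regular" if "g \<in> family_generators" for g
    using that ab x data_regular_gens(3,4)
    by (auto simp: family_generators_def case_prod_beta' quotient_map_components)
qed

lemma R_ring_simps [simp]:
  "carrier R_ring = {f \<in> data_regular. \<forall>\<gamma> \<delta>. \<gamma> \<noteq> 0 \<longrightarrow> \<delta> \<noteq> 0 \<longrightarrow>
     (\<forall>x\<in>AnalyticData. f (torus_action \<gamma> \<delta> x) = f x)}"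
  "mult R_ring = (\<lambda>f g. \<lambda>x\<in>AnalyticData. f x * g x)"
  "add R_ring = (\<lambda>f g. \<lambda>x\<in>AnalyticData. f x + g x)"
  "one R_ring = (\<lambda>x\<in>AnalyticData. 1)" "zero R_ring = (\<lambda>x\<in>AnalyticData. 0)"
  by (simp_all add: R_ring_def AnalyticData_ring_eq)

lemma cring_R_ring: "cring R_ring"
proof -
  interpret D: cring AnalyticData_ring unfolding AnalyticData_ring_eq by (rule cring_coordinate_ring)
  let ?H = "{f \<in> carrier AnalyticData_ring. \<forall>\<gamma> \<delta>. \<gamma> \<noteq> 0 \<longrightarrow> \<delta> \<noteq> 0 \<longrightarrow>
     (\<forall>x\<in>AnalyticData. f (torus_action \<gamma> \<delta> x) = f x)}"
  have "subring ?H AnalyticData_ring"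
  proof (rule D.subringI)
    fix f assume "f \<in> ?H"
    then show "\<ominus>\<^bsub>AnalyticData_ring\<^esub> f \<in> ?H"
      using coordinate_ring_a_inv[of f AnalyticData data_generators]
      by (auto simp: AnalyticData_ring_eq torus_action_AnalyticData intro: regular_intros)
  qed (auto simp: AnalyticData_ring_eq torus_action_AnalyticData intro: regular_intros)
  then have "subcring ?H AnalyticData_ring" by (rule D.subcringI')
  then show ?thesis unfolding R_ring_def using D.subcring_iff[of ?H] by auto
qed

subsection \<open>Invariants\<close>

definition descends :: "(data \<Rightarrow> complex) \<Rightarrow> bool" where
  "descends h \<longleftrightarrow> (\<exists>g\<in>family.reg. \<forall>x\<in>AnalyticData. h x = g (quotient_map x))"

lemma descendsI:
  assumes "restrict g family_ambient \<in> family.reg" "\<And>x. x \<in> AnalyticData \<Longrightarrow> h x = g (quotient_map x)"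
  shows "descends h"
  unfolding descends_def using assms quotient_map_mem(1) by (intro bexI[OF _ assms(1)]) auto

lemma descends_mult:
  assumes "descends f" "descends g"
  shows "descends (\<lambda>x. f x * g x)"
proof -
  obtain f' g' where *: "f' \<in> family.reg" "\<forall>x\<in>AnalyticData. f x = f' (quotient_map x)"
    "g' \<in> family.reg" "\<forall>x\<in>AnalyticData. g x = g' (quotient_map x)"
    using assms unfolding descends_def by blast
  show ?thesis
    by (rule descendsI[OF regular_functions.mult[OF *(1,3)]]) (use *(2,4) in simp)
qed

lemma descends_add:
  assumes "descends f" "descends g"
  shows "descends (\<lambda>x. f x + g x)"
proof -
  obtain f' g' where *: "f' \<in> family.reg" "\<forall>x\<in>AnalyticData. f x = f' (quotient_map x)"
    "g' \<in> family.reg" "\<forall>x\<in>AnalyticData. g x = g' (quotient_map x)"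
    using assms unfolding descends_def by blast
  show ?thesis
    by (rule descendsI[OF regular_functions.add[OF *(1,3)]]) (use *(2,4) in simp)
qed

lemma descends_const: "descends (\<lambda>x. c)"
  by (rule descendsI[of "\<lambda>x. c"]) (auto intro: regular_functions.const)

text \<open>Only the six entries that the torus scales non-trivially occur; the invariant entries
  \<open>m\<^sub>1\<close> and \<open>m\<^sub>4\<close> are left to the coefficients.\<close>

fun data_monomial :: "nat \<times> nat \<times> nat \<times> nat \<times> nat \<times> nat \<Rightarrow> data \<Rightarrow> complex" where
  "data_monomial (a, b, c, d, e, f) (m, L) =
     m$1$2 ^ a * m$2$1 ^ b * L$1$1 ^ c * L$1$2 ^ d * L$2$1 ^ e * L$2$2 ^ f"

text \<open>The minimal monomials of weight zero. The determinants turn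
  \<open>m\<^sub>2 m\<^sub>3\<close> into \<open>m\<^sub>1 m\<^sub>4 - 1\<close> and
  \<open>l\<^sub>1 l\<^sub>4\<close> into \<open>1 + l\<^sub>2 l\<^sub>3\<close>, and the formula
  for \<beta> gives the last one.\<close>

lemma descends_basic:
  "descends (data_monomial (1, 1, 0, 0, 0, 0))" "descends (data_monomial (0, 0, 1, 0, 0, 1))"
  "descends (data_monomial (0, 0, 0, 1, 1, 0))" "descends (data_monomial (1, 0, 1, 0, 1, 0))"
  "descends (data_monomial (0, 1, 0, 1, 0, 1))"
proof -
  show "descends (data_monomial (1, 1, 0, 0, 0, 0))"
  proof (rule descendsI)
    show "(\<lambda>x\<in>family_ambient. fst (fst x) * (snd x $ 3 - fst (fst x)) - 1) \<in> family.reg"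
      by (intro regular_diff regular_mult regular_coords regular_functions.const)
    fix x assume "x \<in> AnalyticData"
    then show "data_monomial (1, 1, 0, 0, 0, 0) x = fst (fst (quotient_map x)) *
        (snd (quotient_map x) $ 3 - fst (fst (quotient_map x))) - 1"
      by (cases x) (simp add: AnalyticData_iff)
  qed
  show "descends (data_monomial (0, 0, 1, 0, 0, 1))"
  proof (rule descendsI)
    show "(\<lambda>x\<in>family_ambient. 1 + snd x $ 1) \<in> family.reg"
      by (intro regular_add regular_coords regular_functions.const)
    fix x assume "x \<in> AnalyticData"
    then show "data_monomial (0, 0, 1, 0, 0, 1) x = 1 + snd (quotient_map x) $ 1"
      by (cases x) (simp add: AnalyticData_iff)
  qed
  show "descends (data_monomial (0, 0, 0, 1, 1, 0))"
  proof (rule descendsI)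
    show "(\<lambda>x\<in>family_ambient. snd x $ 1) \<in> family.reg" by (rule regular_coords)
    fix x assume "x \<in> AnalyticData"
    then show "data_monomial (0, 0, 0, 1, 1, 0) x = snd (quotient_map x) $ 1"
      by (cases x) simp
  qed
  show "descends (data_monomial (1, 0, 1, 0, 1, 0))"
  proof (rule descendsI)
    show "(\<lambda>x\<in>family_ambient. snd x $ 2 + (1 + snd x $ 1) * fst (fst x)) \<in> family.reg"
      by (intro regular_add regular_mult regular_coords regular_functions.const)
    fix x assume "x \<in> AnalyticData"
    then show "data_monomial (1, 0, 1, 0, 1, 0) x
        = snd (quotient_map x) $ 2 + (1 + snd (quotient_map x) $ 1) * fst (fst (quotient_map x))"
      by (cases x) (simp add: AnalyticData_iff mult_ac flip: distrib_right)
  qed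
  show "descends (data_monomial (0, 1, 0, 1, 0, 1))"
  proof (rule descendsI)
    show "(\<lambda>x\<in>family_ambient. snd (fst x) + snd x $ 2 + snd x $ 1 * (snd x $ 3 - fst (fst x))) \<in> family.reg"
      by (intro regular_add regular_diff regular_mult regular_coords)
    fix x assume "x \<in> AnalyticData"
    show "data_monomial (0, 1, 0, 1, 0, 1) x = snd (fst (quotient_map x)) + snd (quotient_map x) $ 2
        + snd (quotient_map x) $ 1 * (snd (quotient_map x) $ 3 - fst (fst (quotient_map x)))"
      by (cases x) (simp add: algebra_simps)
  qed
qed

lemma data_monomial_mult:
  "data_monomial (a, b, c, d, e, f) x * data_monomial (a', b', c', d', e', f') x
     = data_monomial (a + a', b + b', c + c', d + d', e + e', f + f') x"
  by (cases x) (simp add: power_add)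

text \<open>The hypotheses say that the weights for \<gamma> and \<delta> are zero. Unless all
  exponents vanish, this forces one of the five basic monomials to divide, and the quotient is a
  smaller monomial of weight zero.\<close>

lemma weight_zero_descends:
  assumes "2 * a + d + f = 2 * b + c + e" "c + d = e + f"
  shows "descends (data_monomial (a, b, c, d, e, f))"
  using assms
proof (induction "a + b + c + d + e + f" arbitrary: a b c d e f rule: less_induct)
  case less
  have step: "descends (data_monomial (a, b, c, d, e, f))"
    if "descends (data_monomial (a1, b1, c1, d1, e1, f1))" "a1 \<le> a" "b1 \<le> b" "c1 \<le> c" "d1 \<le> d" "e1 \<le> e" "f1 \<le> f"
      "0 < a1 + b1 + c1 + d1 + e1 + f1" "2 * a1 + d1 + f1 = 2 * b1 + c1 + e1" "c1 + d1 = e1 + f1"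
    for a1 b1 c1 d1 e1 f1
  proof -
    have "descends (data_monomial (a - a1, b - b1, c - c1, d - d1, e - e1, f - f1))"
      using that less.prems by (intro less.hyps) auto
    from descends_mult[OF that(1) this] show ?thesis
      using that(2-7) by (simp add: data_monomial_mult)
  qed
  consider "a > 0" "b > 0" | "c > 0" "f > 0" | "d > 0" "e > 0" | "a > 0" "c > 0" "e > 0"
    | "b > 0" "d > 0" "f > 0" | "a = 0" "b = 0" "c = 0" "d = 0" "e = 0" "f = 0"
    using less.prems by linarith
  then show ?case
  proof cases
    case 1 then show ?thesis by (intro step[OF descends_basic(1)]) auto
  next
    case 2 then show ?thesis by (intro step[OF descends_basic(2)]) auto
  next
    case 3 then show ?thesis by (intro step[OF descends_basic(3)]) auto
  next
    case 4 then show ?thesis by (intro step[OF descends_basic(4)]) auto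
  next
    case 5 then show ?thesis by (intro step[OF descends_basic(5)]) auto
  next
    case 6
    have "data_monomial (0, 0, 0, 0, 0, 0) x = 1" for x by (cases x) simp
    then show ?thesis using 6 descends_const[of 1] by (simp add: descends_def)
  qed
qed

text \<open>A form of regular functions adapted to the torus: coefficients that are invariant and
  already descend absorb \<open>m\<^sub>1\<close>, \<open>m\<^sub>4\<close> and the inverses of
  \<alpha> and \<beta>, so that every term is an eigenfunction of the torus.\<close>

inductive_set monomial_sums :: "(data \<Rightarrow> complex) set" where
  monomial: "descends g \<Longrightarrow> (\<And>\<gamma> \<delta> x. \<lbrakk>x \<in> AnalyticData; \<gamma> \<noteq> 0; \<delta> \<noteq> 0\<rbrakk> \<Longrightarrow> g (torus_action \<gamma> \<delta> x) = g x)
    \<Longrightarrow> (\<lambda>x. g x * data_monomial E x) \<in> monomial_sums"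
| add: "f \<in> monomial_sums \<Longrightarrow> g \<in> monomial_sums \<Longrightarrow> (\<lambda>x. f x + g x) \<in> monomial_sums"

lemma monomial_sums_mult:
  assumes "f \<in> monomial_sums" "g \<in> monomial_sums"
  shows "(\<lambda>x. f x * g x) \<in> monomial_sums"
  using assms(1)
proof (induction rule: monomial_sums.induct)
  case (monomial h E)
  note outer = monomial
  show ?case using assms(2)
  proof (induction rule: monomial_sums.induct)
    case (monomial k E')
    obtain a b c d e f where E: "E = (a, b, c, d, e, f)" by (metis prod.exhaust)
    obtain a' b' c' d' e' f' where E': "E' = (a', b', c', d', e', f')" by (metis prod.exhaust)
    have "(\<lambda>x. (h x * k x) * data_monomial (a + a', b + b', c + c', d + d', e + e', f + f') x) \<in> monomial_sums"
      by (rule monomial_sums.monomial) (use outer monomial in \<open>auto intro: descends_mult\<close>)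
    then show ?case by (simp add: E E' data_monomial_mult[symmetric] ac_simps)
  next
    case (add f g)
    then show ?case using monomial_sums.add by (fastforce simp: distrib_left)
  qed
next
  case (add f1 f2)
  then show ?case using monomial_sums.add by (fastforce simp: distrib_right)
qed

lemma regular_monomial_sum:
  assumes "f \<in> data_regular"
  shows "\<exists>h\<in>monomial_sums. \<forall>x\<in>AnalyticData. f x = h x"
  using assms
proof (induction rule: regular_functions.induct)
  have inv: "\<exists>h\<in>monomial_sums. \<forall>x\<in>AnalyticData. k x = h x"
    if "descends k" "\<And>\<gamma> \<delta> x. \<lbrakk>x \<in> AnalyticData; \<gamma> \<noteq> 0; \<delta> \<noteq> 0\<rbrakk> \<Longrightarrow> k (torus_action \<gamma> \<delta> x) = k x" for k
  proof (intro bexI[of _ "\<lambda>x. k x * data_monomial (0, 0, 0, 0, 0, 0) x"] ballI)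
    show "k x = k x * data_monomial (0, 0, 0, 0, 0, 0) x" for x by (cases x) simp
    show "(\<lambda>x. k x * data_monomial (0, 0, 0, 0, 0, 0) x) \<in> monomial_sums"
      by (rule monomial_sums.monomial) (use that in auto)
  qed
  have mon: "data_monomial E \<in> monomial_sums" for E
    using monomial_sums.monomial[OF descends_const[of 1], of E] by simp
  {
    case (const c)
    then show ?case using inv[OF descends_const[of c]] by simp
  next
    case (gen g)
    have m22: "descends (\<lambda>(m, L). m$2$2)"
    proof (rule descendsI)
      show "(\<lambda>x\<in>family_ambient. snd x $ 3 - fst (fst x)) \<in> family.reg"
        by (intro regular_diff regular_coords)
      show "(case x of (m, L) \<Rightarrow> m$2$2) = snd (quotient_map x) $ 3 - fst (fst (quotient_map x))" for x
        by (cases x) simp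
    qed
    have m11: "descends (\<lambda>(m, L). m$1$1)"
      by (rule descendsI[OF regular_coords(1)]) auto
    have ia: "descends (\<lambda>x. 1 / alpha x)" and ib: "descends (\<lambda>x. 1 / beta x)"
      by (rule descendsI[OF regular_coords(3)], simp add: quotient_map_components,
          rule descendsI[OF regular_coords(4)], simp add: quotient_map_components)
    have "\<exists>h\<in>monomial_sums. \<forall>x\<in>AnalyticData. g x = h x"
    proof -
      consider i j where "g = (\<lambda>(m, L). m$i$j)" | i j where "g = (\<lambda>(m, L). L$i$j)"
        | "g = (\<lambda>x. 1 / alpha x)" | "g = (\<lambda>x. 1 / beta x)"
        using gen unfolding data_generators_def by blast
      note forms = this
      let ?P = "\<lambda>g. \<exists>h\<in>monomial_sums. \<forall>x\<in>AnalyticData. g x = h x"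
      from forms show ?thesis
      proof cases
        case (1 i j)
        have "?P (\<lambda>(m, L). m$1$1)" by (rule inv[OF m11]) auto
        moreover have "?P (\<lambda>(m, L). m$1$2)" by (rule bexI[OF _ mon[of "(1, 0, 0, 0, 0, 0)"]]) auto
        moreover have "?P (\<lambda>(m, L). m$2$1)" by (rule bexI[OF _ mon[of "(0, 1, 0, 0, 0, 0)"]]) auto
        moreover have "?P (\<lambda>(m, L). m$2$2)" by (rule inv[OF m22]) auto
        ultimately have "\<forall>i j. ?P (\<lambda>(m, L). m$i$j)" unfolding forall_2 by blast
        then show ?thesis unfolding 1 by blast
      next
        case (2 i j)
        have "?P (\<lambda>(m, L). L$1$1)" by (rule bexI[OF _ mon[of "(0, 0, 1, 0, 0, 0)"]]) auto
        moreover have "?P (\<lambda>(m, L). L$1$2)" by (rule bexI[OF _ mon[of "(0, 0, 0, 1, 0, 0)"]]) auto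
        moreover have "?P (\<lambda>(m, L). L$2$1)" by (rule bexI[OF _ mon[of "(0, 0, 0, 0, 1, 0)"]]) auto
        moreover have "?P (\<lambda>(m, L). L$2$2)" by (rule bexI[OF _ mon[of "(0, 0, 0, 0, 0, 1)"]]) auto
        ultimately have "\<forall>i j. ?P (\<lambda>(m, L). L$i$j)" unfolding forall_2 by blast
        then show ?thesis unfolding 2 by blast
      next
        case 3
        then show ?thesis using inv[OF ia] by (simp add: torus_action_AnalyticData)
      next
        case 4
        then show ?thesis using inv[OF ib] by (simp add: torus_action_AnalyticData)
      qed
    qed
    then show ?case by simp
  next
    case (add f g)
    then obtain h k where "h \<in> monomial_sums" "\<forall>x\<in>AnalyticData. f x = h x"
      "k \<in> monomial_sums" "\<forall>x\<in>AnalyticData. g x = k x" by blast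
    then show ?case by (intro bexI[OF _ monomial_sums.add[of h k]]) auto
  next
    case (mult f g)
    then obtain h k where "h \<in> monomial_sums" "\<forall>x\<in>AnalyticData. f x = h x"
      "k \<in> monomial_sums" "\<forall>x\<in>AnalyticData. g x = k x" by blast
    then show ?case by (intro bexI[OF _ monomial_sums_mult[of h k]]) auto
  }
qed

subsection \<open>Averaging over roots of unity\<close>

definition unity_root :: "nat \<Rightarrow> nat \<Rightarrow> complex" where
  "unity_root N k = cis (2 * pi * real k / real N)"

lemma unity_root_nonzero [simp]: "unity_root N k \<noteq> 0"
  by (simp add: unity_root_def)

text \<open>Orthogonality of the characters of a cyclic group of order \<open>N\<close>. The bounds
  keep distinct exponents distinct modulo \<open>N\<close>, and the quotient of powers avoids
  negative exponents.\<close>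

lemma unity_root_power_sum:
  assumes "p < N" "q < N"
  shows "(\<Sum>k<N. unity_root N k ^ p / unity_root N k ^ q) = (if p = q then of_nat N else 0)"
proof (cases "p = q")
  case False
  define r where "r = unity_root N p / unity_root N q"
  have pow: "unity_root N k ^ p = unity_root N p ^ k" for k p
    by (simp add: unity_root_def Complex.DeMoivre field_simps)
  have "unity_root N p \<noteq> unity_root N q"
    using Complex.bij_betw_roots_unity[of N] assms False
    by (auto simp: unity_root_def bij_betw_def inj_on_def)
  then have "r \<noteq> 1" by (simp add: r_def)
  have "unity_root N k ^ N = 1" for k
    using assms by (simp add: unity_root_def Complex.DeMoivre)
  then have rN: "r ^ N = 1" by (simp add: r_def power_divide)
  have "(\<Sum>k<N. unity_root N k ^ p / unity_root N k ^ q) = (\<Sum>k<N. r ^ k)"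
    by (simp add: pow r_def power_divide)
  also have "\<dots> = 0" using \<open>r \<noteq> 1\<close> rN by (simp add: geometric_sum)
  finally show ?thesis using False by simp
qed simp

text \<open>The projection to the invariants of the finite group of pairs of \<open>N\<close>-th
  roots of unity; on monomials with weights small compared with \<open>N\<close> it agrees with the
  projection for the whole torus.\<close>

definition average :: "nat \<Rightarrow> (data \<Rightarrow> complex) \<Rightarrow> data \<Rightarrow> complex" where
  "average N h x = (\<Sum>j<N. \<Sum>k<N. h (torus_action (unity_root N j) (unity_root N k) x)) / of_nat (N * N)"

lemma data_monomial_torus_action:
  assumes "\<gamma> \<noteq> 0" "\<delta> \<noteq> 0"
  shows "data_monomial (a, b, c, d, e, f) (torus_action \<gamma> \<delta> x) =
    (\<gamma> ^ (2 * a + d + f) / \<gamma> ^ (2 * b + c + e)) * (\<delta> ^ (c + d) / \<delta> ^ (e + f)) * data_monomial (a, b, c, d, e, f) x"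
  using assms
  by (cases x) (simp add: power_add power_mult_distrib power_divide power_mult[symmetric] field_simps)

text \<open>For large \<open>N\<close> only terms of weight zero survive. The threshold depends on
  the expression for \<open>h\<close>, since \<open>N\<close> must exceed all weights in it.\<close>

lemma average_descends:
  assumes "h \<in> monomial_sums"
  shows "\<exists>N0. \<forall>N>N0. descends (average N h)"
  using assms
proof (induction rule: monomial_sums.induct)
  case (monomial g E)
  obtain a b c d e f where E: "E = (a, b, c, d, e, f)" by (metis prod.exhaust)
  define p q p' q' where "p = 2 * a + d + f" and "q = 2 * b + c + e" and "p' = c + d" and "q' = e + f"
  have "descends (average N (\<lambda>x. g x * data_monomial E x))" if N: "p + q + p' + q' < N" for N
  proof -
    have avg: "average N (\<lambda>x. g x * data_monomial E x) x
        = (if p = q \<and> p' = q' then g x * data_monomial E x else 0)" if x: "x \<in> AnalyticData" for x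
    proof -
      have "(\<Sum>j<N. \<Sum>k<N. g (torus_action (unity_root N j) (unity_root N k) x) *
          data_monomial E (torus_action (unity_root N j) (unity_root N k) x))
        = (\<Sum>j<N. \<Sum>k<N. (unity_root N j ^ p / unity_root N j ^ q) *
          ((unity_root N k ^ p' / unity_root N k ^ q') * (g x * data_monomial E x)))"
        by (simp add: monomial(2)[OF x] E data_monomial_torus_action p_def q_def p'_def q'_def ac_simps)
      also have "\<dots> = (\<Sum>j<N. unity_root N j ^ p / unity_root N j ^ q) *
          ((\<Sum>k<N. unity_root N k ^ p' / unity_root N k ^ q') * (g x * data_monomial E x))"
        by (simp only: sum_distrib_left sum_distrib_right) (rule sum.swap)
      also have "\<dots> = (if p = q \<and> p' = q' then of_nat (N * N) * (g x * data_monomial E x) else 0)"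
        using N by (simp add: unity_root_power_sum)
      finally show ?thesis using N by (simp add: average_def)
    qed
    show ?thesis
    proof (cases "p = q \<and> p' = q'")
      case True
      then have "descends (data_monomial E)"
        unfolding E p_def q_def p'_def q'_def by (intro weight_zero_descends) auto
      from descends_mult[OF monomial(1) this] show ?thesis
        using avg True by (simp add: descends_def)
    next
      case False
      then have "average N (\<lambda>x. g x * data_monomial E x) x = 0" if "x \<in> AnalyticData" for x
        by (simp only: avg[OF that] False if_False)
      then show ?thesis using descends_const[of 0] by (simp add: descends_def)
    qed
  qed
  then show ?case by blast
next
  case (add f g)
  then obtain M N where "\<forall>n>M. descends (average n f)" "\<forall>n>N. descends (average n g)" by blast
  moreover have "average n (\<lambda>x. f x + g x) = (\<lambda>x. average n f x + average n g x)" for n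
    by (simp add: average_def sum.distrib add_divide_distrib fun_eq_iff)
  ultimately have "\<forall>n>M + N. descends (average n (\<lambda>x. f x + g x))"
    by (simp add: descends_add)
  then show ?case by blast
qed

text \<open>An invariant equals its average for every positive \<open>N\<close>, and for a suitable
  \<open>N\<close> the average descends.\<close>

lemma invariant_is_pullback:
  assumes "f \<in> carrier R_ring"
  shows "\<exists>g\<in>family.reg. f = pullback g"
proof -
  have f: "f \<in> data_regular"
    and inv: "\<And>\<gamma> \<delta> x. \<lbrakk>\<gamma> \<noteq> 0; \<delta> \<noteq> 0; x \<in> AnalyticData\<rbrakk> \<Longrightarrow> f (torus_action \<gamma> \<delta> x) = f x"
    using assms by auto
  obtain h where h: "h \<in> monomial_sums" "\<And>x. x \<in> AnalyticData \<Longrightarrow> f x = h x"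
    using regular_monomial_sum[OF f] by blast
  obtain N0 where N0: "\<forall>N>N0. descends (average N h)" using average_descends[OF h(1)] by blast
  define N where "N = Suc N0"
  have "average N h x = f x" if "x \<in> AnalyticData" for x
  proof -
    have "h (torus_action (unity_root N j) (unity_root N k) x) = f x" for j k
      using inv[of "unity_root N j" "unity_root N k" x] h(2) torus_action_AnalyticData(1)[OF that] that
      by simp
    moreover have "N \<noteq> 0" by (simp add: N_def)
    ultimately show ?thesis by (simp add: average_def)
  qed
  moreover have "descends (average N h)" using N0 by (simp add: N_def)
  ultimately obtain g where g: "g \<in> family.reg" "\<forall>x\<in>AnalyticData. f x = g (quotient_map x)"
    unfolding descends_def by auto
  have "f = pullback g"
    using regular_eqI[OF f pullback_regular[OF g(1)]] g(2) by (simp add: pullback_def)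
  then show ?thesis using g(1) by blast
qed

lemma pullback_R_ring: "f \<in> family.reg \<Longrightarrow> pullback f \<in> carrier R_ring"
  using pullback_regular
  by (auto simp: pullback_def torus_action_AnalyticData quotient_map_torus_action)

lemma pullback_hom: "pullback \<in> ring_hom family.A R_ring"
proof (rule ring_hom_memI)
  show "pullback f \<in> carrier R_ring" if "f \<in> carrier family.A" for f
    using pullback_R_ring that unfolding coordinate_ring_simps .
  show "pullback (f \<otimes>\<^bsub>family.A\<^esub> g) = pullback f \<otimes>\<^bsub>R_ring\<^esub> pullback g" for f g
    unfolding R_ring_simps coordinate_ring_simps pullback_def
    by (rule restrict_ext) (simp add: quotient_map_mem(1))
  show "pullback (f \<oplus>\<^bsub>family.A\<^esub> g) = pullback f \<oplus>\<^bsub>R_ring\<^esub> pullback g" for f g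
    unfolding R_ring_simps coordinate_ring_simps pullback_def
    by (rule restrict_ext) (simp add: quotient_map_mem(1))
  show "pullback \<one>\<^bsub>family.A\<^esub> = \<one>\<^bsub>R_ring\<^esub>"
    unfolding R_ring_simps coordinate_ring_simps pullback_def
    by (rule restrict_ext) (simp add: quotient_map_mem(1))
qed

interpretation R: hypersurface family_coord family_point "range Inl" family_ambient family_generators
  R_ring pullback "restrict cubic family_ambient" family_gradient
proof (intro hypersurface.intro hypersurface_axioms.intro)
  show "laurent_space family_coord family_point (range Inl) family_ambient family_generators"
    by (rule family.laurent_space_axioms)
  show "cring R_ring" by (rule cring_R_ring)
  show "pullback \<in> ring_hom family.A R_ring" by (rule pullback_hom)
  show "pullback ` family.reg = carrier R_ring"
    using pullback_R_ring invariant_is_pullback by blast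
  show "restrict cubic family_ambient \<in> family.reg" by (rule cubic_regular)
  show "pullback f = \<zero>\<^bsub>R_ring\<^esub> \<longleftrightarrow>
      (\<exists>g\<in>family.reg. \<forall>x\<in>family_ambient. f x = g x * restrict cubic family_ambient x)"
    if f: "f \<in> family.reg" for f
  proof
    assume zero: "pullback f = \<zero>\<^bsub>R_ring\<^esub>"
    \<comment> \<open>Every zero of the cubic is the image of some data, so a function that pulls
      back to zero vanishes at all of them; \<open>cubic_divides\<close> turns this into
      divisibility.\<close>
    have "f x = 0" if x: "x \<in> family_ambient" "cubic x = 0" for x
    proof -
      obtain y where y: "y \<in> AnalyticData" "quotient_map y = x" using quotient_map_surj[OF x] by blast
      have "pullback f y = 0" unfolding zero using y by simp
      then show ?thesis using y by (simp add: pullback_def)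
    qed
    from cubic_divides[OF f this] show "\<exists>g\<in>family.reg. \<forall>x\<in>family_ambient. f x = g x * restrict cubic family_ambient x"
      by simp
  next
    assume "\<exists>g\<in>family.reg. \<forall>x\<in>family_ambient. f x = g x * restrict cubic family_ambient x"
    then show "pullback f = \<zero>\<^bsub>R_ring\<^esub>"
      unfolding pullback_def R_ring_simps
      by (intro restrict_ext) (metis mult_zero_right quotient_map_mem restrict_apply')
  qed
  show "g = (\<lambda>x\<in>family_ambient. 0)"
    if "g \<in> family.reg" "\<And>x. x \<in> family_ambient \<Longrightarrow> restrict cubic family_ambient x * g x = 0" for g
    using cubic_nonzerodivisor[OF that] .
  show "((\<lambda>t. restrict cubic family_ambient (family_point (\<lambda>i. family_coord i z + t * v i)))
      has_field_derivative (\<Sum>i\<in>UNIV. family_gradient i z * v i)) (at 0)"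
    if "z \<in> family_ambient" for z v
    by (rule cubic_derivative[OF that])
qed

section \<open>Irreducible subvarieties of the cubic surfaces\<close>

lemma family_index_cases:
  obtains "i = Inl False" | "i = Inl True" | "i = Inr 1" | "i = Inr 2" | "i = Inr (3 :: 3)"
proof (cases i)
  case (Inl b)
  then show ?thesis using that by (cases b) auto
next
  case (Inr j)
  then show ?thesis using that exhaust_3[of j] by auto
qed

lemma family_ambient_iff: "((a, b), x) \<in> family_ambient \<longleftrightarrow> a \<noteq> 0 \<and> b \<noteq> 0"
  by (simp add: family_ambient_def param_space_def)

text \<open>The cubic is linear in \<open>x\<^sub>3\<close> with coefficient
  \<open>x\<^sub>1 x\<^sub>2\<close>; this is its root.\<close>

definition third_coord :: "complex \<Rightarrow> complex \<Rightarrow> complex \<Rightarrow> complex \<Rightarrow> complex" where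
  "third_coord a b u v = - (u\<^sup>2 + v\<^sup>2 + (1 + a * b) * u + (a + b) * v + a * b) / (u * v)"

lemma fibre_cubic_graph:
  assumes "u \<noteq> 0" "v \<noteq> 0"
  shows "fibre_cubic a b (vector [u, v, third_coord a b u v]) = 0"
  using assms by (simp add: fibre_cubic_def third_coord_def)

lemma third_coord_unique:
  assumes "fibre_cubic a b x = 0" "x$1 \<noteq> 0" "x$2 \<noteq> 0"
  shows "x = vector [x$1, x$2, third_coord a b (x$1) (x$2)]"
proof -
  have "x$3 * (x$1 * x$2) = - ((x$1)\<^sup>2 + (x$2)\<^sup>2 + (1 + a * b) * x$1 + (a + b) * x$2 + a * b)"
    using assms(1) by (simp add: fibre_cubic_def algebra_simps eq_neg_iff_add_eq_0)
  then have "x$3 = third_coord a b (x$1) (x$2)"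
    using assms(2,3) unfolding third_coord_def by (metis nonzero_eq_divide_eq mult_eq_0_iff)
  then show ?thesis by (simp add: vec_eq_iff forall_3)
qed

definition open_part :: "((complex \<times> complex) \<times> (complex^3)) set" where
  "open_part = {((a, b), x). a \<noteq> 0 \<and> b \<noteq> 0 \<and> x$1 \<noteq> 0 \<and> x$2 \<noteq> 0 \<and> fibre_cubic a b x = 0}"

lemma open_part_subset: "open_part \<subseteq> {x \<in> family_ambient. restrict cubic family_ambient x = 0}"
  by (auto simp: open_part_def family_ambient_iff cubic_eq)

lemma open_part_graph: "\<lbrakk>a \<noteq> 0; b \<noteq> 0; u \<noteq> 0; v \<noteq> 0\<rbrakk> \<Longrightarrow> ((a, b), vector [u, v, third_coord a b u v]) \<in> open_part"
  by (simp add: open_part_def fibre_cubic_graph)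

text \<open>
  The parametrization by \<open>a\<close>, \<open>b\<close>, \<open>x\<^sub>1\<close>, \<open>x\<^sub>2\<close> identifies the open part with the complement of
  the coordinate hyperplanes; two points of it are joined by a line minus finitely many points.
\<close>
lemma open_part_curve:
  assumes "((a, b), x) \<in> open_part" "((a', b'), x') \<in> open_part"
  obtains T \<theta> where "open T" "connected T" "\<theta> ` T \<subseteq> open_part"
    "((a, b), x) \<in> \<theta> ` T" "((a', b'), x') \<in> \<theta> ` T"
    "\<And>i. (\<lambda>t. family_coord i (\<theta> t)) holomorphic_on T"
    "\<And>t. a = a' \<Longrightarrow> fst (fst (\<theta> t)) = a" "\<And>t. b = b' \<Longrightarrow> snd (fst (\<theta> t)) = b"
proof -
  define l where "l r s t = r + t * (s - r)" for r s t :: complex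
  have l: "l r s 0 = r" "l r s 1 = s" "l r r t = r" for r s t by (simp_all add: l_def)
  \<comment> \<open>Each interpolation is non-zero at \<open>t = 0\<close>, so it has at most one
    zero, and the complement of \<open>S\<close> is connected.\<close>
  define S where "S = {t. l a a' t = 0} \<union> {t. l b b' t = 0} \<union> {t. l (x$1) (x'$1) t = 0} \<union> {t. l (x$2) (x'$2) t = 0}"
  have ne: "a \<noteq> 0" "b \<noteq> 0" "x$1 \<noteq> 0" "x$2 \<noteq> 0" "a' \<noteq> 0" "b' \<noteq> 0" "x'$1 \<noteq> 0" "x'$2 \<noteq> 0"
    "fibre_cubic a b x = 0" "fibre_cubic a' b' x' = 0"
    using assms by (auto simp: open_part_def)
  have "finite {t. l r s t = 0}" if "r \<noteq> 0" for r s
    using finite_quadratic_roots[of 0 "s - r" r] that by (simp add: l_def algebra_simps)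
  then have fin: "finite S" using ne by (simp add: S_def)
  define \<theta> where "\<theta> t = ((l a a' t, l b b' t), vector [l (x$1) (x'$1) t, l (x$2) (x'$2) t,
      third_coord (l a a' t) (l b b' t) (l (x$1) (x'$1) t) (l (x$2) (x'$2) t)] :: complex^3)" for t
  have T: "l a a' t \<noteq> 0" "l b b' t \<noteq> 0" "l (x$1) (x'$1) t \<noteq> 0" "l (x$2) (x'$2) t \<noteq> 0" if "t \<in> - S" for t
    using that by (auto simp: S_def)
  show ?thesis
  proof (rule that[of "- S" \<theta>])
    show "open (- S)" using fin by (simp add: finite_imp_closed open_Compl)
    have "connected (UNIV - S)"
      by (rule connected_open_diff_countable) (use fin in \<open>auto simp: uncountable_infinite countable_finite\<close>)
    then show "connected (- S)" by (simp add: Compl_eq_Diff_UNIV)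
    show "\<theta> ` (- S) \<subseteq> open_part"
      unfolding \<theta>_def using T by (blast intro: open_part_graph)
    have "0 \<in> - S" "\<theta> 0 = ((a, b), x)"
      using ne third_coord_unique[OF ne(9,3,4)] by (simp_all add: S_def l \<theta>_def)
    then show "((a, b), x) \<in> \<theta> ` (- S)" by force
    have "1 \<in> - S" "\<theta> 1 = ((a', b'), x')"
      using ne third_coord_unique[OF ne(10,7,8)] by (simp_all add: S_def l \<theta>_def)
    then show "((a', b'), x') \<in> \<theta> ` (- S)" by force
    show "(\<lambda>t. family_coord i (\<theta> t)) holomorphic_on (- S)" for i
    proof (cases i rule: family_index_cases)
      case 5
      have "(\<lambda>t. third_coord (l a a' t) (l b b' t) (l (x$1) (x'$1) t) (l (x$2) (x'$2) t)) holomorphic_on (- S)"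
        unfolding third_coord_def using T(3,4)
        by (intro holomorphic_intros) (auto simp: l_def intro!: holomorphic_intros)
      then show ?thesis by (simp add: 5 \<theta>_def)
    qed (simp_all add: \<theta>_def l_def holomorphic_intros)
    show "fst (fst (\<theta> t)) = a" if "a = a'" for t using that by (simp add: \<theta>_def l)
    show "snd (fst (\<theta> t)) = b" if "b = b'" for t using that by (simp add: \<theta>_def l)
  qed
qed

text \<open>The curve is a conic or a line in the plane through \<open>z\<close> where \<open>x\<^sub>1\<close> is constant.\<close>
lemma fibre_curve:
  assumes z: "fibre_cubic a b z = 0" and ab: "a \<noteq> 0" "b \<noteq> 0"
  obtains T \<gamma> where "open T" "connected T" "z \<in> \<gamma> ` T" "\<And>i. (\<lambda>t. \<gamma> t $ i) holomorphic_on T"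
    "\<And>t. t \<in> T \<Longrightarrow> fibre_cubic a b (\<gamma> t) = 0 \<and> \<gamma> t $ 1 = z $ 1" "\<gamma> ` T \<noteq> {z}"
proof -
  let ?u = "z $ 1"
  let ?c = "(?u + 1) * (?u + a * b)"
  have F: "fibre_cubic a b (vector [?u, v, w]) = ?u * v * w + v\<^sup>2 + (a + b) * v + ?c" for v w
    by (simp add: fibre_cubic_def algebra_simps power2_eq_square)
  have zF: "?u * z$2 * z$3 + (z$2)\<^sup>2 + (a + b) * z$2 + ?c = 0"
    using z by (simp add: fibre_cubic_def algebra_simps power2_eq_square)
  have zeq: "z = vector [?u, z$2, z$3]" by (simp add: vec_eq_iff forall_3)
  have hol: "(\<lambda>t. (vector [p t, q t, r t] :: complex^3) $ i) holomorphic_on T"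
    if "p holomorphic_on T" "q holomorphic_on T" "r holomorphic_on T" for p q r T and i :: 3
    using exhaust_3[of i] that by auto
  \<comment> \<open>For fixed \<open>x\<^sub>1 = ?u\<close> the equation is
    \<open>?u v w + v\<^sup>2 + (a + b) v + ?c = 0\<close>. The cases give a line in the direction
    of \<open>x\<^sub>3\<close>, the graph of a function of \<open>v \<noteq> 0\<close>, and, once
    the factor \<open>v\<close> splits off, a line as a graph over \<open>v\<close>.\<close>
  consider "?u * z$2 = 0" | "?u \<noteq> 0" "?c \<noteq> 0" | "?u \<noteq> 0" "z$2 \<noteq> 0" "?c = 0" by auto
  then show thesis
  proof cases
    case 1
    then have F0: "(z$2)\<^sup>2 + (a + b) * z$2 + ?c = 0" using zF unfolding 1 by simp
    show thesis
    proof (rule that[of UNIV "\<lambda>t. vector [?u, z$2, t]"])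
      show "z \<in> range (\<lambda>t. vector [?u, z$2, t])" using zeq by (rule range_eqI)
      have "(vector [?u, z$2, z$3 + 1] :: complex^3) \<noteq> z" by (auto simp: vec_eq_iff forall_3)
      then show "range (\<lambda>t. vector [?u, z$2, t]) \<noteq> {z}" by (metis rangeI singletonD)
      show "(\<lambda>t. (vector [?u, z$2, t] :: complex^3) $ i) holomorphic_on UNIV" for i
        by (intro hol holomorphic_intros)
      show "fibre_cubic a b (vector [?u, z$2, t]) = 0 \<and> (vector [?u, z$2, t] :: complex^3) $ 1 = ?u" for t
        by (simp only: F 1 mult_zero_left add_0 F0) simp
    qed auto
  next
    case 2
    have z2: "z$2 \<noteq> 0"
    proof
      assume "z$2 = 0"
      with zF have "?c = 0" by simp
      with 2 show False by simp
    qed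
    define w where "w v = - (v\<^sup>2 + (a + b) * v + ?c) / (?u * v)" for v
    have "z$3 * (?u * z$2) = - ((z$2)\<^sup>2 + (a + b) * z$2 + ?c)"
      using zF by (simp add: algebra_simps eq_neg_iff_add_eq_0)
    then have w: "w (z$2) = z$3" using 2(1) z2 unfolding w_def by (metis nonzero_eq_divide_eq mult_eq_0_iff)
    show thesis
    proof (rule that[of "- {0}" "\<lambda>t. vector [?u, t, w t]"])
      show "z \<in> (\<lambda>t. vector [?u, t, w t]) ` (- {0})"
        using zeq w z2 by (intro image_eqI[of _ _ "z$2"]) auto
      have "(vector [?u, 2 * z$2, w (2 * z$2)] :: complex^3) \<noteq> z" using z2 by (auto simp: vec_eq_iff forall_3)
      moreover have "(vector [?u, 2 * z$2, w (2 * z$2)] :: complex^3) \<in> (\<lambda>t. vector [?u, t, w t]) ` (- {0})"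
        using z2 by (intro imageI) auto
      ultimately show "(\<lambda>t. vector [?u, t, w t]) ` (- {0}) \<noteq> {z}" by auto
      have "w holomorphic_on - {0}" unfolding w_def using 2(1) by (intro holomorphic_intros) auto
      then show "(\<lambda>t. (vector [?u, t, w t] :: complex^3) $ i) holomorphic_on (- {0})" for i
        by (intro hol holomorphic_intros)
      show "fibre_cubic a b (vector [?u, t, w t]) = 0 \<and> (vector [?u, t, w t] :: complex^3) $ 1 = ?u" if "t \<in> - {0}" for t
        using that 2(1) by (simp add: F w_def)
      show "connected (- {0::complex})" by (rule connected_punctured_universe) simp
    qed auto
  next
    case 3
    define w where "w v = - (v + a + b) / ?u" for v
    have "z$2 * (?u * z$3 + z$2 + a + b) = 0" using zF unfolding 3(3) by (simp add: algebra_simps power2_eq_square)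
    then have "?u * z$3 + z$2 + a + b = 0" using 3(2) by simp
    then have "z$3 * ?u = - (z$2 + a + b)" by (simp add: algebra_simps eq_neg_iff_add_eq_0)
    then have w: "w (z$2) = z$3" using 3(1) unfolding w_def by (metis nonzero_eq_divide_eq)
    show thesis
    proof (rule that[of UNIV "\<lambda>t. vector [?u, t, w t]"])
      show "z \<in> range (\<lambda>t. vector [?u, t, w t])" using zeq w by (intro image_eqI[of _ _ "z$2"]) auto
      have "(vector [?u, z$2 + 1, w (z$2 + 1)] :: complex^3) \<noteq> z" by (auto simp: vec_eq_iff forall_3)
      moreover have "(vector [?u, z$2 + 1, w (z$2 + 1)] :: complex^3) \<in> range (\<lambda>t. vector [?u, t, w t])"
        by (rule rangeI)
      ultimately show "range (\<lambda>t. vector [?u, t, w t]) \<noteq> {z}" by blast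
      have "w holomorphic_on UNIV" unfolding w_def using 3(1) by (intro holomorphic_intros) auto
      then show "(\<lambda>t. (vector [?u, t, w t] :: complex^3) $ i) holomorphic_on UNIV" for i
        by (intro hol holomorphic_intros)
      show "fibre_cubic a b (vector [?u, t, w t]) = 0 \<and> (vector [?u, t, w t] :: complex^3) $ 1 = ?u" for t
      proof -
        have "?u * t * w t + t\<^sup>2 + (a + b) * t = 0"
          using 3(1) by (simp add: w_def field_simps power2_eq_square)
        then show ?thesis by (simp only: F 3(3) add_0) simp
      qed
    qed auto
  qed
qed

text \<open>The absolute value of the perturbed quadratic at \<open>r\<close> is the product of the
  distances from \<open>r\<close> to its two roots, so the nearer root lies within the square root
  of a quantity that tends to zero.\<close>

lemma quadratic_root_continuous:
  fixes r :: complex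
  assumes B: "B \<longlonglongrightarrow> b" and C: "C \<longlonglongrightarrow> c" and r: "r\<^sup>2 + b * r + c = 0"
  obtains s where "s \<longlonglongrightarrow> r" "\<And>k. (s k)\<^sup>2 + B k * s k + C k = 0"
proof -
  have "\<exists>s. s\<^sup>2 + B k * s + C k = 0 \<and> (norm (s - r))\<^sup>2 \<le> norm (r\<^sup>2 + B k * r + C k)" for k
  proof -
    define d where "d = csqrt ((B k)\<^sup>2 - 4 * C k)"
    define p where "p = (- B k + d) / 2"
    define q where "q = (- B k - d) / 2"
    have d: "d * d = B k * B k - 4 * C k" by (simp add: d_def flip: power2_eq_square)
    have fact: "t\<^sup>2 + B k * t + C k = (t - p) * (t - q)" for t
    proof -
      have "(t - p) * (t - q) = t\<^sup>2 + B k * t + (B k * B k - d * d) / 4"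
        by (simp add: p_def q_def field_simps power2_eq_square)
      then show ?thesis by (simp add: d)
    qed
    define s where "s = (if norm (p - r) \<le> norm (q - r) then p else q)"
    have "norm (s - r) \<le> norm (r - p)" "norm (s - r) \<le> norm (r - q)"
      by (auto simp: s_def norm_minus_commute)
    then have "(norm (s - r))\<^sup>2 \<le> norm (r - p) * norm (r - q)"
      unfolding power2_eq_square by (intro mult_mono) auto
    then show ?thesis
      by (intro exI[of _ s]) (auto simp: fact norm_mult s_def)
  qed
  then obtain s where s: "\<And>k. (s k)\<^sup>2 + B k * s k + C k = 0"
    "\<And>k. (norm (s k - r))\<^sup>2 \<le> norm (r\<^sup>2 + B k * r + C k)" by metis
  have "(\<lambda>k. norm (r\<^sup>2 + B k * r + C k)) \<longlonglongrightarrow> norm (r\<^sup>2 + b * r + c)"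
    by (intro tendsto_intros B C)
  then have lim: "(\<lambda>k. norm (r\<^sup>2 + B k * r + C k)) \<longlonglongrightarrow> 0" using r by simp
  have "(\<lambda>k. (norm (s k - r))\<^sup>2) \<longlonglongrightarrow> 0"
    by (rule tendsto_sandwich[OF _ _ tendsto_const lim]) (use s(2) in auto)
  then have "(\<lambda>k. norm (s k - r)) \<longlonglongrightarrow> 0"
    using tendsto_real_sqrt[of "\<lambda>k. (norm (s k - r))\<^sup>2" 0] by simp
  then have "(\<lambda>k. s k - r) \<longlonglongrightarrow> 0" by (rule tendsto_norm_zero_cancel)
  then have "s \<longlonglongrightarrow> r" by (rule LIM_zero_cancel)
  then show thesis using s(1) that by blast
qed

text \<open>A vanishing coordinate \<open>x\<^sub>1\<close> or \<open>x\<^sub>2\<close> is replaced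
  by \<open>1 / (k + 1)\<close> with \<open>x\<^sub>3\<close> fixed, and the other one follows as a
  root of a monic quadratic with converging coefficients. It is eventually non-zero, since the cubic
  equals \<open>a b\<close> where both vanish.\<close>

lemma fibre_dense:
  assumes z: "fibre_cubic a b z = 0" and ab: "a \<noteq> 0" "b \<noteq> 0"
  obtains s :: "nat \<Rightarrow> complex^3" where "\<And>i. (\<lambda>k. s k $ i) \<longlonglongrightarrow> z $ i"
    "\<forall>\<^sub>F k in sequentially. fibre_cubic a b (s k) = 0 \<and> s k $ 1 \<noteq> 0 \<and> s k $ 2 \<noteq> 0"
proof -
  note result = that
  define e :: "nat \<Rightarrow> complex" where "e k = 1 / of_nat (Suc k)" for k
  have e: "e \<longlonglongrightarrow> 0" "\<And>k. e k \<noteq> 0"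
    unfolding e_def using LIMSEQ_Suc[OF lim_inverse_n] by (simp_all add: inverse_eq_divide del: of_nat_Suc)
  have vec: "(\<lambda>k. (vector [p k, q k, r k] :: complex^3) $ i) \<longlonglongrightarrow> z $ i"
    if "p \<longlonglongrightarrow> z$1" "q \<longlonglongrightarrow> z$2" "r \<longlonglongrightarrow> z$3" for p q r and i :: 3
    using exhaust_3[of i] that by auto
  have sequence: thesis if lim: "p \<longlonglongrightarrow> z$1" "q \<longlonglongrightarrow> z$2"
    and ev: "\<forall>\<^sub>F k in sequentially. p k \<noteq> 0" "\<forall>\<^sub>F k in sequentially. q k \<noteq> 0"
    and 0: "\<And>k. fibre_cubic a b (vector [p k, q k, z$3]) = 0" for p q
  proof (rule result[of "\<lambda>k. vector [p k, q k, z$3]"])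
    show "(\<lambda>k. (vector [p k, q k, z$3] :: complex^3) $ i) \<longlonglongrightarrow> z $ i" for i
      by (rule vec) (use lim in auto)
    show "\<forall>\<^sub>F k in sequentially. fibre_cubic a b (vector [p k, q k, z$3]) = 0
        \<and> (vector [p k, q k, z$3] :: complex^3) $ 1 \<noteq> 0 \<and> (vector [p k, q k, z$3] :: complex^3) $ 2 \<noteq> 0"
      using ev by eventually_elim (simp add: 0)
  qed
  have coeff: "(\<lambda>k. e k * z$3 + c + d) \<longlonglongrightarrow> c + d" "(\<lambda>k. (e k)\<^sup>2 + c * e k + d) \<longlonglongrightarrow> d" for c d
  proof -
    have "(\<lambda>k. e k * z$3 + c + d) \<longlonglongrightarrow> 0 * z$3 + c + d" by (intro tendsto_intros e)
    then show "(\<lambda>k. e k * z$3 + c + d) \<longlonglongrightarrow> c + d" by simp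
    have "(\<lambda>k. (e k)\<^sup>2 + c * e k + d) \<longlonglongrightarrow> 0\<^sup>2 + c * 0 + d" by (intro tendsto_intros e)
    then show "(\<lambda>k. (e k)\<^sup>2 + c * e k + d) \<longlonglongrightarrow> d" by simp
  qed
  consider "z$1 \<noteq> 0" "z$2 \<noteq> 0" | "z$1 = 0" | "z$1 \<noteq> 0" "z$2 = 0" by blast
  then show thesis
  proof cases
    case 1
    then show thesis using z by (intro that[of "\<lambda>_. z"]) auto
  next
    case 2
    then have z2: "z$2 \<noteq> 0" using z ab by (auto simp: fibre_cubic_def)
    have "(z$2)\<^sup>2 + (a + b) * z$2 + a * b = 0" using z 2 by (simp add: fibre_cubic_def)
    then obtain y where y: "y \<longlonglongrightarrow> z$2"
      "\<And>k. (y k)\<^sup>2 + (e k * z$3 + a + b) * y k + ((e k)\<^sup>2 + (1 + a * b) * e k + a * b) = 0"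
      using quadratic_root_continuous[OF coeff] by blast
    show thesis
    proof (rule sequence)
      show "fibre_cubic a b (vector [e k, y k, z$3]) = 0" for k
        using y(2)[of k] by (simp add: fibre_cubic_def algebra_simps)
    qed (use e y z2 2 in \<open>auto intro: tendsto_imp_eventually_ne\<close>)
  next
    case 3
    have "(z$1)\<^sup>2 + (1 + a * b) * z$1 + a * b = 0" using z 3 by (simp add: fibre_cubic_def)
    then obtain y where y: "y \<longlonglongrightarrow> z$1"
      "\<And>k. (y k)\<^sup>2 + (e k * z$3 + 1 + a * b) * y k + ((e k)\<^sup>2 + (a + b) * e k + a * b) = 0"
      using quadratic_root_continuous[OF coeff] by blast
    show thesis
    proof (rule sequence)
      show "fibre_cubic a b (vector [y k, e k, z$3]) = 0" for k
        using y(2)[of k] by (simp add: fibre_cubic_def algebra_simps)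
    qed (use e y 3 in \<open>auto intro: tendsto_imp_eventually_ne\<close>)
  qed
qed

subsection \<open>Chains in the family\<close>

lemma (in laurent_space) curve_connected_image:
  assumes "open T" "connected T" "\<And>i. (\<lambda>t. coord i (\<theta> t)) holomorphic_on T"
  shows "curve_connected (\<theta> ` T)"
  unfolding curve_connected_def using assms by (intro ballI exI[of _ T] exI[of _ \<theta>]) auto

text \<open>The function \<open>coord i - c\<close> separates the two ideals.\<close>

lemma (in laurent_space) vanishing_strict:
  assumes "Z' \<subseteq> X" "vanishing Z \<subseteq> vanishing Z'" "\<And>x. x \<in> Z' \<Longrightarrow> coord i x = c" "y \<in> Z" "y \<in> X" "coord i y \<noteq> c"
  shows "vanishing Z \<subset> vanishing Z'"
proof -
  have "(\<lambda>x\<in>X. coord i x - c) \<in> reg" by (intro regular_diff coord_regular regular_functions.const)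
  moreover have "(\<lambda>x\<in>X. coord i x - c) y \<noteq> 0" using assms(5,6) by simp
  ultimately have "(\<lambda>x\<in>X. coord i x - c) \<in> vanishing Z' - vanishing Z"
    using assms(1,3,4) by (auto simp: vanishing_def subset_iff)
  then show ?thesis using assms(2) by blast
qed

lemma (in laurent_space) vanishing_mono: "Z' \<subseteq> Z \<Longrightarrow> vanishing Z \<subseteq> vanishing Z'"
  by (auto simp: vanishing_def)

text \<open>\<open>A\<close> and \<open>B\<close> switch on the conditions that fix the first and
  the second parameter, so that the whole open part, its slice over a fixed first parameter and the
  open part of one fibre are treated together.\<close>

lemma open_part_slice_connected:
  "family.curve_connected {y \<in> open_part. (A \<longrightarrow> fst (fst y) = a) \<and> (B \<longrightarrow> snd (fst y) = b)}" (is "family.curve_connected ?Z")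
  unfolding family.curve_connected_def
proof (intro ballI)
  fix p q assume pq: "p \<in> ?Z" "q \<in> ?Z"
  obtain a1 b1 x1 a2 b2 x2 where eq: "p = ((a1, b1), x1)" "q = ((a2, b2), x2)" by (metis prod.exhaust)
  have mem: "((a1, b1), x1) \<in> open_part" "((a2, b2), x2) \<in> open_part" using pq by (auto simp: eq)
  obtain T \<theta> where T: "open T" "connected T" "\<theta> ` T \<subseteq> open_part"
    "((a1, b1), x1) \<in> \<theta> ` T" "((a2, b2), x2) \<in> \<theta> ` T"
    "\<And>i. (\<lambda>t. family_coord i (\<theta> t)) holomorphic_on T"
    "\<And>t. a1 = a2 \<Longrightarrow> fst (fst (\<theta> t)) = a1" "\<And>t. b1 = b2 \<Longrightarrow> snd (fst (\<theta> t)) = b1"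
    by (rule open_part_curve[OF mem]) (rule that)
  have "\<theta> ` T \<subseteq> ?Z" using T(3,7,8) pq by (auto simp: eq)
  then show "\<exists>T \<theta>. open T \<and> connected T \<and> \<theta> ` T \<subseteq> ?Z \<and> p \<in> \<theta> ` T \<and> q \<in> \<theta> ` T \<and>
      (\<forall>i. (\<lambda>t. family_coord i (\<theta> t)) holomorphic_on T)"
    using T(1,2,4-6) unfolding eq by blast
qed

text \<open>A flag in the family with four strict steps: the open part, its slice at fixed \<alpha>,
  the open part of the fibre, a curve in the fibre through \<open>z\<close>, and \<open>z\<close>
  itself.\<close>

lemma R_height_lower:
  assumes z: "z \<in> family_ambient" "restrict cubic family_ambient z = 0"
  shows "enat (CARD(bool + 3) - 1) \<le> height R_ring (max_ideal R_ring (R.eval_at z))"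
proof -
  obtain a b x where zeq: "z = ((a, b), x)" by (metis prod.exhaust)
  have ab: "a \<noteq> 0" "b \<noteq> 0" using z(1) by (auto simp: zeq family_ambient_iff)
  have x: "fibre_cubic a b x = 0" using z by (simp add: zeq cubic_eq)
  obtain T \<gamma> where T: "open T" "connected T" "x \<in> \<gamma> ` T" "\<And>i. (\<lambda>t. \<gamma> t $ i) holomorphic_on T"
    "\<And>t. t \<in> T \<Longrightarrow> fibre_cubic a b (\<gamma> t) = 0 \<and> \<gamma> t $ 1 = x $ 1" "\<gamma> ` T \<noteq> {x}"
    using fibre_curve[OF x ab] by metis
  define Z1 where "Z1 = {y \<in> open_part. fst (fst y) = a}"
  define Z2 where "Z2 = {y \<in> open_part. fst (fst y) = a \<and> snd (fst y) = b}"
  define Z3 where "Z3 = (\<lambda>t. ((a, b), \<gamma> t)) ` T"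
  define Z where "Z i = (if i = 0 then open_part else if i = 1 then Z1 else if i = 2 then Z2
    else if i = 3 then Z3 else {z})" for i :: nat
  have mem: "((a', b'), vector [u, v, third_coord a' b' u v]) \<in> open_part"
    if "a' \<noteq> 0" "b' \<noteq> 0" "u \<noteq> 0" "v \<noteq> 0" for a' b' u v using open_part_graph that .
  have cc: "family.curve_connected open_part" "family.curve_connected Z1" "family.curve_connected Z2"
    using open_part_slice_connected[of False a False b] open_part_slice_connected[of True a False b]
      open_part_slice_connected[of True a True b]
    by (simp_all add: Z1_def Z2_def)
  have "(\<lambda>t. family_coord i ((a, b), \<gamma> t)) holomorphic_on T" for i
    by (cases i rule: family_index_cases) (simp_all add: T(4))
  then have cc3: "family.curve_connected Z3"
    unfolding Z3_def by (intro family.curve_connected_image T(1,2))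
  have sub: "open_part \<subseteq> family_ambient" using open_part_subset by auto
  have Z3: "Z3 \<subseteq> {y \<in> family_ambient. restrict cubic family_ambient y = 0}"
    using T(5) ab by (auto simp: Z3_def family_ambient_iff cubic_eq)
  \<comment> \<open>The curve may lie in \<open>x\<^sub>1 x\<^sub>2 = 0\<close>, outside
    \<open>Z2\<close>; its points are limits of points of \<open>Z2\<close>, and regular functions
    are continuous.\<close>
  have van23: "family.vanishing Z2 \<subseteq> family.vanishing Z3"
  proof
    fix f assume f: "f \<in> family.vanishing Z2"
    have "f ((a, b), \<gamma> t) = 0" if t: "t \<in> T" for t
    proof -
      obtain s where s: "\<And>i. (\<lambda>k. s k $ i) \<longlonglongrightarrow> \<gamma> t $ i"
        "\<forall>\<^sub>F k in sequentially. fibre_cubic a b (s k) = 0 \<and> s k $ 1 \<noteq> 0 \<and> s k $ 2 \<noteq> 0"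
        by (rule fibre_dense[OF conjunct1[OF T(5)[OF t]] ab]) (rule that)
      have "(\<lambda>k. f ((a, b), s k)) \<longlonglongrightarrow> f ((a, b), \<gamma> t)"
      proof (rule family.tendsto_regular)
        show "(\<lambda>k. family_coord i ((a, b), s k)) \<longlonglongrightarrow> family_coord i ((a, b), \<gamma> t)" for i
          by (cases i rule: family_index_cases) (simp_all add: s(1))
      qed (use f ab in \<open>auto simp: family.vanishing_def family_ambient_iff\<close>)
      moreover have "\<forall>\<^sub>F k in sequentially. f ((a, b), s k) = 0"
        using s(2) by (rule eventually_mono)
          (use f ab in \<open>auto simp: family.vanishing_def Z2_def open_part_def\<close>)
      then have "(\<lambda>k. f ((a, b), s k)) \<longlonglongrightarrow> 0" by (rule tendsto_eventually)
      ultimately show ?thesis by (rule LIMSEQ_unique)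
    qed
    then show "f \<in> family.vanishing Z3" using f by (auto simp: family.vanishing_def Z3_def)
  qed
  have s01: "family.vanishing open_part \<subset> family.vanishing Z1"
    by (rule family.vanishing_strict[of _ _ "Inl False" a, OF _ family.vanishing_mono _ mem[of "2 * a" b 1 1]])
      (use sub ab mem[of "2 * a" b 1 1] in \<open>auto simp: Z1_def family_coord_eq\<close>)
  have s12: "family.vanishing Z1 \<subset> family.vanishing Z2"
    by (rule family.vanishing_strict[of _ _ "Inl True" b "((a, 2 * b), vector [1, 1, third_coord a (2 * b) 1 1])",
          OF _ family.vanishing_mono])
      (use sub ab mem[of a "2 * b" 1 1] in \<open>auto simp: Z1_def Z2_def family_coord_eq\<close>)
  \<comment> \<open>A value of \<open>x\<^sub>1\<close> that is non-zero, as points of the open part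
    require, and differs from the constant one on the curve.\<close>
  define u where "u = (if x$1 = 0 then 1 else 2 * x$1)"
  have u: "u \<noteq> 0" "u \<noteq> x$1" by (auto simp: u_def)
  have s23: "family.vanishing Z2 \<subset> family.vanishing Z3"
    by (rule family.vanishing_strict[of _ _ "Inr 1" "x$1" "((a, b), vector [u, 1, third_coord a b u 1])",
          OF _ van23])
      (use sub ab u mem[of a b u 1] Z3 T(5) in \<open>auto simp: Z2_def Z3_def\<close>)
  have zZ3: "z \<in> Z3" using T(3) by (auto simp: zeq Z3_def)
  obtain t where t: "t \<in> T" "\<gamma> t \<noteq> x" using T(3,6) by blast
  then obtain i where i: "\<gamma> t $ i \<noteq> x $ i" by (auto simp: vec_eq_iff)
  have s34: "family.vanishing Z3 \<subset> family.vanishing {z}"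
    by (rule family.vanishing_strict[of _ _ "Inr i" "x$i" "((a, b), \<gamma> t)", OF _ family.vanishing_mono])
      (use z zZ3 t i ab in \<open>auto simp: zeq Z3_def family_ambient_iff\<close>)
  have "enat 4 \<le> height R_ring (max_ideal R_ring (R.eval_at z))"
  proof (rule R.height_lower[OF z, of 4 Z])
    fix k :: nat assume "k \<le> 4"
    show "Z k \<subseteq> {x \<in> family_ambient. restrict cubic family_ambient x = 0}"
      using open_part_subset Z3 z by (auto simp: Z_def Z1_def Z2_def)
    have "((a, b), vector [1, 1, third_coord a b 1 1]) \<in> open_part" using mem ab by simp
    then have "open_part \<noteq> {}" "Z1 \<noteq> {}" "Z2 \<noteq> {}" unfolding Z1_def Z2_def by force+
    then show "Z k \<noteq> {}" using zZ3 by (auto simp: Z_def)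
    show "family.curve_connected (Z k)"
      using cc cc3 family.curve_connected_singleton by (simp add: Z_def)
  next
    fix k :: nat assume "k < 4"
    then consider "k = 0" | "k = 1" | "k = 2" | "k = 3" by linarith
    then show "family.vanishing (Z k) \<subset> family.vanishing (Z (Suc k))"
      using s01 s12 s23 s34 by cases (simp_all add: Z_def)
  qed (simp add: Z_def)
  then show ?thesis by simp
qed

section \<open>The fibres\<close>

definition extend :: "(complex^3 \<Rightarrow> complex) \<Rightarrow> (complex \<times> complex) \<times> (complex^3) \<Rightarrow> complex" where
  "extend g = (\<lambda>y\<in>family_ambient. g (snd y))"

lemma extend_regular: "g \<in> affine.reg \<Longrightarrow> extend g \<in> family.reg"
  unfolding extend_def
  by (rule regular_compose) (use regular_coords(5) in \<open>auto simp: affine_generators_def\<close>)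

lemma specialize_regular:
  assumes ab: "a \<noteq> 0" "b \<noteq> 0" and f: "f \<in> family.reg"
  shows "(\<lambda>x. f ((a, b), x)) \<in> affine.reg"
proof -
  have const: "(\<lambda>x. c) \<in> affine.reg" for c using regular_functions.const[of c UNIV] by simp
  have "(\<lambda>x\<in>UNIV. f ((a, b), x)) \<in> affine.reg"
  proof (rule regular_compose[OF f])
    show "((a, b), x) \<in> family_ambient" for x using ab by (simp add: family_ambient_iff)
    show "(\<lambda>x\<in>UNIV. g ((a, b), x)) \<in> affine.reg" if "g \<in> family_generators" for g
      using that const affine.coord_regular by (auto simp: family_generators_def)
  qed
  then show ?thesis by simp
qed

lemma R_alpha_eq: "R_alpha = pullback (\<lambda>y\<in>family_ambient. fst (fst y))"
  unfolding R_alpha_def pullback_def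
  by (rule restrict_ext) (simp add: quotient_map_mem quotient_map_components)

lemma R_beta_eq: "R_beta = pullback (\<lambda>y\<in>family_ambient. snd (fst y))"
  unfolding R_beta_def pullback_def
  by (rule restrict_ext) (simp add: quotient_map_mem quotient_map_components)

lemma R_const_eq: "R_const c = pullback (\<lambda>y\<in>family_ambient. c)"
  unfolding R_const_def pullback_def
  by (rule restrict_ext) (simp add: quotient_map_mem)

lemma R_scalar: "R.scalar = R_const"
  by (simp add: R.scalar_def R_const_eq fun_eq_iff)

definition fibre_map :: "complex \<Rightarrow> complex \<Rightarrow> (complex^3 \<Rightarrow> complex) \<Rightarrow> (data \<Rightarrow> complex) set" where
  "fibre_map a b g = to_fibre a b (pullback (extend g))"

section \<open>The fibre ideal and its preimage in the ring of the family\<close>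

lemma fibre_generators:
  "R_alpha \<ominus>\<^bsub>R_ring\<^esub> R_const a = pullback (\<lambda>y\<in>family_ambient. fst (fst y) - a)"
  "R_beta \<ominus>\<^bsub>R_ring\<^esub> R_const b = pullback (\<lambda>y\<in>family_ambient. snd (fst y) - b)"
  unfolding R_alpha_eq R_beta_eq R_const_eq
  by (subst R.\<pi>_minus; simp add: regular_coords regular_functions.const)+

lemma generators_regular:
  "(\<lambda>y\<in>family_ambient. fst (fst y) - a) \<in> family.reg" "(\<lambda>y\<in>family_ambient. snd (fst y) - b) \<in> family.reg"
  by (intro regular_diff regular_coords regular_functions.const)+

lemma fibre_ideal_eq:
  "fibre_ideal a b = genideal R_ring {pullback (\<lambda>y\<in>family_ambient. fst (fst y) - a),
     pullback (\<lambda>y\<in>family_ambient. snd (fst y) - b)}"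
  by (simp only: fibre_ideal_def fibre_generators)

lemma ideal_fibre_ideal: "ideal (fibre_ideal a b) R_ring"
  unfolding fibre_ideal_eq
  by (rule ring.genideal_ideal[OF cring.axioms(1)[OF cring_R_ring]])
    (use pullback_R_ring generators_regular in blast)

lemma fibre_ideal_generators:
  "pullback (\<lambda>y\<in>family_ambient. fst (fst y) - a) \<in> fibre_ideal a b"
  "pullback (\<lambda>y\<in>family_ambient. snd (fst y) - b) \<in> fibre_ideal a b"
proof -
  have "{pullback (\<lambda>y\<in>family_ambient. fst (fst y) - a), pullback (\<lambda>y\<in>family_ambient. snd (fst y) - b)}
      \<subseteq> fibre_ideal a b"
    unfolding fibre_ideal_eq
    by (rule ring.genideal_self[OF cring.axioms(1)[OF cring_R_ring]])
      (use pullback_R_ring generators_regular in blast)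
  then show "pullback (\<lambda>y\<in>family_ambient. fst (fst y) - a) \<in> fibre_ideal a b"
    "pullback (\<lambda>y\<in>family_ambient. snd (fst y) - b) \<in> fibre_ideal a b" by auto
qed

text \<open>Moving the fibre ideal to the ring over \<open>family_ambient\<close>, where parameters
  and coordinates are independent, makes the substitution of values for the parameters
  available.\<close>

definition fibre_preideal :: "complex \<Rightarrow> complex \<Rightarrow> ((complex \<times> complex) \<times> (complex^3) \<Rightarrow> complex) set" where
  "fibre_preideal a b = {h \<in> carrier family.A. pullback h \<in> fibre_ideal a b}"

lemma ideal_fibre_preideal: "ideal (fibre_preideal a b) family.A"
  unfolding fibre_preideal_def by (rule R.hom.ideal_vimage[OF ideal_fibre_ideal])

text \<open>Modulo the fibre ideal the parameters may be replaced by their values. For inverses,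
  \<open>1 / \<alpha> - 1 / a\<close> is a multiple of \<open>\<alpha> - a\<close>; products follow
  from the Leibniz rule for differences.\<close>

lemma specialize_difference:
  assumes ab: "a \<noteq> 0" "b \<noteq> 0" and "f \<in> family.reg"
  shows "(\<lambda>y\<in>family_ambient. f y - f ((a, b), snd y)) \<in> fibre_preideal a b"
  using assms(3)
proof (induction rule: family.regular_induct)
  note closed = regular_ideal_closed[OF ideal_fibre_preideal[of a b]]
  have mem: "((a, b), x) \<in> family_ambient" for x using ab by (simp add: family_ambient_iff)
  have gens: "(\<lambda>y\<in>family_ambient. fst (fst y) - a) \<in> fibre_preideal a b"
    "(\<lambda>y\<in>family_ambient. snd (fst y) - b) \<in> fibre_preideal a b"
    using fibre_ideal_generators generators_regular by (simp_all add: fibre_preideal_def)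
  have nz: "fst (fst y) \<noteq> 0" "snd (fst y) \<noteq> 0" if "y \<in> family_ambient" for y
    using that by (auto simp: family_ambient_def param_space_def)
  {
    case (const c)
    show ?case using mem closed(1) by simp
  next
    case (coord i)
    show ?case
      using mem closed(1) gens by (cases i rule: family_index_cases) (simp_all add: family_coord_eq)
  next
    case (inverse j)
    have "(\<lambda>y\<in>family_ambient. (1 / fst (fst y) * (- 1 / a)) * (fst (fst y) - a)) \<in> fibre_preideal a b"
      by (rule closed(4)[OF _ gens(1)]) (intro regular_mult regular_coords regular_functions.const)
    then have 1: "(\<lambda>y\<in>family_ambient. 1 / fst (fst y) - 1 / a) \<in> fibre_preideal a b"
      by (rule back_subst[of "\<lambda>u. u \<in> fibre_preideal a b"])
        (rule restrict_ext, use ab nz in \<open>simp add: field_simps\<close>)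
    have "(\<lambda>y\<in>family_ambient. (1 / snd (fst y) * (- 1 / b)) * (snd (fst y) - b)) \<in> fibre_preideal a b"
      by (rule closed(4)[OF _ gens(2)]) (intro regular_mult regular_coords regular_functions.const)
    then have 2: "(\<lambda>y\<in>family_ambient. 1 / snd (fst y) - 1 / b) \<in> fibre_preideal a b"
      by (rule back_subst[of "\<lambda>u. u \<in> fibre_preideal a b"])
        (rule restrict_ext, use ab nz in \<open>simp add: field_simps\<close>)
    show ?case
      using inverse 1 2 mem by (cases j rule: family_index_cases) (auto simp: family_coord_eq)
  next
    case (add f g)
    have "(\<lambda>y\<in>family_ambient. (f y - f ((a, b), snd y)) + (g y - g ((a, b), snd y))) \<in> fibre_preideal a b"
      by (rule closed(3)[OF add(3,4)])
    then show ?case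
      by (rule back_subst[of "\<lambda>u. u \<in> fibre_preideal a b"]) (rule restrict_ext, simp add: mem)
  next
    case (mult f g)
    have f0: "(\<lambda>y\<in>family_ambient. f ((a, b), snd y)) \<in> family.reg"
      using extend_regular[OF specialize_regular[OF ab mult(1)]] by (simp add: extend_def)
    have 1: "(\<lambda>y\<in>family_ambient. g y * (f y - f ((a, b), snd y))) \<in> fibre_preideal a b"
      by (rule closed(4)[OF regular_self[OF mult(2)] mult(3)])
    have 2: "(\<lambda>y\<in>family_ambient. f ((a, b), snd y) * (g y - g ((a, b), snd y))) \<in> fibre_preideal a b"
      by (rule closed(4)[OF f0 mult(4)])
    show ?case
      using closed(3)[OF 1 2]
      by (rule back_subst[of "\<lambda>u. u \<in> fibre_preideal a b"])
        (rule restrict_ext, simp add: mem algebra_simps)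
  }
qed

lemma to_fibre_eq_iff:
  assumes "f \<in> family.reg" "g \<in> family.reg"
  shows "to_fibre a b (pullback f) = to_fibre a b (pullback g)
    \<longleftrightarrow> (\<lambda>y\<in>family_ambient. f y - g y) \<in> fibre_preideal a b"
proof -
  have "to_fibre a b (pullback f) = to_fibre a b (pullback g)
      \<longleftrightarrow> pullback f \<ominus>\<^bsub>R_ring\<^esub> pullback g \<in> fibre_ideal a b"
    unfolding to_fibre_def
    using ring.quotient_eq_iff_same_a_r_cos[OF cring.axioms(1)[OF cring_R_ring] ideal_fibre_ideal
      pullback_R_ring[OF assms(1)] pullback_R_ring[OF assms(2)]] by blast
  then show ?thesis
    using regular_diff[of f family_ambient family_generators g] assms
    by (simp add: R.\<pi>_minus fibre_preideal_def)
qed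

text \<open>The functions whose restriction to the parameters \<open>(a, b)\<close> is a multiple of
  \<open>fibre_cubic a b\<close> form an ideal \<open>N\<close>. It contains both generators of the
  fibre ideal, and also the cubic, so that membership passes from pullbacks back to
  functions.\<close>

lemma fibre_preideal_specialize:
  assumes ab: "a \<noteq> 0" "b \<noteq> 0" and f: "f \<in> fibre_preideal a b"
  shows "\<exists>h\<in>affine.reg. \<forall>x. f ((a, b), x) = h x * fibre_cubic a b x"
proof -
  have mem: "((a, b), x) \<in> family_ambient" for x using ab by (simp add: family_ambient_iff)
  define N where "N = {f \<in> family.reg. \<exists>h\<in>affine.reg. \<forall>x. f ((a, b), x) = h x * fibre_cubic a b x}"
  have N: "ideal N family.A"
  proof (rule idealI)
    show "ring family.A" by (rule cring.axioms(1)[OF cring_coordinate_ring])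
    show "subgroup N (add_monoid family.A)"
    proof (rule subgroup.intro)
      show "N \<subseteq> carrier (add_monoid family.A)" by (auto simp: N_def)
      have "(\<lambda>x\<in>UNIV. 0) \<in> affine.reg" by (rule regular_functions.const)
      then show "\<one>\<^bsub>add_monoid family.A\<^esub> \<in> N"
        using mem by (auto simp: N_def regular_functions.const intro!: bexI[of _ "\<lambda>x. 0"])
      show "f \<otimes>\<^bsub>add_monoid family.A\<^esub> g \<in> N" if fg: "f \<in> N" "g \<in> N" for f g
      proof -
        obtain h k where *: "h \<in> affine.reg" "\<forall>x. f ((a, b), x) = h x * fibre_cubic a b x"
          "k \<in> affine.reg" "\<forall>x. g ((a, b), x) = k x * fibre_cubic a b x" using fg by (auto simp: N_def)
        have "(\<lambda>x\<in>UNIV. h x + k x) \<in> affine.reg" using *(1,3) by (rule regular_functions.add)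
        then show ?thesis using fg * mem
          by (auto simp: N_def distrib_right regular_functions.add intro!: bexI[of _ "\<lambda>x. h x + k x"])
      qed
      show "inv\<^bsub>add_monoid family.A\<^esub> f \<in> N" if f: "f \<in> N" for f
      proof -
        obtain h where *: "h \<in> affine.reg" "\<forall>x. f ((a, b), x) = h x * fibre_cubic a b x"
          using f by (auto simp: N_def)
        have "(\<lambda>x\<in>UNIV. - h x) \<in> affine.reg" using *(1) by (intro regular_intros)
        moreover have "(\<lambda>y\<in>family_ambient. - f y) \<in> family.reg"
          using f by (intro regular_intros) (auto simp: N_def)
        moreover have "inv\<^bsub>add_monoid family.A\<^esub> f = (\<lambda>y\<in>family_ambient. - f y)"
          unfolding a_inv_def[symmetric] by (rule coordinate_ring_a_inv) (use f in \<open>simp add: N_def\<close>)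
        ultimately show ?thesis using * mem
          by (auto simp: N_def intro!: bexI[of _ "\<lambda>x. - h x"])
      qed
    qed
  next
    fix f k assume f: "f \<in> N" and k: "k \<in> carrier family.A"
    obtain h where *: "h \<in> affine.reg" "\<forall>x. f ((a, b), x) = h x * fibre_cubic a b x"
      using f by (auto simp: N_def)
    have k0: "(\<lambda>x. k ((a, b), x)) \<in> affine.reg" using specialize_regular[OF ab] k by simp
    have "(\<lambda>x\<in>UNIV. k ((a, b), x) * h x) \<in> affine.reg" by (rule regular_functions.mult[OF k0 *(1)])
    then show "k \<otimes>\<^bsub>family.A\<^esub> f \<in> N" "f \<otimes>\<^bsub>family.A\<^esub> k \<in> N" using f k * mem
      by (auto simp: N_def regular_functions.mult mult_ac intro!: bexI[of _ "\<lambda>x. k ((a, b), x) * h x"])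
  qed
  have zero: "(\<lambda>x. 0) \<in> affine.reg" using regular_functions.const[of 0 UNIV] by simp
  have "(\<lambda>y\<in>family_ambient. fst (fst y) - a) \<in> N" "(\<lambda>y\<in>family_ambient. snd (fst y) - b) \<in> N"
    unfolding N_def using mem generators_regular zero by (auto intro!: bexI[of _ "\<lambda>x. 0"])
  then have "fibre_ideal a b \<subseteq> pullback ` N"
    unfolding fibre_ideal_eq
    by (intro ring.genideal_minimal[OF cring.axioms(1)[OF cring_R_ring] R.ideal_image[OF N]]) auto
  then have "pullback f \<in> pullback ` N" using f by (auto simp: fibre_preideal_def)
  moreover have "restrict cubic family_ambient \<in> N"
  proof -
    have "(\<lambda>x. 1) \<in> affine.reg" using regular_functions.const[of 1 UNIV] by simp
    then show ?thesis unfolding N_def using cubic_regular mem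
      by (auto simp: cubic_eq intro!: bexI[of _ "\<lambda>x. 1"])
  qed
  ultimately have "f \<in> N"
    using R.preimage_image[OF N] f by (simp add: fibre_preideal_def)
  then show ?thesis by (simp add: N_def)
qed

lemma extend_hom: "extend \<in> ring_hom affine.A family.A"
proof (rule ring_hom_memI)
  show "extend f \<in> carrier family.A" if "f \<in> carrier affine.A" for f
    using extend_regular that by simp
qed (simp_all add: extend_def)

text \<open>Surjectivity holds because every invariant is congruent to one that does not involve the
  parameters; the kernel is found by comparing the fibre ideal with specialization in both
  directions.\<close>

lemma fibre_hypersurface:
  assumes ab: "a \<noteq> 0" "b \<noteq> 0"
  shows "hypersurface (\<lambda>i (z::complex^3). z $ i) (\<lambda>u. \<chi> i. u i) {} UNIV affine_generators
    (fibre_ring a b) (fibre_map a b) (fibre_cubic a b) (fibre_gradient a b)"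
proof (intro hypersurface.intro hypersurface_axioms.intro)
  show "laurent_space (\<lambda>i (z::complex^3). z $ i) (\<lambda>u. \<chi> i. u i) {} UNIV affine_generators"
    by (rule affine.laurent_space_axioms)
  show "cring (fibre_ring a b)"
    unfolding fibre_ring_def by (rule ideal.quotient_is_cring[OF ideal_fibre_ideal cring_R_ring])
  have "to_fibre a b \<in> ring_hom R_ring (fibre_ring a b)"
    using ideal.rcos_ring_hom[OF ideal_fibre_ideal] unfolding fibre_ring_def to_fibre_def[abs_def] .
  from ring_hom_trans[OF ring_hom_trans[OF extend_hom pullback_hom] this]
  show "fibre_map a b \<in> ring_hom affine.A (fibre_ring a b)"
    by (simp add: fibre_map_def[abs_def] comp_def)
  show "fibre_map a b ` affine.reg = carrier (fibre_ring a b)"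
  proof
    show "fibre_map a b ` affine.reg \<subseteq> carrier (fibre_ring a b)"
      using ring_hom_closed[OF \<open>fibre_map a b \<in> ring_hom affine.A (fibre_ring a b)\<close>] by auto
    show "carrier (fibre_ring a b) \<subseteq> fibre_map a b ` affine.reg"
    proof
      fix c assume "c \<in> carrier (fibre_ring a b)"
      then obtain r where "r \<in> carrier R_ring" "c = to_fibre a b r"
        unfolding fibre_ring_def FactRing_def A_RCOSETS_def' to_fibre_def by auto
      then obtain f where f: "f \<in> family.reg" "c = to_fibre a b (pullback f)"
        using invariant_is_pullback by blast
      have s: "(\<lambda>x. f ((a, b), x)) \<in> affine.reg" by (rule specialize_regular[OF ab f(1)])
      have "(\<lambda>y\<in>family_ambient. f y - extend (\<lambda>x. f ((a, b), x)) y) \<in> fibre_preideal a b"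
        using specialize_difference[OF ab f(1)] by (simp add: extend_def)
      then have "c = fibre_map a b (\<lambda>x. f ((a, b), x))"
        using to_fibre_eq_iff[OF f(1) extend_regular[OF s]] f(2) by (simp add: fibre_map_def)
      then show "c \<in> fibre_map a b ` affine.reg" using s by blast
    qed
  qed
  show "fibre_cubic a b \<in> affine.reg" by (rule fibre_cubic_regular)
  show "fibre_map a b f = \<zero>\<^bsub>fibre_ring a b\<^esub> \<longleftrightarrow> (\<exists>g\<in>affine.reg. \<forall>x\<in>UNIV. f x = g x * fibre_cubic a b x)"
    if f: "f \<in> affine.reg" for f
  proof -
    have "pullback (\<lambda>y\<in>family_ambient. 0) = \<zero>\<^bsub>R_ring\<^esub>"
      unfolding pullback_def R_ring_simps by (rule restrict_ext) (simp add: quotient_map_mem)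
    moreover have "to_fibre a b \<zero>\<^bsub>R_ring\<^esub> = \<zero>\<^bsub>fibre_ring a b\<^esub>"
      by (rule ring_hom_zero[OF \<open>to_fibre a b \<in> _\<close> cring.axioms(1)[OF cring_R_ring]
        cring.axioms(1)[OF \<open>cring (fibre_ring a b)\<close>]])
    ultimately have zero: "\<zero>\<^bsub>fibre_ring a b\<^esub> = to_fibre a b (pullback (\<lambda>y\<in>family_ambient. 0))"
      by simp
    have ext: "extend f \<in> family.reg" by (rule extend_regular[OF f])
    have "fibre_map a b f = \<zero>\<^bsub>fibre_ring a b\<^esub> \<longleftrightarrow> extend f \<in> fibre_preideal a b"
      unfolding fibre_map_def zero to_fibre_eq_iff[OF ext regular_functions.const]
      using ext by (simp add: extend_def)
    also have "\<dots> \<longleftrightarrow> (\<exists>g\<in>affine.reg. \<forall>x\<in>UNIV. f x = g x * fibre_cubic a b x)"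
    proof
      assume "extend f \<in> fibre_preideal a b"
      from fibre_preideal_specialize[OF ab this]
      show "\<exists>g\<in>affine.reg. \<forall>x\<in>UNIV. f x = g x * fibre_cubic a b x"
        using ab by (simp add: extend_def family_ambient_iff)
    next
      assume "\<exists>g\<in>affine.reg. \<forall>x\<in>UNIV. f x = g x * fibre_cubic a b x"
      then obtain g where g: "g \<in> affine.reg" "\<And>x. f x = g x * fibre_cubic a b x" by blast
      note closed = regular_ideal_closed[OF ideal_fibre_preideal[of a b]]
      have "restrict cubic family_ambient \<in> fibre_preideal a b"
      proof -
        have "pullback (restrict cubic family_ambient) = \<zero>\<^bsub>R_ring\<^esub>" by (rule R.\<pi>_F)
        then show ?thesis
          using additive_subgroup.zero_closed[OF ideal.axioms(1)[OF ideal_fibre_ideal]] cubic_regular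
          by (simp add: fibre_preideal_def)
      qed
      \<comment> \<open>The cubic and its difference from the specialized cubic lie in the ideal,
        hence so does the specialized cubic.\<close>
      from closed(5)[OF _ specialize_difference[OF ab cubic_regular], of cubic, OF this]
      have "(\<lambda>y\<in>family_ambient. fibre_cubic a b (snd y)) \<in> fibre_preideal a b"
        by (rule back_subst[of "\<lambda>u. u \<in> fibre_preideal a b"])
          (rule restrict_ext, use ab in \<open>simp add: family_ambient_iff cubic_eq\<close>)
      from closed(4)[OF _ this, of "extend g"] extend_regular[OF g(1)]
      have "(\<lambda>y\<in>family_ambient. extend g y * fibre_cubic a b (snd y)) \<in> fibre_preideal a b" by simp
      moreover have "extend f = (\<lambda>y\<in>family_ambient. extend g y * fibre_cubic a b (snd y))"
        unfolding extend_def by (rule restrict_ext) (simp add: g(2))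
      ultimately show "extend f \<in> fibre_preideal a b" by simp
    qed
    finally show ?thesis .
  qed
  show "g = (\<lambda>x\<in>UNIV. 0)" if "g \<in> affine.reg" "\<And>x. x \<in> UNIV \<Longrightarrow> fibre_cubic a b x * g x = 0" for g
    using fibre_cubic_nonzerodivisor[OF that(1)] that(2) by blast
  show "((\<lambda>t. fibre_cubic a b (\<chi> i. z $ i + t * v i)) has_field_derivative
      (\<Sum>i\<in>UNIV. fibre_gradient a b i z * v i)) (at 0)" for z v
    by (rule fibre_cubic_derivative)
qed

text \<open>A flag of length 2 in the fibre: its open part, a curve, the point.\<close>

lemma fibre_height_lower:
  assumes ab: "a \<noteq> 0" "b \<noteq> 0" and z: "fibre_cubic a b z = 0"
  shows "enat (CARD(3) - 1) \<le> height (fibre_ring a b)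
    (max_ideal (fibre_ring a b) (hypersurface.eval_at UNIV affine_generators (fibre_ring a b) (fibre_map a b) z))"
proof -
  interpret Fib: hypersurface "\<lambda>i (z::complex^3). z $ i" "\<lambda>u. \<chi> i. u i" "{}" UNIV affine_generators
    "fibre_ring a b" "fibre_map a b" "fibre_cubic a b" "fibre_gradient a b"
    by (rule fibre_hypersurface[OF ab])
  obtain T \<gamma> where T: "open T" "connected T" "z \<in> \<gamma> ` T" "\<And>i. (\<lambda>t. \<gamma> t $ i) holomorphic_on T"
    "\<And>t. t \<in> T \<Longrightarrow> fibre_cubic a b (\<gamma> t) = 0 \<and> \<gamma> t $ 1 = z $ 1" "\<gamma> ` T \<noteq> {z}"
    using fibre_curve[OF z ab] by metis
  define Z0 where "Z0 = {x. ((a, b), x) \<in> open_part}"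
  define Z where "Z i = (if i = 0 then Z0 else if i = 1 then \<gamma> ` T else {z})" for i :: nat
  have mem: "vector [u, v, third_coord a b u v] \<in> Z0" if "u \<noteq> 0" "v \<noteq> 0" for u v
    using open_part_graph[OF ab that] by (simp add: Z0_def)
  have cc0: "affine.curve_connected Z0"
    unfolding affine.curve_connected_def
  proof (intro ballI)
    fix p q assume "p \<in> Z0" "q \<in> Z0"
    then have pq: "((a, b), p) \<in> open_part" "((a, b), q) \<in> open_part" by (auto simp: Z0_def)
    obtain T \<theta> where T: "open T" "connected T" "\<theta> ` T \<subseteq> open_part" "((a, b), p) \<in> \<theta> ` T" "((a, b), q) \<in> \<theta> ` T"
      "\<And>i. (\<lambda>t. family_coord i (\<theta> t)) holomorphic_on T" "\<And>t. fst (fst (\<theta> t)) = a" "\<And>t. snd (fst (\<theta> t)) = b"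
      using open_part_curve[OF pq] by metis
    have \<theta>: "\<theta> t = ((a, b), snd (\<theta> t))" for t using T(7,8)[of t] by (metis prod.collapse)
    show "\<exists>T \<theta>. open T \<and> connected T \<and> \<theta> ` T \<subseteq> Z0 \<and> p \<in> \<theta> ` T \<and> q \<in> \<theta> ` T \<and>
        (\<forall>i. (\<lambda>t. \<theta> t $ i) holomorphic_on T)"
    proof (intro exI[of _ T] exI[of _ "\<lambda>t. snd (\<theta> t)"] conjI allI)
      show "(\<lambda>t. snd (\<theta> t)) ` T \<subseteq> Z0" using T(3) \<theta> by (force simp: Z0_def)
      show "p \<in> (\<lambda>t. snd (\<theta> t)) ` T" using imageI[OF T(4), of snd] by (simp add: image_image)
      show "q \<in> (\<lambda>t. snd (\<theta> t)) ` T" using imageI[OF T(5), of snd] by (simp add: image_image)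
      show "(\<lambda>t. snd (\<theta> t) $ i) holomorphic_on T" for i
        using T(6)[of "Inr i"] by (simp add: family_coord_eq)
    qed (rule T)+
  qed
  have van01: "affine.vanishing Z0 \<subseteq> affine.vanishing (\<gamma> ` T)"
  proof
    fix f assume f: "f \<in> affine.vanishing Z0"
    have "f (\<gamma> t) = 0" if t: "t \<in> T" for t
    proof -
      obtain s where s: "\<And>i. (\<lambda>k. s k $ i) \<longlonglongrightarrow> \<gamma> t $ i"
        "\<forall>\<^sub>F k in sequentially. fibre_cubic a b (s k) = 0 \<and> s k $ 1 \<noteq> 0 \<and> s k $ 2 \<noteq> 0"
        by (rule fibre_dense[OF conjunct1[OF T(5)[OF t]] ab]) (rule that)
      have "(\<lambda>k. f (s k)) \<longlonglongrightarrow> f (\<gamma> t)"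
        by (rule affine.tendsto_regular) (use f s(1) in \<open>auto simp: affine.vanishing_def\<close>)
      moreover have "\<forall>\<^sub>F k in sequentially. f (s k) = 0"
        using s(2) by (rule eventually_mono)
          (use f ab in \<open>auto simp: affine.vanishing_def Z0_def open_part_def\<close>)
      then have "(\<lambda>k. f (s k)) \<longlonglongrightarrow> 0" by (rule tendsto_eventually)
      ultimately show ?thesis by (rule LIMSEQ_unique)
    qed
    then show "f \<in> affine.vanishing (\<gamma> ` T)" using f by (auto simp: affine.vanishing_def)
  qed
  define u where "u = (if z$1 = 0 then 1 else 2 * z$1)"
  have u: "u \<noteq> 0" "u \<noteq> z$1" by (auto simp: u_def)
  have s01: "affine.vanishing Z0 \<subset> affine.vanishing (\<gamma> ` T)"
    by (rule affine.vanishing_strict[of _ _ 1 "z$1" "vector [u, 1, third_coord a b u 1]", OF _ van01])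
      (use u mem[of u 1] T(5) in auto)
  obtain t where t: "t \<in> T" "\<gamma> t \<noteq> z" using T(3,6) by blast
  then obtain i where i: "\<gamma> t $ i \<noteq> z $ i" by (auto simp: vec_eq_iff)
  have s12: "affine.vanishing (\<gamma> ` T) \<subset> affine.vanishing {z}"
    by (rule affine.vanishing_strict[of _ _ i "z$i" "\<gamma> t", OF _ affine.vanishing_mono])
      (use T(3) t i in auto)
  have "enat 2 \<le> height (fibre_ring a b) (max_ideal (fibre_ring a b) (Fib.eval_at z))"
  proof (rule Fib.height_lower[OF UNIV_I z, of 2 Z])
    fix k :: nat assume "k \<le> 2"
    show "Z k \<subseteq> {x \<in> UNIV. fibre_cubic a b x = 0}"
      using T(5) z by (auto simp: Z_def Z0_def open_part_def)
    have "Z0 \<noteq> {}" using mem[of 1 1] by auto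
    then show "Z k \<noteq> {}" using T(3) by (auto simp: Z_def)
    show "affine.curve_connected (Z k)"
      using cc0 affine.curve_connected_image[OF T(1,2,4)] affine.curve_connected_singleton
      by (simp add: Z_def)
  next
    fix k :: nat assume "k < 2"
    then consider "k = 0" | "k = 1" by linarith
    then show "affine.vanishing (Z k) \<subset> affine.vanishing (Z (Suc k))"
      using s01 s12 by cases (simp_all add: Z_def)
  qed (simp add: Z_def)
  then show ?thesis by simp
qed

section \<open>The singular points\<close>

text \<open>The derivative in \<open>x\<^sub>3\<close> gives \<open>x\<^sub>1 x\<^sub>2 = 0\<close>.
  On \<open>x\<^sub>1 = 0\<close> the equation is a quadratic in \<open>x\<^sub>2\<close> that must
  have a double root, with discriminant \<open>(a - b)\<^sup>2\<close>; on
  \<open>x\<^sub>2 = 0\<close> the discriminant is \<open>(a b - 1)\<^sup>2\<close>.\<close>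

lemma fibre_singular_iff:
  assumes ab: "a \<noteq> 0" "b \<noteq> 0"
  shows "fibre_cubic a b x = 0 \<and> (\<forall>i. fibre_gradient a b i x = 0) \<longleftrightarrow>
    a = b \<and> x = vector [0, - a, a + 1 / a] \<or> b = 1 / a \<and> x = vector [- 1, 0, a + 1 / a]"
proof
  assume *: "fibre_cubic a b x = 0 \<and> (\<forall>i. fibre_gradient a b i x = 0)"
  then have F: "fibre_cubic a b x = 0" and g: "x$2 * x$3 + 2 * x$1 + 1 + a * b = 0"
    "x$1 * x$3 + 2 * x$2 + a + b = 0" "x$1 * x$2 = 0"
    using allE[OF conjunct2[OF *], of 1] allE[OF conjunct2[OF *], of 2] allE[OF conjunct2[OF *], of 3]
    by (auto simp: fibre_gradient_def)
  consider "x$1 = 0" | "x$2 = 0" using g(3) by auto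
  then show "a = b \<and> x = vector [0, - a, a + 1 / a] \<or> b = 1 / a \<and> x = vector [- 1, 0, a + 1 / a]"
  proof cases
    case 1
    have x2: "x$2 = - (a + b) / 2" using g(2) 1 by (simp add: field_simps eq_neg_iff_add_eq_0)
    have "(a - b)\<^sup>2 = - 4 * ((x$2)\<^sup>2 + (a + b) * x$2 + a * b)"
      unfolding x2 by (simp add: field_simps power2_eq_square)
    also have "(x$2)\<^sup>2 + (a + b) * x$2 + a * b = 0" using F 1 by (simp add: fibre_cubic_def)
    finally have "a = b" by simp
    then have x2: "x$2 = - a" using x2 by simp
    have "x$3 = a + 1 / a" using g(1) 1 ab unfolding x2 \<open>a = b\<close>[symmetric]
      by (simp add: field_simps)
    then show ?thesis using 1 x2 \<open>a = b\<close> by (simp add: vec_eq_iff forall_3)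
  next
    case 2
    have x1: "x$1 = - (1 + a * b) / 2" using g(1) 2 by (simp add: field_simps eq_neg_iff_add_eq_0)
    have "(a * b - 1)\<^sup>2 = - 4 * ((x$1)\<^sup>2 + (1 + a * b) * x$1 + a * b)"
      unfolding x1 by (simp add: field_simps power2_eq_square)
    also have "(x$1)\<^sup>2 + (1 + a * b) * x$1 + a * b = 0" using F 2 by (simp add: fibre_cubic_def)
    finally have ab1: "a * b = 1" by simp
    then have b: "b = 1 / a" using ab by (simp add: field_simps)
    have x1: "x$1 = - 1" using x1 ab1 by simp
    have "x$3 = a + b" using g(2) 2 unfolding x1 by (simp add: algebra_simps)
    then show ?thesis using 2 x1 b by (simp add: vec_eq_iff forall_3)
  qed
next
  assume "a = b \<and> x = vector [0, - a, a + 1 / a] \<or> b = 1 / a \<and> x = vector [- 1, 0, a + 1 / a]"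
  then show "fibre_cubic a b x = 0 \<and> (\<forall>i. fibre_gradient a b i x = 0)"
    using ab by (auto simp: fibre_cubic_def fibre_gradient_def field_simps power2_eq_square)
qed

lemma singular_curves_iff:
  "((a, b), x) \<in> singular_curve_1 \<union> singular_curve_2 \<longleftrightarrow>
    a \<noteq> 0 \<and> b \<noteq> 0 \<and> fibre_cubic a b x = 0 \<and> (\<forall>i. fibre_gradient a b i x = 0)"
proof (cases "a \<noteq> 0 \<and> b \<noteq> 0")
  case True
  then show ?thesis
    using fibre_singular_iff[of a b x] by (auto simp: singular_curve_1_def singular_curve_2_def)
next
  case False
  then show ?thesis by (auto simp: singular_curve_1_def singular_curve_2_def)
qed

text \<open>The derivatives \<open>b x\<^sub>1 + x\<^sub>2 + b\<close> and
  \<open>a x\<^sub>1 + x\<^sub>2 + a\<close> in the parameters vanish on both curves, so the total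
  space is singular wherever a fibre is.\<close>

lemma family_singular_iff:
  "z \<in> family_ambient \<and> restrict cubic family_ambient z = 0 \<and> (\<forall>i. family_gradient i z = 0)
    \<longleftrightarrow> z \<in> singular_curve_1 \<union> singular_curve_2"
proof -
  obtain a b x where z: "z = ((a, b), x)" by (metis prod.exhaust)
  have "(\<forall>i. family_gradient i z = 0) \<longleftrightarrow> family_gradient (Inl False) z = 0 \<and>
      family_gradient (Inl True) z = 0 \<and> (\<forall>i. fibre_gradient a b i x = 0)"
    by (metis family_gradient.simps(3) family_index_cases z)
  moreover have "family_gradient (Inl False) z = 0 \<and> family_gradient (Inl True) z = 0"
    if ab: "a \<noteq> 0" "b \<noteq> 0" and sing: "fibre_cubic a b x = 0" "\<forall>i. fibre_gradient a b i x = 0"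
  proof -
    consider "a = b" "x = vector [0, - a, a + 1 / a]" | "b = 1 / a" "x = vector [- 1, 0, a + 1 / a]"
      using fibre_singular_iff[OF ab, of x] sing by blast
    then show ?thesis using ab(1) by cases (simp_all add: z)
  qed
  ultimately show ?thesis
    unfolding z singular_curves_iff by (auto simp: family_ambient_iff cubic_eq)
qed

subsection \<open>Ordinary double points\<close>

lemma holomorphic_on_vec_const: "open U \<Longrightarrow> holomorphic_on_vec (\<lambda>z. c) U"
  unfolding holomorphic_on_vec_def by (auto intro!: exI[of _ "\<lambda>_. 0"])

lemma holomorphic_on_vec_coord: "open U \<Longrightarrow> holomorphic_on_vec (\<lambda>z. z $ i) U"
  unfolding holomorphic_on_vec_def
  by (auto intro!: exI[of _ "\<lambda>v. v $ i"] bounded_linear_imp_has_derivative bounded_linear_vec_nth)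

lemma holomorphic_on_vec_add:
  assumes "holomorphic_on_vec f U" "holomorphic_on_vec g U"
  shows "holomorphic_on_vec (\<lambda>z. f z + g z) U"
  unfolding holomorphic_on_vec_def
proof (intro conjI ballI)
  show "open U" using assms by (simp add: holomorphic_on_vec_def)
  fix z assume "z \<in> U"
  then obtain D E where "(f has_derivative D) (at z)" "\<forall>c v. D (c *s v) = c * D v"
    "(g has_derivative E) (at z)" "\<forall>c v. E (c *s v) = c * E v"
    using assms unfolding holomorphic_on_vec_def by meson
  then show "\<exists>D. ((\<lambda>z. f z + g z) has_derivative D) (at z) \<and> (\<forall>c v. D (c *s v) = c * D v)"
    by (intro exI[of _ "\<lambda>v. D v + E v"]) (auto intro: has_derivative_add simp: distrib_left)
qed

lemma holomorphic_on_vec_mult: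
  assumes "holomorphic_on_vec f U" "holomorphic_on_vec g U"
  shows "holomorphic_on_vec (\<lambda>z. f z * g z) U"
  unfolding holomorphic_on_vec_def
proof (intro conjI ballI)
  show "open U" using assms by (simp add: holomorphic_on_vec_def)
  fix z assume "z \<in> U"
  then obtain D E where "(f has_derivative D) (at z)" "\<forall>c v. D (c *s v) = c * D v"
    "(g has_derivative E) (at z)" "\<forall>c v. E (c *s v) = c * E v"
    using assms unfolding holomorphic_on_vec_def by meson
  note DE = this
  have "((\<lambda>z. f z * g z) has_derivative (\<lambda>v. f z * E v + D v * g z)) (at z)"
    by (rule has_derivative_mult[OF DE(1,3)])
  moreover have "\<forall>c v. f z * E (c *s v) + D (c *s v) * g z = c * (f z * E v + D v * g z)"
    using DE(2,4) by (simp add: algebra_simps)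
  ultimately show "\<exists>D. ((\<lambda>z. f z * g z) has_derivative D) (at z) \<and> (\<forall>c v. D (c *s v) = c * D v)"
    by blast
qed

lemma holomorphic_on_vec_inverse:
  assumes "holomorphic_on_vec f U" "\<And>z. z \<in> U \<Longrightarrow> f z \<noteq> 0"
  shows "holomorphic_on_vec (\<lambda>z. inverse (f z)) U"
  unfolding holomorphic_on_vec_def
proof (intro conjI ballI)
  show "open U" using assms by (simp add: holomorphic_on_vec_def)
  fix z assume z: "z \<in> U"
  then obtain D where "(f has_derivative D) (at z)" "\<forall>c v. D (c *s v) = c * D v"
    using assms(1) unfolding holomorphic_on_vec_def by meson
  then show "\<exists>D. ((\<lambda>z. inverse (f z)) has_derivative D) (at z) \<and> (\<forall>c v. D (c *s v) = c * D v)"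
    using assms(2)[OF z]
    by (intro exI[of _ "\<lambda>v. - (inverse (f z) * D v * inverse (f z))"])
      (auto intro: has_derivative_inverse)
qed

lemma holomorphic_on_vec_diff:
  assumes "holomorphic_on_vec f U" "holomorphic_on_vec g U"
  shows "holomorphic_on_vec (\<lambda>z. f z - g z) U"
proof -
  have "open U" using assms by (simp add: holomorphic_on_vec_def)
  from holomorphic_on_vec_add[OF assms(1) holomorphic_on_vec_mult[OF holomorphic_on_vec_const[OF this, of "-1"] assms(2)]]
  show ?thesis by simp
qed

lemma holomorphic_on_vec_divide:
  assumes "holomorphic_on_vec f U" "holomorphic_on_vec g U" "\<And>z. z \<in> U \<Longrightarrow> g z \<noteq> 0"
  shows "holomorphic_on_vec (\<lambda>z. f z / g z) U"
  using holomorphic_on_vec_mult[OF assms(1) holomorphic_on_vec_inverse[OF assms(2,3)]]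
  by (simp add: divide_inverse)

lemmas holomorphic_on_vec_intros = holomorphic_on_vec_const holomorphic_on_vec_coord
  holomorphic_on_vec_add holomorphic_on_vec_diff holomorphic_on_vec_mult holomorphic_on_vec_divide

lemma regular_holomorphic: "f \<in> affine.reg \<Longrightarrow> holomorphic_on_vec f UNIV"
proof (induction rule: affine.regular_induct)
  case (const c)
  show ?case by (simp add: holomorphic_on_vec_const)
next
  case (coord i)
  show ?case by (simp add: holomorphic_on_vec_coord)
next
  case (add f g)
  then show ?case by (simp add: holomorphic_on_vec_add)
next
  case (mult f g)
  then show ?case by (simp add: holomorphic_on_vec_mult)
qed simp

text \<open>
  Near both kinds of singular points the equation has the form \<open>y\<^sup>2 + x B = 0\<close> with \<open>B\<close> linear in
  \<open>x\<^sub>3\<close>, so that \<open>x\<close>, \<open>y\<close>, \<open>B\<close> are coordinates; moreover \<open>4 x B = (x + B)\<^sup>2 - (x - B)\<^sup>2\<close>.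
\<close>
lemma node_coordinates:
  fixes j k :: 3 and e c :: complex and q :: "complex^3"
  assumes jk: "j \<noteq> k" "j \<noteq> 3" "k \<noteq> 3" and e: "e \<noteq> 0" and q: "q $ j = - e" "q $ k = 0" "q $ 3 = c"
  obtains w U where "analytic_coordinates w U q"
    "\<And>z. (w z $ 1)\<^sup>2 + (w z $ 2)\<^sup>2 + (w z $ 3)\<^sup>2
      = (z $ j + e)\<^sup>2 + z $ k * (z $ k + c * (z $ j + e) + z $ j * (z $ 3 - c))"
proof -
  have all: "i = j \<or> i = k \<or> i = 3" for i
    using jk exhaust_3[of i] exhaust_3[of j] exhaust_3[of k] by auto
  define B where "B z = z $ k + c * (z $ j + e) + z $ j * (z $ 3 - c)" for z :: "complex^3"
  define w :: "complex^3 \<Rightarrow> complex^3" where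
    "w z = vector [z $ j + e, (z $ k + B z) / 2, \<i> * (z $ k - B z) / 2]" for z
  \<comment> \<open>\<open>v $ 2 + \<i> * v $ 3\<close> recovers \<open>B\<close> and
    \<open>v $ 2 - \<i> * v $ 3\<close> recovers \<open>z $ k\<close>; the definition of
    \<open>B\<close> is then solved for \<open>z $ 3\<close>, dividing by
    \<open>z $ j = v $ 1 - e\<close>.\<close>
  define w' :: "complex^3 \<Rightarrow> complex^3" where
    "w' v = (\<chi> i. if i = j then v $ 1 - e else if i = k then v $ 2 - \<i> * v $ 3
      else c + (v $ 2 + \<i> * v $ 3 - (v $ 2 - \<i> * v $ 3) - c * v $ 1) / (v $ 1 - e))" for v
  define U where "U = {z :: complex^3. z $ j \<noteq> 0}"
  define V where "V = {v :: complex^3. v $ 1 \<noteq> e}"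
  have w'_comp: "w' v $ j = v $ 1 - e" "w' v $ k = v $ 2 - \<i> * v $ 3"
    "w' v $ 3 = c + (v $ 2 + \<i> * v $ 3 - (v $ 2 - \<i> * v $ 3) - c * v $ 1) / (v $ 1 - e)" for v
    using jk by (simp_all add: w'_def)
  have openU: "open U" unfolding U_def by (intro open_Collect_neq continuous_intros)
  have openV: "open V" unfolding V_def by (intro open_Collect_neq continuous_intros)
  have ii: "\<i> * (\<i> * x) = - x" for x by (simp flip: mult.assoc)
  have left: "w' (w z) = z" if "z \<in> U" for z
  proof -
    have zj: "z $ j \<noteq> 0" using that by (simp add: U_def)
    have p: "w z $ 2 + \<i> * w z $ 3 = B z" "w z $ 2 - \<i> * w z $ 3 = z $ k"
      by (simp_all add: w_def ii field_simps)
    have "w' (w z) $ i = z $ i" for i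
      using all[of i]
    proof (elim disjE)
      assume "i = 3"
      have "w' (w z) $ 3 = c + (B z - z $ k - c * (z $ j + e)) / z $ j"
        unfolding w'_comp p by (simp add: w_def)
      also have "\<dots> = z $ 3" using zj by (simp add: B_def)
      finally show ?thesis using \<open>i = 3\<close> by simp
    qed (simp_all add: w'_comp p, simp add: w_def)
    then show ?thesis by (simp add: vec_eq_iff)
  qed
  have right: "w (w' v) = v" "w' v \<in> U" if "v \<in> V" for v
  proof -
    have ve: "v $ 1 - e \<noteq> 0" using that by (simp add: V_def)
    then show "w' v \<in> U" by (simp add: U_def w'_comp)
    have B: "B (w' v) = v $ 2 + \<i> * v $ 3"
      using ve unfolding B_def w'_comp by simp
    show "w (w' v) = v"
      unfolding w_def B w'_comp by (simp add: vec_eq_iff forall_3 ii field_simps)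
  qed
  have "analytic_coordinates w U q"
    unfolding analytic_coordinates_def
  proof (intro conjI allI exI[of _ V] exI[of _ w'] ballI)
    show "q \<in> U" using q e by (simp add: U_def)
    show "w q = 0" using q by (simp add: w_def B_def vec_eq_iff forall_3)
    show "holomorphic_on_vec (\<lambda>z. w z $ i) U" for i
    proof -
      have B: "holomorphic_on_vec B U"
        unfolding B_def by (intro holomorphic_on_vec_intros openU)
      have "holomorphic_on_vec (\<lambda>z. z $ j + e) U" "holomorphic_on_vec (\<lambda>z. (z $ k + B z) / 2) U"
        "holomorphic_on_vec (\<lambda>z. \<i> * (z $ k - B z) / 2) U"
        by (intro holomorphic_on_vec_intros B openU; simp)+
      then show ?thesis using exhaust_3[of i] by (auto simp: w_def)
    qed
    show "w ` U = V"
    proof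
      show "w ` U \<subseteq> V" by (auto simp: U_def V_def w_def)
      show "V \<subseteq> w ` U" using right by (metis image_iff subsetI)
    qed
    show "holomorphic_on_vec (\<lambda>z. w' z $ i) V" for i
    proof -
      have "holomorphic_on_vec (\<lambda>v. v $ 1 - e) V" "holomorphic_on_vec (\<lambda>v. v $ 2 - \<i> * v $ 3) V"
        by (intro holomorphic_on_vec_intros openV)+
      moreover have "holomorphic_on_vec
          (\<lambda>v. c + (v $ 2 + \<i> * v $ 3 - (v $ 2 - \<i> * v $ 3) - c * v $ 1) / (v $ 1 - e)) V"
        by (intro holomorphic_on_vec_intros openV) (simp add: V_def)
      ultimately show ?thesis using all[of i] by (auto simp: w'_comp)
    qed
  qed (use openU openV left in auto)
  moreover have "(w z $ 1)\<^sup>2 + (w z $ 2)\<^sup>2 + (w z $ 3)\<^sup>2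
      = (z $ j + e)\<^sup>2 + z $ k * (z $ k + c * (z $ j + e) + z $ j * (z $ 3 - c))" for z
  proof -
    have "(w z $ 1)\<^sup>2 + (w z $ 2)\<^sup>2 + (w z $ 3)\<^sup>2 = (z $ j + e)\<^sup>2 + ((z $ k + B z) / 2)\<^sup>2 - ((z $ k - B z) / 2)\<^sup>2"
      by (simp add: w_def power_divide power_mult_distrib)
    also have "\<dots> = (z $ j + e)\<^sup>2 + z $ k * B z"
      by (simp add: field_simps power2_eq_square)
    finally show ?thesis by (simp add: B_def)
  qed
  ultimately show thesis using that by blast
qed

lemma fibre_const_eq: "fibre_const a b c = fibre_map a b (\<lambda>z. c)"
  by (simp add: fibre_const_def fibre_map_def R_const_eq extend_def)

text \<open>The embedding is given by \<open>fibre_map\<close>, whose kernel is generated by the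
  fibre cubic, and in the coordinates of \<open>node_coordinates\<close> that cubic is identically a
  sum of three squares, without a unit factor.\<close>

lemma fibre_type_A1:
  assumes ab: "a \<noteq> 0" "b \<noteq> 0" and z: "fibre_cubic a b z = 0" "\<forall>i. fibre_gradient a b i z = 0"
  shows "singularity_type_A 1 (fibre_ring a b) (fibre_const a b)
    (hypersurface.eval_at UNIV affine_generators (fibre_ring a b) (fibre_map a b) z)"
proof -
  interpret Fib: hypersurface "\<lambda>i (z::complex^3). z $ i" "\<lambda>u. \<chi> i. u i" "{}" UNIV affine_generators
    "fibre_ring a b" "fibre_map a b" "fibre_cubic a b" "fibre_gradient a b"
    by (rule fibre_hypersurface[OF ab])
  obtain w U where w: "analytic_coordinates w U z"
    "\<And>x. (w x $ 1)\<^sup>2 + (w x $ 2)\<^sup>2 + (w x $ 3)\<^sup>2 = fibre_cubic a b x"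
  proof -
    consider "a = b" "z = vector [0, - a, a + 1 / a]" | "b = 1 / a" "z = vector [- 1, 0, a + 1 / a]"
      using fibre_singular_iff[OF ab, of z] z by blast
    then show thesis
    proof cases
      case 1
      obtain w U where w: "analytic_coordinates w U z"
        "\<And>x. (w x $ 1)\<^sup>2 + (w x $ 2)\<^sup>2 + (w x $ 3)\<^sup>2
          = (x $ 2 + a)\<^sup>2 + x $ 1 * (x $ 1 + (a + 1 / a) * (x $ 2 + a) + x $ 2 * (x $ 3 - (a + 1 / a)))"
        using node_coordinates[of 2 1 a z "a + 1 / a"] ab 1 by auto
      have "(x $ 2 + a)\<^sup>2 + x $ 1 * (x $ 1 + (a + 1 / a) * (x $ 2 + a) + x $ 2 * (x $ 3 - (a + 1 / a)))
          = fibre_cubic a b x" for x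
        using ab unfolding 1(1)[symmetric] fibre_cubic_def by (simp add: field_simps power2_eq_square)
      then show thesis using that w by simp
    next
      case 2
      obtain w U where w: "analytic_coordinates w U z"
        "\<And>x. (w x $ 1)\<^sup>2 + (w x $ 2)\<^sup>2 + (w x $ 3)\<^sup>2
          = (x $ 1 + 1)\<^sup>2 + x $ 2 * (x $ 2 + (a + 1 / a) * (x $ 1 + 1) + x $ 1 * (x $ 3 - (a + 1 / a)))"
        using node_coordinates[of 1 2 1 z "a + 1 / a"] 2 by auto
      have "(x $ 1 + 1)\<^sup>2 + x $ 2 * (x $ 2 + (a + 1 / a) * (x $ 1 + 1) + x $ 1 * (x $ 3 - (a + 1 / a)))
          = fibre_cubic a b x" for x
        using ab unfolding 2(1) fibre_cubic_def by (simp add: field_simps power2_eq_square)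
      then show thesis using that w by simp
    qed
  qed
  show ?thesis
    unfolding singularity_type_A_def affine_3_space_eq
  proof (intro exI[of _ "fibre_map a b"] exI[of _ z] exI[of _ w] exI[of _ U] conjI allI)
    show "fibre_map a b \<in> ring_hom affine.A (fibre_ring a b)" by (rule Fib.hom)
    show "fibre_map a b ` carrier affine.A = carrier (fibre_ring a b)" using Fib.surj by simp
    show "fibre_map a b (\<lambda>z. c) = fibre_const a b c" for c by (simp add: fibre_const_eq)
    show "Fib.eval_at z (fibre_map a b (\<lambda>z. z $ i)) = z $ i" for i
      by (rule Fib.eval_at_\<pi>) (use z affine.coord_regular in auto)
    show "analytic_coordinates w U z" by (rule w)
    have "(\<lambda>x. (w x $ 1)\<^sup>2 + (w x $ 2)\<^sup>2 + (w x $ 3) ^ (1 + 1)) = fibre_cubic a b"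
      using w(2) by (simp add: fun_eq_iff numeral_2_eq_2)
    moreover have "analytically_generated_by (a_kernel affine.A (fibre_ring a b) (fibre_map a b)) (fibre_cubic a b) z"
      unfolding analytically_generated_by_def
    proof (intro conjI ballI)
      fix f assume "f \<in> a_kernel affine.A (fibre_ring a b) (fibre_map a b)"
      then have "f \<in> affine.reg" "fibre_map a b f = \<zero>\<^bsub>fibre_ring a b\<^esub>"
        unfolding a_kernel_def' coordinate_ring_simps by blast+
      then obtain g where "g \<in> affine.reg" "\<forall>x. f x = g x * fibre_cubic a b x"
        using Fib.kernel[of f] by blast
      then show "\<exists>W k. z \<in> W \<and> holomorphic_on_vec k W \<and> (\<forall>x\<in>W. f x = k x * fibre_cubic a b x)"
        using regular_holomorphic by (intro exI[of _ UNIV] exI[of _ g]) auto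
    next
      have "fibre_cubic a b \<in> a_kernel affine.A (fibre_ring a b) (fibre_map a b)"
        unfolding a_kernel_def' coordinate_ring_simps using Fib.F_regular Fib.\<pi>_F by blast
      then show "\<exists>F W k. finite F \<and> F \<subseteq> a_kernel affine.A (fibre_ring a b) (fibre_map a b) \<and> z \<in> W \<and> open W \<and>
          (\<forall>f\<in>F. holomorphic_on_vec (k f) W) \<and> (\<forall>x\<in>W. fibre_cubic a b x = (\<Sum>f\<in>F. k f x * f x))"
        by (intro exI[of _ "{fibre_cubic a b}"] exI[of _ UNIV] exI[of _ "\<lambda>_ _. 1"])
          (simp add: holomorphic_on_vec_const)
    qed
    ultimately show "analytically_generated_by (a_kernel affine.A (fibre_ring a b) (fibre_map a b))
        (\<lambda>x. (w x $ 1)\<^sup>2 + (w x $ 2)\<^sup>2 + (w x $ 3) ^ (1 + 1)) z" by simp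
  qed
qed

text \<open>A singular point is recovered from its coordinates, which makes the correspondence a
  bijection; counting singular points requires this, equality of images would not suffice.\<close>

lemma fibre_singular_points:
  assumes ab: "a \<noteq> 0" "b \<noteq> 0"
  defines "S \<equiv> singular_points (fibre_ring a b) (fibre_const a b)"
  shows "bij_betw (\<lambda>p. \<chi> i. p (fibre_map a b (\<lambda>z. z $ i))) S {z. ((a, b), z) \<in> singular_curve_1 \<union> singular_curve_2}"
    and "p \<in> S \<Longrightarrow> singularity_type_A 1 (fibre_ring a b) (fibre_const a b) p"
proof -
  interpret Fib: hypersurface "\<lambda>i (z::complex^3). z $ i" "\<lambda>u. \<chi> i. u i" "{}" UNIV affine_generators
    "fibre_ring a b" "fibre_map a b" "fibre_cubic a b" "fibre_gradient a b"
    by (rule fibre_hypersurface[OF ab])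
  define Z where "Z = {z. ((a, b), z) \<in> singular_curve_1 \<union> singular_curve_2}"
  have Z: "Z = {z \<in> UNIV. fibre_cubic a b z = 0 \<and> (\<forall>i. fibre_gradient a b i z = 0)}"
    using ab by (auto simp: Z_def singular_curves_iff simp del: Un_iff)
  have "Fib.scalar = fibre_const a b"
    by (simp add: fun_eq_iff Fib.scalar_def fibre_const_eq)
  moreover have "singular_points (fibre_ring a b) Fib.scalar = Fib.eval_at ` Z"
    unfolding Z by (rule Fib.singular_points_eq) (rule fibre_height_lower[OF ab])
  ultimately have S: "S = Fib.eval_at ` Z" by (simp add: S_def)
  have coords: "(\<chi> i. Fib.eval_at z (fibre_map a b (\<lambda>z. z $ i))) = z" if "z \<in> Z" for z
  proof -
    have "Fib.eval_at z (fibre_map a b (\<lambda>z. z $ i)) = z $ i" for i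
      by (rule Fib.eval_at_\<pi>) (use that Z affine.coord_regular in auto)
    then show ?thesis by (simp add: vec_eq_iff)
  qed
  show "bij_betw (\<lambda>p. \<chi> i. p (fibre_map a b (\<lambda>z. z $ i))) S {z. ((a, b), z) \<in> singular_curve_1 \<union> singular_curve_2}"
    unfolding Z_def[symmetric] S
    by (rule bij_betw_byWitness[where f' = Fib.eval_at]) (auto simp: coords)
  show "singularity_type_A 1 (fibre_ring a b) (fibre_const a b) p" if "p \<in> S"
    using that fibre_type_A1[OF ab] unfolding S Z by auto
qed

section \<open>The isomorphism over the parameter space and the count of singular points\<close>

lemma parameters_regular:
  assumes "k \<in> carrier param_ring"
  shows "(\<lambda>(t, x)\<in>family_ambient. k t) \<in> family.reg"
proof -
  have "(\<lambda>y\<in>family_ambient. k (fst y)) \<in> family.reg"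
    using assms unfolding param_ring_def coordinate_ring_simps
    by (rule regular_compose) (use regular_coords in \<open>auto simp: family_ambient_def\<close>)
  then show ?thesis by (simp add: case_prod_beta')
qed

text \<open>Makes the first isomorphism theorem applicable: a principal ideal consists of the
  multiples of its generator, and the kernel of \<open>pullback\<close> is described in the same
  way.\<close>

lemma family_ideal_eq: "family_ideal = a_kernel family.A R_ring pullback"
proof -
  interpret cring family.A by (rule cring_coordinate_ring)
  have "family_ideal = PIdl\<^bsub>family.A\<^esub> (restrict cubic family_ambient)"
    unfolding family_ideal_def family_ambient_ring_eq
    by (rule cgenideal_eq_genideal[symmetric]) (use cubic_regular in simp)
  also have "\<dots> = {f \<in> family.reg. \<exists>g\<in>family.reg. \<forall>x\<in>family_ambient. f x = g x * restrict cubic family_ambient x}"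
  proof (intro equalityI subsetI)
    fix f assume "f \<in> PIdl\<^bsub>family.A\<^esub> (restrict cubic family_ambient)"
    then obtain g where "g \<in> family.reg" "f = (\<lambda>x\<in>family_ambient. g x * restrict cubic family_ambient x)"
      unfolding cgenideal_def by auto
    then show "f \<in> {f \<in> family.reg. \<exists>g\<in>family.reg. \<forall>x\<in>family_ambient. f x = g x * restrict cubic family_ambient x}"
      using cubic_regular regular_functions.mult[of g family_ambient family_generators "restrict cubic family_ambient"]
      by auto
  next
    fix f assume "f \<in> {f \<in> family.reg. \<exists>g\<in>family.reg. \<forall>x\<in>family_ambient. f x = g x * restrict cubic family_ambient x}"
    then obtain g where g: "f \<in> family.reg" "g \<in> family.reg"
      "\<forall>x\<in>family_ambient. f x = g x * restrict cubic family_ambient x" by blast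
    have "f = (\<lambda>x\<in>family_ambient. g x * restrict cubic family_ambient x)"
      by (rule regular_eqI[OF g(1) regular_functions.mult[OF g(2) cubic_regular]]) (use g(3) in simp)
    then show "f \<in> PIdl\<^bsub>family.A\<^esub> (restrict cubic family_ambient)"
      unfolding cgenideal_def using g(2) by auto
  qed
  also have "\<dots> = a_kernel family.A R_ring pullback"
    unfolding a_kernel_def' using R.kernel by auto
  finally show ?thesis .
qed

theorem mainTheorem5:
  shows "\<exists>h \<in> ring_iso family_ring R_ring.
    (\<forall>k \<in> carrier param_ring. h (family_structure k) = R_structure k) \<and>
    (let x = (\<lambda>i::3. h (family_coordinate i)) in
      (\<lambda>p. ((p R_alpha, p R_beta), \<chi> i. p (x i))) ` singular_points R_ring R_const
        = singular_curve_1 \<union> singular_curve_2 \<and>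
      singular_curve_1 \<inter> singular_curve_2 = {} \<and>
      (\<forall>a b. a \<noteq> 0 \<and> b \<noteq> 0 \<longrightarrow>
        (let S = singular_points (fibre_ring a b) (fibre_const a b) in
          (a \<noteq> b \<and> a \<noteq> 1 / b \<longrightarrow> S = {}) \<and>
          (\<lambda>p. \<chi> i. p (to_fibre a b (x i))) ` S
            = {z. ((a, b), z) \<in> singular_curve_1 \<union> singular_curve_2} \<and>
          (\<forall>p\<in>S. singularity_type_A 1 (fibre_ring a b) (fibre_const a b) p) \<and>
          (a \<noteq> 1 \<and> a \<noteq> - 1 \<and> (b = a \<or> b = 1 / a) \<longrightarrow> card S = 1) \<and>
          (a = b \<and> (a = 1 \<or> a = - 1) \<longrightarrow> card S = 2))))"
proof -
  \<comment> \<open>The map induced on cosets: \<open>pullback\<close> is constant on each coset of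
    its kernel, so the image is a singleton.\<close>
  define h where "h X = the_elem (pullback ` X)" for X
  have iso: "h \<in> ring_iso family_ring R_ring"
    unfolding family_ring_def family_ideal_eq family_ambient_ring_eq h_def[abs_def]
    by (rule R.hom.FactRing_iso_set) (use R.surj in simp)
  have h: "h (family_ideal +>\<^bsub>family_ambient_ring\<^esub> f) = pullback f" if "f \<in> family.reg" for f
    using R.hom.the_elem_simp[of f] that
    unfolding h_def family_ideal_eq family_ambient_ring_eq by simp
  have structure_map: "h (family_structure k) = R_structure k" if "k \<in> carrier param_ring" for k
    unfolding family_structure_def h[OF parameters_regular[OF that]] pullback_def R_structure_def
    by (rule restrict_ext) (use quotient_map_mem(1) in \<open>auto simp: case_prod_beta' quotient_map_components\<close>)
  have ext_coord: "extend (\<lambda>x. x $ i) = (\<lambda>y\<in>family_ambient. snd y $ i)" for i by (simp add: extend_def)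
  have coordinate: "h (family_coordinate i) = pullback (extend (\<lambda>x. x $ i))" for i
    using h[OF regular_coords(5), of i]
    by (simp add: family_coordinate_def ext_coord case_prod_beta')
  have total: "(\<lambda>p. ((p R_alpha, p R_beta), \<chi> i. p (h (family_coordinate i)))) ` singular_points R_ring R_const
      = singular_curve_1 \<union> singular_curve_2"
  proof -
    have "singular_points R_ring R_const = R.eval_at ` (singular_curve_1 \<union> singular_curve_2)"
    proof -
      have "singular_points R_ring R.scalar = R.eval_at ` {z \<in> family_ambient.
          restrict cubic family_ambient z = 0 \<and> (\<forall>i. family_gradient i z = 0)}"
        by (rule R.singular_points_eq) (rule R_height_lower)
      also have "{z \<in> family_ambient. restrict cubic family_ambient z = 0 \<and> (\<forall>i. family_gradient i z = 0)}
          = singular_curve_1 \<union> singular_curve_2"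
        using family_singular_iff by blast
      finally show ?thesis by (simp only: R_scalar)
    qed
    moreover have "((R.eval_at z R_alpha, R.eval_at z R_beta), \<chi> i. R.eval_at z (h (family_coordinate i))) = z"
      if "z \<in> singular_curve_1 \<union> singular_curve_2" for z
    proof -
      have z: "z \<in> family_ambient" "restrict cubic family_ambient z = 0"
        using family_singular_iff that by blast+
      show ?thesis
        unfolding R_alpha_eq R_beta_eq coordinate ext_coord
        using z(1) R.eval_at_\<pi>[OF z] regular_coords by (simp add: prod_eq_iff vec_eq_iff)
    qed
    ultimately show ?thesis by (simp add: image_image)
  qed
  have disjoint: "singular_curve_1 \<inter> singular_curve_2 = {}"
    by (auto simp: singular_curve_1_def singular_curve_2_def vec_eq_iff forall_3)
  have fibres: "(a \<noteq> b \<and> a \<noteq> 1 / b \<longrightarrow> S = {}) \<and>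
      (\<lambda>p. \<chi> i. p (to_fibre a b (h (family_coordinate i)))) ` S
        = {z. ((a, b), z) \<in> singular_curve_1 \<union> singular_curve_2} \<and>
      (\<forall>p\<in>S. singularity_type_A 1 (fibre_ring a b) (fibre_const a b) p) \<and>
      (a \<noteq> 1 \<and> a \<noteq> - 1 \<and> (b = a \<or> b = 1 / a) \<longrightarrow> card S = 1) \<and>
      (a = b \<and> (a = 1 \<or> a = - 1) \<longrightarrow> card S = 2)"
    if ab: "a \<noteq> 0" "b \<noteq> 0" and S: "S = singular_points (fibre_ring a b) (fibre_const a b)" for a b S
  proof -
    define Z where "Z = {z. ((a, b), z) \<in> singular_curve_1 \<union> singular_curve_2}"
    let ?v1 = "vector [0, - a, a + 1 / a] :: complex^3"
    let ?v2 = "vector [- 1, 0, a + 1 / a] :: complex^3"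
    \<comment> \<open>Each curve meets a fibre in at most one point, and the two points differ, so
      the count depends only on which of \<open>a = b\<close> and \<open>b = 1 / a\<close>
      hold.\<close>
    have Z: "Z = (if a = b then {?v1} else {}) \<union> (if b = 1 / a then {?v2} else {})"
      using ab by (auto simp: Z_def singular_curve_1_def singular_curve_2_def)
    have v: "?v1 \<noteq> ?v2" by (simp add: vec_eq_iff forall_3)
    have bij: "bij_betw (\<lambda>p. \<chi> i. p (to_fibre a b (h (family_coordinate i)))) S Z"
      using fibre_singular_points(1)[OF ab] unfolding S Z_def coordinate fibre_map_def .
    have card: "card S = card Z" using bij by (rule bij_betw_same_card)
    have "S = {}" if "a \<noteq> b" "a \<noteq> 1 / b"
    proof -
      have "b \<noteq> 1 / a" using that(2) ab by (auto simp: field_simps)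
      then have "Z = {}" using that(1) by (simp add: Z)
      then show ?thesis using bij by (simp add: bij_betw_def)
    qed
    moreover have "card Z = 1" if "a \<noteq> 1" "a \<noteq> - 1" "b = a \<or> b = 1 / a"
    proof -
      have "a \<noteq> 1 / a"
      proof
        assume "a = 1 / a"
        then have "a\<^sup>2 = 1" using ab by (simp add: field_simps power2_eq_square)
        then show False using that(1,2) by (simp add: power2_eq_1_iff)
      qed
      then show ?thesis using that(3) by (auto simp: Z)
    qed
    moreover have "card Z = 2" if "a = b" "a = 1 \<or> a = - 1"
    proof -
      have "b = 1 / a" using that by auto
      then have "Z = {?v1, ?v2}" using that(1) by (auto simp: Z)
      then show ?thesis using v by simp
    qed
    moreover have "(\<lambda>p. \<chi> i. p (to_fibre a b (h (family_coordinate i)))) ` S = Z"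
      using bij by (simp add: bij_betw_def)
    ultimately show ?thesis
      using fibre_singular_points(2)[OF ab] card unfolding S Z_def by auto
  qed
  show ?thesis
    unfolding Let_def using iso structure_map total disjoint fibres[OF _ _ refl] by (intro bexI[of _ h]) blast+
qed

end
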